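(* Let $\delta\ge0$ and let $D$ be a $\delta$-hyperbolic digraph that satisfies (B1) and (B2) for the function $f\colon\mathbb R\to\mathbb R$ and that has a finite base $S$. Let $\varepsilon>0$ be such that $e^{2\varepsilon(6\delta+2\delta f(\delta+1))}<\sqrt2$. Then the following hold for $D\cup\partial D$ equipped with $d_{S,\varepsilon}$. (i) If every vertex of $D$ has finite out-degree and $D\cup\partial D$ is a semimetric space, then $D\cup\partial D$ is f-complete. (ii) If every vertex of $D$ has finite in-degree and $D\cup\partial D$ is a semimetric space, then $D\cup\partial D$ is b-complete.
   Context: Digraphs may have loops, parallel edges and oppositely oriented edges. A directed path in $D$ is a sequence $x_0\ldots x_n$ of vertices with every $x_ix_{i+1}$ an edge; its length $\ell$ is $n$. $d(x,y)$ is the length of a shortest directed path from $x$ to $y$, or $\infty$ if there is none. $D$ is regarded as the space $X=V(D)$ with the (non-symmetric) distance $d$ and these directed paths; a directed path from $x$ to $y$ is a geodesic if its length is $d(x,y)$. The out-degree (in-degree) of $x$ is the number of $y$ with $d(x,y)=1$ ($d(y,x)=1$). $\mathcal B^+_r(x)=\{y: d(x,y)\le r\}$, $\mathcal B^-_r(x)=\{y:d(y,x)\le r\}$, and $\mathcal B^\pm_r(Y)=\bigcup_{y\in Y}\mathcal B^\pm_r(y)$. A geodesic triangle consists of three points and three geodesics (its sides), one between every two of these points (in one of the two directions). It is $\delta$-thin if for every labelling $P,Q,R$ of its sides such that the starting point of $P$ is the starting or the end point of $Q$ and the end point of $P$ is the starting or the end point of $R$, we have $P\subseteq\mathcal B^+_\delta(Q)\cup\mathcal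 B^-_\delta(R)$. $D$ is $\delta$-hyperbolic if all geodesic triangles are $\delta$-thin. (B1) for $f$: for all $x$, $r\ge0$ and $y,z\in\mathcal B^+_r(x)$, $d(y,z)$ is either $\infty$ or at most $f(r)$. (B2) for $f$: the same with $\mathcal B^-_r(x)$ in place of $\mathcal B^+_r(x)$. A ray is a sequence $R=x_0x_1\ldots$ of distinct vertices with edges $x_ix_{i+1}$; an anti-ray is such a sequence with edges $x_{i+1}x_i$; in both cases $R(i)=x_i$. A directed path $P$ is a $(\gamma,c)$-quasi-geodesic if $\ell(uPv)\le\gamma d(u,v)+c$ for every directed subpath $uPv$ of $P$; a (anti-)ray is quasi-geodesic if for some $\gamma\ge1,c\ge0$ all its finite directed subpaths are $(\gamma,c)$-quasi-geodesics. For quasi-geodesic rays or anti-rays write $R_1\le R_2$ if there is $M\ge0$ such that for every $r\ge0$ and every $x$ there is a directed path from $R_1$ to $R_2$ of length at most $M$ outside of $\mathcal B^+_r(x)\cup\mathcal B^-_r(x)$; $R_1\approx R_2$ means $R_1\le R_2\le R_1$, an equivalence relation under the hypotheses. The quasi-geodesic boundary $\partial D$ is the set of its classes; $D\cup\partial D$ means $V(D)\cup\partial D$. Let $d^{\leftrightarrow}(x,y)=\min\{d(x,y),d(y,x)\}$ and $d^{\leftrightarrow}(s,P)=\min_{p\text{ on }P}d^{\leftrightarrow}(s,p)$. $S\subseteq V(D)$ is a base if for every vertex $x$ there is $s\in S$ with $d^{\leftrightarrow}(x,s)<\infty$. Let $\varepsilon>0$, $s\in S$, $\eta,\mu\in V(D)\cup\partial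 D$. If $\eta\in V(D)$, let its only representative be the constant map $R(i)=\eta$; if $\eta\in\partial D$, its representatives are its elements. For representatives $R$ of $\eta$ and $Q$ of $\mu$ let $L_s(R,Q)=\liminf_{i,j\to\infty}\{d^{\leftrightarrow}(s,P): P\text{ an }R(i)\text{-}Q(j)\text{ geodesic}\}=\sup_n\inf\{d^{\leftrightarrow}(s,P): i,j\ge n,\ P\text{ an }R(i)\text{-}Q(j)\text{ geodesic}\}$, with $L_s(R,Q)=-\infty$ if for some $n$ there is no such geodesic with $i,j\ge n$. Put $\rho^\varepsilon_s(\eta,\mu)=\inf_{R,Q}e^{-\varepsilon L_s(R,Q)}$ (with $e^{-\infty}=0,e^\infty=\infty$), with $\rho_s^\varepsilon(x,x)=0$ for $x\in V(D)$; $\rho^\varepsilon_S=\max_{s\in S}\rho^\varepsilon_s$; and $$d_{S,\varepsilon}(\eta,\mu)=\inf\Big\{\sum_{i=0}^{n-1}\rho^\varepsilon_S(\eta_i,\eta_{i+1}) : n\in\mathbb N,\ \eta=\eta_0,\ldots,\eta_n=\mu\in V(D)\cup\partial D\Big\}.$$ Under the hypotheses $d_{S,\varepsilon}$ is a pseudo-semimetric (it vanishes on the diagonal and satisfies the triangle inequality); it is a semimetric, and $D\cup\partial D$ a semimetric space, if moreover $d_{S,\varepsilon}(\eta,\mu)=0$ implies $\eta=\mu$. For a semimetric space $(Y,\rho)$, a sequence f-converges (b-converges) to a point if it converges to it in the topology generated by the open out-balls $\{y:\rho(x,y)<r\}$ (the open in-balls $\{y:\rho(y,x)<r\}$). A sequence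 $(x_i)$ is f-Cauchy if for every $\varepsilon_0>0$ there is $N$ with $\rho(x_n,x_m)<\varepsilon_0$ for all $m\ge n\ge N$, and b-Cauchy if for every $\varepsilon_0>0$ there is $N$ with $\rho(x_m,x_n)<\varepsilon_0$ for all $m\ge n\ge N$. $Y$ is f-complete if every f-Cauchy sequence b-converges to a point of $Y$, and b-complete if every b-Cauchy sequence f-converges to a point of $Y$. *)

theory Defs
  imports
    "HOL-Analysis.Analysis"
    "HOL-Library.Sublist"
    "Graph_Theory.Vertex_Walk"
begin

section \<open>Digraphs as spaces with a non-symmetric distance\<close>

text \<open>
  A directed path is a \<^const>\<open>vwalk\<close>: a nonempty sequence of vertices, consecutive ones joined by
  an edge, with repetitions allowed. Its length is \<^const>\<open>vwalk_length\<close>.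
\<close>

text \<open>The infimum is that of a set of natural numbers, so it is attained or the set is empty, in
  which case the value is \<open>\<infinity>\<close>.\<close>
definition ddist :: "('a,'b) pre_digraph \<Rightarrow> 'a \<Rightarrow> 'a \<Rightarrow> ereal" where
  "ddist G x y = (INF p \<in> {p. vwalk p G \<and> hd p = x \<and> last p = y}. ereal (real (vwalk_length p)))"

definition geodesic :: "('a,'b) pre_digraph \<Rightarrow> 'a list \<Rightarrow> 'a \<Rightarrow> 'a \<Rightarrow> bool" where
  "geodesic G p x y \<longleftrightarrow>
     vwalk p G \<and> hd p = x \<and> last p = y \<and> ereal (real (vwalk_length p)) = ddist G x y"

definition finite_out_degree :: "('a,'b) pre_digraph \<Rightarrow> 'a \<Rightarrow> bool" where
  "finite_out_degree G x \<longleftrightarrow> finite {y \<in> verts G. ddist G x y = 1}"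

definition finite_in_degree :: "('a,'b) pre_digraph \<Rightarrow> 'a \<Rightarrow> bool" where
  "finite_in_degree G x \<longleftrightarrow> finite {y \<in> verts G. ddist G y x = 1}"

definition out_ball :: "('a,'b) pre_digraph \<Rightarrow> real \<Rightarrow> 'a \<Rightarrow> 'a set" where
  "out_ball G r x = {y \<in> verts G. ddist G x y \<le> ereal r}"

definition in_ball :: "('a,'b) pre_digraph \<Rightarrow> real \<Rightarrow> 'a \<Rightarrow> 'a set" where
  "in_ball G r x = {y \<in> verts G. ddist G y x \<le> ereal r}"

definition B1 :: "('a,'b) pre_digraph \<Rightarrow> (real \<Rightarrow> real) \<Rightarrow> bool" where
  "B1 G f \<longleftrightarrow> (\<forall>x\<in>verts G. \<forall>r\<ge>0. \<forall>y\<in>out_ball G r x. \<forall>z\<in>out_ball G r x.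
     ddist G y z = \<infinity> \<or> ddist G y z \<le> ereal (f r))"

definition B2 :: "('a,'b) pre_digraph \<Rightarrow> (real \<Rightarrow> real) \<Rightarrow> bool" where
  "B2 G f \<longleftrightarrow> (\<forall>x\<in>verts G. \<forall>r\<ge>0. \<forall>y\<in>in_ball G r x. \<forall>z\<in>in_ball G r x.
     ddist G y z = \<infinity> \<or> ddist G y z \<le> ereal (f r))"

section \<open>Hyperbolicity\<close>

text \<open>The three points need not be distinct.\<close>
definition geodesic_triangle ::
    "('a,'b) pre_digraph \<Rightarrow> 'a \<Rightarrow> 'a \<Rightarrow> 'a \<Rightarrow> 'a list \<Rightarrow> 'a list \<Rightarrow> 'a list \<Rightarrow> bool" where
  "geodesic_triangle G x y z A B C \<longleftrightarrow>
     (geodesic G A x y \<or> geodesic G A y x) \<and>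
     (geodesic G B y z \<or> geodesic G B z y) \<and>
     (geodesic G C z x \<or> geodesic G C x z)"

definition thin_triangle ::
    "('a,'b) pre_digraph \<Rightarrow> real \<Rightarrow> 'a list \<Rightarrow> 'a list \<Rightarrow> 'a list \<Rightarrow> bool" where
  "thin_triangle G \<delta> A B C \<longleftrightarrow>
     (\<forall>P Q R. mset [P, Q, R] = mset [A, B, C] \<longrightarrow>
        hd P \<in> {hd Q, last Q} \<longrightarrow> last P \<in> {hd R, last R} \<longrightarrow>
        set P \<subseteq> (\<Union>q\<in>set Q. out_ball G \<delta> q) \<union> (\<Union>q\<in>set R. in_ball G \<delta> q))"

definition hyperbolic :: "('a,'b) pre_digraph \<Rightarrow> real \<Rightarrow> bool" where
  "hyperbolic G \<delta> \<longleftrightarrow>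
     (\<forall>x y z A B C. geodesic_triangle G x y z A B C \<longrightarrow> thin_triangle G \<delta> A B C)"

section \<open>The quasi-geodesic boundary\<close>

definition quasi_geodesic :: "('a,'b) pre_digraph \<Rightarrow> real \<Rightarrow> real \<Rightarrow> 'a list \<Rightarrow> bool" where
  "quasi_geodesic G \<gamma> c P \<longleftrightarrow> vwalk P G \<and>
     (\<forall>p. sublist p P \<longrightarrow> p \<noteq> [] \<longrightarrow>
        ereal (real (vwalk_length p)) \<le> ereal \<gamma> * ddist G (hd p) (last p) + ereal c)"

definition ray :: "('a,'b) pre_digraph \<Rightarrow> (nat \<Rightarrow> 'a) \<Rightarrow> bool" where
  "ray G R \<longleftrightarrow> inj R \<and> range R \<subseteq> verts G \<and> (\<forall>i. (R i, R (Suc i)) \<in> arcs_ends G)"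

definition anti_ray :: "('a,'b) pre_digraph \<Rightarrow> (nat \<Rightarrow> 'a) \<Rightarrow> bool" where
  "anti_ray G R \<longleftrightarrow> inj R \<and> range R \<subseteq> verts G \<and> (\<forall>i. (R (Suc i), R i) \<in> arcs_ends G)"

definition quasi_geodesic_ray :: "('a,'b) pre_digraph \<Rightarrow> (nat \<Rightarrow> 'a) \<Rightarrow> bool" where
  "quasi_geodesic_ray G R \<longleftrightarrow> ray G R \<and>
     (\<exists>\<gamma>\<ge>1. \<exists>c\<ge>0. \<forall>i j. i \<le> j \<longrightarrow> quasi_geodesic G \<gamma> c (map R [i..<Suc j]))"

definition quasi_geodesic_anti_ray :: "('a,'b) pre_digraph \<Rightarrow> (nat \<Rightarrow> 'a) \<Rightarrow> bool" where
  "quasi_geodesic_anti_ray G R \<longleftrightarrow> anti_ray G R \<and>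
     (\<exists>\<gamma>\<ge>1. \<exists>c\<ge>0. \<forall>i j. i \<le> j \<longrightarrow> quasi_geodesic G \<gamma> c (rev (map R [i..<Suc j])))"

definition qg_rays :: "('a,'b) pre_digraph \<Rightarrow> (nat \<Rightarrow> 'a) set" where
  "qg_rays G = {R. quasi_geodesic_ray G R \<or> quasi_geodesic_anti_ray G R}"

definition ray_le :: "('a,'b) pre_digraph \<Rightarrow> (nat \<Rightarrow> 'a) \<Rightarrow> (nat \<Rightarrow> 'a) \<Rightarrow> bool" where
  "ray_le G R1 R2 \<longleftrightarrow> (\<exists>M::real. M \<ge> 0 \<and> (\<forall>r\<ge>0. \<forall>x\<in>verts G. \<exists>p.
     vwalk p G \<and> hd p \<in> range R1 \<and> last p \<in> range R2 \<and> real (vwalk_length p) \<le> M \<and>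
     set p \<inter> (out_ball G r x \<union> in_ball G r x) = {}))"

definition ray_equiv :: "('a,'b) pre_digraph \<Rightarrow> ((nat \<Rightarrow> 'a) \<times> (nat \<Rightarrow> 'a)) set" where
  "ray_equiv G = {(R1, R2). R1 \<in> qg_rays G \<and> R2 \<in> qg_rays G \<and> ray_le G R1 R2 \<and> ray_le G R2 R1}"

definition qg_boundary :: "('a,'b) pre_digraph \<Rightarrow> (nat \<Rightarrow> 'a) set set" where
  "qg_boundary G = qg_rays G // ray_equiv G"

text \<open>Vertices are tagged \<^const>\<open>Inl\<close>, boundary points \<^const>\<open>Inr\<close>.\<close>
type_synonym 'a bpoint = "'a + (nat \<Rightarrow> 'a) set"

definition with_boundary :: "('a,'b) pre_digraph \<Rightarrow> 'a bpoint set" where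
  "with_boundary G = verts G <+> qg_boundary G"

section \<open>The visual pseudo-semimetric\<close>

definition sdist :: "('a,'b) pre_digraph \<Rightarrow> 'a \<Rightarrow> 'a \<Rightarrow> ereal" where
  "sdist G x y = min (ddist G x y) (ddist G y x)"

definition sdist_path :: "('a,'b) pre_digraph \<Rightarrow> 'a \<Rightarrow> 'a list \<Rightarrow> ereal" where
  "sdist_path G s P = Min (sdist G s ` set P)"

definition is_base :: "('a,'b) pre_digraph \<Rightarrow> 'a set \<Rightarrow> bool" where
  "is_base G S \<longleftrightarrow> S \<subseteq> verts G \<and> (\<forall>x\<in>verts G. \<exists>s\<in>S. sdist G x s < \<infinity>)"

fun representatives :: "'a bpoint \<Rightarrow> (nat \<Rightarrow> 'a) set" where
  "representatives (Inl x) = {\<lambda>_. x}"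
| "representatives (Inr \<eta>) = \<eta>"

definition tail_geodesics ::
    "('a,'b) pre_digraph \<Rightarrow> (nat \<Rightarrow> 'a) \<Rightarrow> (nat \<Rightarrow> 'a) \<Rightarrow> nat \<Rightarrow> 'a list set" where
  "tail_geodesics G R Q n = {P. \<exists>i j. n \<le> i \<and> n \<le> j \<and> geodesic G P (R i) (Q j)}"

definition visual_L :: "('a,'b) pre_digraph \<Rightarrow> 'a \<Rightarrow> (nat \<Rightarrow> 'a) \<Rightarrow> (nat \<Rightarrow> 'a) \<Rightarrow> ereal" where
  "visual_L G s R Q =
     (if \<exists>n. tail_geodesics G R Q n = {} then -\<infinity>
      else SUP n. INF P \<in> tail_geodesics G R Q n. sdist_path G s P)"

definition eexp :: "ereal \<Rightarrow> ereal" where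
  "eexp x = (case x of ereal t \<Rightarrow> ereal (exp t) | PInfty \<Rightarrow> \<infinity> | MInfty \<Rightarrow> 0)"

definition visual_rho ::
    "('a,'b) pre_digraph \<Rightarrow> real \<Rightarrow> 'a \<Rightarrow> 'a bpoint \<Rightarrow> 'a bpoint \<Rightarrow> ereal" where
  "visual_rho G \<epsilon> s \<eta> \<mu> =
     (if \<eta> = \<mu> \<and> \<eta> \<in> range Inl then 0
      else INF (R, Q) \<in> representatives \<eta> \<times> representatives \<mu>.
             eexp (- (ereal \<epsilon> * visual_L G s R Q)))"

text \<open>Used for finite \<open>S\<close> only. If \<open>S\<close> is a base and empty, then so are the vertex set and its
  extension by the boundary, and the value is irrelevant.\<close>
definition visual_rho_base ::
    "('a,'b) pre_digraph \<Rightarrow> real \<Rightarrow> 'a set \<Rightarrow> 'a bpoint \<Rightarrow> 'a bpoint \<Rightarrow> ereal" where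
  "visual_rho_base G \<epsilon> S \<eta> \<mu> = Max ((\<lambda>s. visual_rho G \<epsilon> s \<eta> \<mu>) ` S)"

definition visual_dist ::
    "('a,'b) pre_digraph \<Rightarrow> 'a set \<Rightarrow> real \<Rightarrow> 'a bpoint \<Rightarrow> 'a bpoint \<Rightarrow> ereal" where
  "visual_dist G S \<epsilon> \<eta> \<mu> =
     Inf {(\<Sum>i<n. visual_rho_base G \<epsilon> S (c i) (c (Suc i))) | (n::nat) c.
            c 0 = \<eta> \<and> c n = \<mu> \<and> (\<forall>i\<le>n. c i \<in> with_boundary G)}"

section \<open>Semimetric spaces and completeness\<close>

definition semimetric_on :: "'p set \<Rightarrow> ('p \<Rightarrow> 'p \<Rightarrow> ereal) \<Rightarrow> bool" where
  "semimetric_on Y \<rho> \<longleftrightarrow>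
     (\<forall>x\<in>Y. \<forall>y\<in>Y. 0 \<le> \<rho> x y) \<and>
     (\<forall>x\<in>Y. \<rho> x x = 0) \<and>
     (\<forall>x\<in>Y. \<forall>y\<in>Y. \<forall>z\<in>Y. \<rho> x z \<le> \<rho> x y + \<rho> y z) \<and>
     (\<forall>x\<in>Y. \<forall>y\<in>Y. \<rho> x y = 0 \<longrightarrow> x = y)"

definition f_topology :: "'p set \<Rightarrow> ('p \<Rightarrow> 'p \<Rightarrow> ereal) \<Rightarrow> 'p topology" where
  "f_topology Y \<rho> = topology_generated_by {{y \<in> Y. \<rho> x y < ereal r} | x r. x \<in> Y \<and> r > 0}"

definition b_topology :: "'p set \<Rightarrow> ('p \<Rightarrow> 'p \<Rightarrow> ereal) \<Rightarrow> 'p topology" where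
  "b_topology Y \<rho> = topology_generated_by {{y \<in> Y. \<rho> y x < ereal r} | x r. x \<in> Y \<and> r > 0}"

definition f_Cauchy :: "'p set \<Rightarrow> ('p \<Rightarrow> 'p \<Rightarrow> ereal) \<Rightarrow> (nat \<Rightarrow> 'p) \<Rightarrow> bool" where
  "f_Cauchy Y \<rho> \<sigma> \<longleftrightarrow> range \<sigma> \<subseteq> Y \<and>
     (\<forall>e>0. \<exists>N. \<forall>n m. N \<le> n \<longrightarrow> n \<le> m \<longrightarrow> \<rho> (\<sigma> n) (\<sigma> m) < ereal e)"

definition b_Cauchy :: "'p set \<Rightarrow> ('p \<Rightarrow> 'p \<Rightarrow> ereal) \<Rightarrow> (nat \<Rightarrow> 'p) \<Rightarrow> bool" where
  "b_Cauchy Y \<rho> \<sigma> \<longleftrightarrow> range \<sigma> \<subseteq> Y \<and>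
     (\<forall>e>0. \<exists>N. \<forall>n m. N \<le> n \<longrightarrow> n \<le> m \<longrightarrow> \<rho> (\<sigma> m) (\<sigma> n) < ereal e)"

text \<open>The directions are crossed on purpose: f-Cauchy sequences are required to b-converge, and
  vice versa.\<close>
definition f_complete :: "'p set \<Rightarrow> ('p \<Rightarrow> 'p \<Rightarrow> ereal) \<Rightarrow> bool" where
  "f_complete Y \<rho> \<longleftrightarrow>
     (\<forall>\<sigma>. f_Cauchy Y \<rho> \<sigma> \<longrightarrow> (\<exists>l\<in>Y. limitin (b_topology Y \<rho>) \<sigma> l sequentially))"

definition b_complete :: "'p set \<Rightarrow> ('p \<Rightarrow> 'p \<Rightarrow> ereal) \<Rightarrow> bool" where
  "b_complete Y \<rho> \<longleftrightarrow>
     (\<forall>\<sigma>. b_Cauchy Y \<rho> \<sigma> \<longrightarrow> (\<exists>l\<in>Y. limitin (f_topology Y \<rho>) \<sigma> l sequentially))"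

end

theory Submission
  imports Defs
begin

text \<open>
  Let \<open>x \<rightarrow> y \<rightarrow> z\<close> be vertices joined by directed paths. Thinness of triangles, combined with
  the bounds on balls, shows that every vertex of a geodesic from \<open>x\<close> to \<open>z\<close> lies at most \<open>\<kappa>\<close> steps
  before some vertex of the other two sides, and also at most \<open>\<kappa>\<close> steps after such a vertex
  (\<open>forward_close\<close>, \<open>backward_close\<close>); here \<open>\<kappa> \<le> 6 \<delta> + 2 \<delta> f(\<delta> + 1)\<close>. Having both directions is what
  makes a non-symmetric distance behave: for a base vertex \<open>s\<close> the weight \<open>exp (- \<epsilon> d\<^sup>\<leftrightarrow>(s, p))\<close> of a
  vertex \<open>p\<close> of the first side is at most \<open>K = exp (\<epsilon> \<kappa>)\<close> times the weight of a vertex of the others.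
  The assumption on \<open>\<epsilon>\<close> gives \<open>K\<^sup>2 \<le> 2\<close>, and the classical halving argument then bounds the weight on
  a geodesic from \<open>x\<close> to \<open>z\<close> by twice the total cost of any chain of geodesics from \<open>x\<close> to \<open>z\<close>
  (\<open>chain_seg_le\<close>).

  A boundary point that occurs in the middle of a chain can be replaced by vertices far out on its
  representatives. So if \<open>\<eta>\<close> and \<open>\<mu>\<close> have distance less than \<open>t\<close>, then any two of their representatives
  are joined, arbitrarily far out, by chains of vertices of cost \<open>t\<close> (\<open>visual_dist_less_link\<close>).

  Now let \<open>\<sigma>\<close> be f-Cauchy and all out-degrees finite. It suffices to find a point to which infinitely
  many members of \<open>\<sigma>\<close> have arbitrarily small distance. If a value is repeated infinitely often, take
  that value. If infinitely many members are vertices or contain a ray, choose vertices \<open>y\<^sub>m\<close> far out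
  on representatives \<open>R\<^sub>m\<close> of a subsequence, in such a way that longer and longer parts of all earlier
  \<open>R\<^sub>k\<close> reach \<open>y\<^sub>m\<close>. By Koenig's lemma geodesics from a fixed vertex to the \<open>y\<^sub>m\<close> subconverge to a geodesic
  ray, and the class of that ray is the limit (\<open>ray_limit\<close>). Otherwise almost all members contain
  anti-rays only. A vertex reaching the whole of such an anti-ray would give rise to a ray at distance
  0 from its class (\<open>ray_below_backward_ray\<close>), hence, in a semimetric space, to a ray inside the class.
  So no vertex does, and then the geodesics between two such anti-rays leave every bounded region
  (\<open>backward_rays_far\<close>): two of these classes at finite distance have distance 0 and are equal, and
  \<open>\<sigma>\<close> is eventually constant.

  Reversing all edges exchanges rays with anti-rays and the two notions of completeness, which gives
  the statement on in-degrees.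
\<close>

section \<open>Spaces of directed geodesics\<close>

text \<open>A digraph is seen through its reachability relation and its hop count \<open>d\<close>, whose values are
  meaningful on reachable pairs only. The axioms are invariant under exchanging the two arguments of
  both, so every statement proved from them also holds for the reversed digraph.\<close>
locale directed_space =
  fixes V :: "'a set" and reach :: "'a \<Rightarrow> 'a \<Rightarrow> bool" and d :: "'a \<Rightarrow> 'a \<Rightarrow> nat"
  assumes reach_in: "reach x y \<Longrightarrow> x \<in> V \<and> y \<in> V"
    and reach_refl: "x \<in> V \<Longrightarrow> reach x x"
    and reach_trans: "reach x y \<Longrightarrow> reach y z \<Longrightarrow> reach x z"
    and d_zero_iff: "reach x y \<Longrightarrow> d x y = 0 \<longleftrightarrow> x = y"
    and d_triangle: "reach x y \<Longrightarrow> reach y z \<Longrightarrow> d x z \<le> d x y + d y z"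
    and d_between: "reach x y \<Longrightarrow> k \<le> d x y \<Longrightarrow>
          \<exists>z. reach x z \<and> reach z y \<and> d x z = k \<and> d z y = d x y - k"
begin

definition reaches :: "nat \<Rightarrow> 'a \<Rightarrow> 'a \<Rightarrow> bool" where
  "reaches n x y \<longleftrightarrow> reach x y \<and> d x y \<le> n"

text \<open>The relation \<open>d\<^sup>\<leftrightarrow>(s, x) \<le> n\<close>.\<close>
definition near :: "'a \<Rightarrow> nat \<Rightarrow> 'a \<Rightarrow> bool" where
  "near s n x \<longleftrightarrow> reaches n s x \<or> reaches n x s"

text \<open>The vertices on geodesics from \<open>x\<close> to \<open>y\<close>.\<close>
definition seg :: "'a \<Rightarrow> 'a \<Rightarrow> 'a set" where
  "seg x y = {p. reach x p \<and> reach p y \<and> d x p + d p y = d x y}"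

definition geo :: "(nat \<Rightarrow> 'a) \<Rightarrow> 'a \<Rightarrow> 'a \<Rightarrow> bool" where
  "geo g x y \<longleftrightarrow> reach x y \<and> g 0 = x \<and> g (d x y) = y \<and>
     (\<forall>i j. i \<le> j \<longrightarrow> j \<le> d x y \<longrightarrow> reach (g i) (g j) \<and> d (g i) (g j) = j - i)"

text \<open>The vertex set of a single geodesic between \<open>x\<close> and \<open>z\<close>, in either direction. Thinness is used
  with such sets and not just with the larger \<open>seg x z\<close>: on one geodesic, the distances to an end
  decide which of two vertices comes first.\<close>
definition side :: "'a set \<Rightarrow> 'a \<Rightarrow> 'a \<Rightarrow> bool" where
  "side A x z \<longleftrightarrow> (\<exists>g. geo g x z \<and> A = g ` {..d x z}) \<or> (\<exists>g. geo g z x \<and> A = g ` {..d z x})"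

lemma reaches_refl: "x \<in> V \<Longrightarrow> reaches n x x"
  using reach_refl d_zero_iff unfolding reaches_def by fastforce

lemma d_self [simp]: "x \<in> V \<Longrightarrow> d x x = 0"
  using reach_refl d_zero_iff by blast

lemma reaches_trans: "reaches a x y \<Longrightarrow> reaches b y z \<Longrightarrow> a + b \<le> c \<Longrightarrow> reaches c x z"
  unfolding reaches_def using reach_trans d_triangle by (meson add_le_mono le_trans)

lemma reaches_mono: "reaches a x y \<Longrightarrow> a \<le> c \<Longrightarrow> reaches c x y"
  unfolding reaches_def by simp

lemma reaches_d: "reach x y \<Longrightarrow> reaches (d x y) x y"
  unfolding reaches_def by simp

lemma seg_ends: "reach x y \<Longrightarrow> x \<in> seg x y" "reach x y \<Longrightarrow> y \<in> seg x y"
  unfolding seg_def using reach_in reach_refl by auto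

lemma seg_reach: "p \<in> seg x y \<Longrightarrow> reach x y"
  unfolding seg_def using reach_trans by blast

lemma seg_left: "q \<in> seg x y \<Longrightarrow> seg x q \<subseteq> seg x y"
proof
  fix p assume q: "q \<in> seg x y" and p: "p \<in> seg x q"
  have r: "reach x p" "reach p q" "reach q y" "d x p + d p q = d x q" "d x q + d q y = d x y"
    using p q unfolding seg_def by auto
  have "reach p y" using r reach_trans by blast
  moreover have "d p y \<le> d p q + d q y" using r d_triangle by blast
  moreover have "d x y \<le> d x p + d p y" using r \<open>reach p y\<close> d_triangle by blast
  ultimately show "p \<in> seg x y" unfolding seg_def using r by auto
qed

lemma seg_right: "q \<in> seg x y \<Longrightarrow> seg q y \<subseteq> seg x y"
proof
  fix p assume q: "q \<in> seg x y" and p: "p \<in> seg q y"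
  have r: "reach q p" "reach p y" "reach x q" "d q p + d p y = d q y" "d x q + d q y = d x y"
    using p q unfolding seg_def by auto
  have "reach x p" using r reach_trans by blast
  moreover have "d x p \<le> d x q + d q p" using r d_triangle by blast
  moreover have "d x y \<le> d x p + d p y" using r \<open>reach x p\<close> d_triangle by blast
  ultimately show "p \<in> seg x y" unfolding seg_def using r by auto
qed

lemma geo_mem_seg:
  assumes "geo g x y" "i \<le> d x y" shows "g i \<in> seg x y"
proof -
  have "reach (g 0) (g i) \<and> d (g 0) (g i) = i - 0"
    "reach (g i) (g (d x y)) \<and> d (g i) (g (d x y)) = d x y - i"
    using assms unfolding geo_def by blast+
  then show ?thesis using assms unfolding seg_def geo_def by auto
qed

lemma geo_prefix:
  assumes "geo g x y" "i \<le> d x y" shows "geo g x (g i)" "d x (g i) = i"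
proof -
  have "reach (g 0) (g i) \<and> d (g 0) (g i) = i - 0" using assms unfolding geo_def by blast
  then show "d x (g i) = i" "geo g x (g i)" using assms unfolding geo_def by auto
qed

lemma geo_exists: assumes "reach x y" shows "\<exists>g. geo g x y"
  using assms
proof (induction "d x y" arbitrary: x)
  case 0
  then show ?case using d_zero_iff reach_in reach_refl
    by (intro exI[of _ "\<lambda>_. x"]) (auto simp: geo_def)
next
  case (Suc n)
  obtain z where z: "reach x z" "reach z y" "d x z = 1" "d z y = n"
    using d_between[OF Suc.prems, of 1] Suc.hyps(2) by auto
  obtain g where g: "geo g z y" using Suc.hyps(1)[of z] z by auto
  define h where "h = (\<lambda>i. case i of 0 \<Rightarrow> x | Suc i \<Rightarrow> g i)"
  have "reach (h i) (h j) \<and> d (h i) (h j) = j - i" if ij: "i \<le> j" "j \<le> d x y" for i j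
  proof (cases i)
    case (Suc i')
    then show ?thesis using ij g z Suc.hyps(2) unfolding geo_def h_def by (cases j) auto
  next
    case 0
    show ?thesis
    proof (cases j)
      case 0
      then show ?thesis using \<open>i = 0\<close> Suc.prems reach_in reach_refl by (auto simp: h_def)
    next
      case (Suc j')
      have j': "j' \<le> d z y" using ij Suc \<open>Suc n = d x y\<close> z by auto
      have m: "reach z (g j')" "d z (g j') = j'" "reach (g j') y" "d (g j') y = d z y - j'"
        using geo_mem_seg[OF g j'] geo_prefix[OF g j'] unfolding seg_def by auto
      have r: "reach x (g j')" using m z reach_trans by blast
      have "d x (g j') \<le> Suc j'" using d_triangle[OF z(1) m(1)] z m by auto
      moreover have "d x y \<le> d x (g j') + d (g j') y" using d_triangle[OF r m(3)] .
      ultimately show ?thesis using r Suc \<open>i = 0\<close> m z \<open>Suc n = d x y\<close> j' by (auto simp: h_def)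
    qed
  qed
  moreover have "h 0 = x" "h (d x y) = y" using g z Suc.hyps(2)[symmetric] by (auto simp: h_def geo_def)
  ultimately have "geo h x y" unfolding geo_def using Suc.prems by blast
  then show ?case by blast
qed

lemma geo_concat:
  assumes "p \<in> seg x y" "geo g x p" "geo h p y"
  shows "geo (\<lambda>i. if i \<le> d x p then g i else h (i - d x p)) x y" (is "geo ?k x y")
proof -
  have r: "reach x p" "reach p y" "d x p + d p y = d x y" "reach x y"
    using assms(1) seg_reach[OF assms(1)] unfolding seg_def by auto
  have G: "g 0 = x" "g (d x p) = p" "\<And>i j. i \<le> j \<Longrightarrow> j \<le> d x p \<Longrightarrow> reach (g i) (g j) \<and> d (g i) (g j) = j - i"
    using assms(2) unfolding geo_def by auto
  have H: "h 0 = p" "h (d p y) = y" "\<And>i j. i \<le> j \<Longrightarrow> j \<le> d p y \<Longrightarrow> reach (h i) (h j) \<and> d (h i) (h j) = j - i"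
    using assms(3) unfolding geo_def by auto
  have "reach (?k i) (?k j) \<and> d (?k i) (?k j) = j - i" if ij: "i \<le> j" "j \<le> d x y" for i j
  proof (cases "j \<le> d x p \<or> \<not> i \<le> d x p")
    case True
    then show ?thesis using G H ij r by (cases "j \<le> d x p") auto
  next
    case False
    let ?j = "j - d x p"
    have a: "reach x (g i)" "d x (g i) = i" "reach (g i) p" "d (g i) p = d x p - i"
      using G(3)[of 0 i] G(3)[of i "d x p"] G(1,2) False by auto
    have b: "reach p (h ?j)" "d p (h ?j) = ?j" "reach (h ?j) y" "d (h ?j) y = d p y - ?j"
      using H(3)[of 0 ?j] H(3)[of ?j "d p y"] H(1,2) False ij r by auto
    have c: "reach (g i) (h ?j)" using a b reach_trans by blast
    have "d (g i) (h ?j) \<le> d x p - i + ?j" using d_triangle[OF a(3) b(1)] a b by auto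
    moreover have "d x y \<le> i + d (g i) (h ?j) + (d p y - ?j)"
      using d_triangle[OF a(1) reach_trans[OF c b(3)]] d_triangle[OF c b(3)] a b by auto
    ultimately have "d (g i) (h ?j) = j - i" using r False ij by auto
    then show ?thesis using c False by auto
  qed
  moreover have "?k 0 = x" "?k (d x y) = y" using G H r by (auto intro: arg_cong[of _ _ h] simp: r(3)[symmetric])
  ultimately show ?thesis unfolding geo_def using r(4) by blast
qed

lemma geo_through:
  assumes "p \<in> seg x y" shows "\<exists>g i. geo g x y \<and> i \<le> d x y \<and> g i = p"
proof -
  have r: "reach x p" "reach p y" "d x p + d p y = d x y" using assms unfolding seg_def by auto
  obtain g h where gh: "geo g x p" "geo h p y" using geo_exists r by blast
  then have "geo (\<lambda>i. if i \<le> d x p then g i else h (i - d x p)) x y" using geo_concat assms by blast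
  moreover have "g (d x p) = p" using gh unfolding geo_def by blast
  ultimately show ?thesis using r by (intro exI[of _ "\<lambda>i. if i \<le> d x p then g i else h (i - d x p)"] exI[of _ "d x p"]) auto
qed

lemma side_geo: "geo g x z \<Longrightarrow> side (g ` {..d x z}) x z" "geo g x z \<Longrightarrow> side (g ` {..d x z}) z x"
  unfolding side_def by auto

lemma side_exists:
  "reach x z \<Longrightarrow> \<exists>A \<subseteq> seg x z. side A x z \<and> side A z x \<and> card A \<le> Suc (d x z) \<and> finite A"
proof -
  assume "reach x z"
  then obtain g where g: "geo g x z" using geo_exists by blast
  have "g ` {..d x z} \<subseteq> seg x z" using geo_mem_seg g by auto
  moreover have "card (g ` {..d x z}) \<le> Suc (d x z)" using card_image_le[of "{..d x z}" g] by simp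
  ultimately show ?thesis using side_geo[OF g] by (intro exI[of _ "g ` {..d x z}"]) simp
qed

lemma side_left: "side A x z \<Longrightarrow> x \<in> A"
  unfolding side_def geo_def by force

lemma dual_directed: "directed_space V (\<lambda>x y. reach y x) (\<lambda>x y. d y x)"
proof (unfold_locales, goal_cases)
  case (5 x y z)
  then show ?case using d_triangle[of z y x] by simp
next
  case (6 x y k)
  then show ?case using d_between[of y x "d y x - k"] by auto
qed (auto intro: reach_refl reach_trans simp: d_zero_iff dest: reach_in)

lemma geo_reverse:
  assumes "directed_space.geo (\<lambda>x y. reach y x) (\<lambda>x y. d y x) g x y"
  shows "geo (\<lambda>i. g (d y x - i)) y x \<and> (\<lambda>i. g (d y x - i)) ` {..d y x} = g ` {..d y x}"
proof -
  note G = assms[unfolded directed_space.geo_def[OF dual_directed]]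
  have "(\<lambda>i. d y x - i) ` {..d y x} = {..d y x}"
  proof (intro equalityI subsetI)
    fix i assume "i \<in> {..d y x}"
    then show "i \<in> (\<lambda>i. d y x - i) ` {..d y x}" by (intro image_eqI[of _ _ "d y x - i"]) auto
  qed auto
  then have "(\<lambda>i. g (d y x - i)) ` {..d y x} = g ` {..d y x}"
    by (metis image_image)
  moreover have "geo (\<lambda>i. g (d y x - i)) y x"
    unfolding geo_def using G by (auto simp: diff_le_mono2)
  ultimately show ?thesis by blast
qed

lemma dual_reaches: "directed_space.reaches (\<lambda>x y. reach y x) (\<lambda>x y. d y x) n x y = reaches n y x"
  unfolding reaches_def directed_space.reaches_def[OF dual_directed] by simp

lemma dual_seg: "directed_space.seg (\<lambda>x y. reach y x) (\<lambda>x y. d y x) x y = seg y x"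
  unfolding seg_def directed_space.seg_def[OF dual_directed] by auto

lemma dual_side:
  assumes "directed_space.side (\<lambda>x y. reach y x) (\<lambda>x y. d y x) A x y"
  shows "side A x y"
proof -
  have "(\<exists>h. geo h v u \<and> A = h ` {..d v u})"
    if "directed_space.geo (\<lambda>x y. reach y x) (\<lambda>x y. d y x) g u v" "A = g ` {..d v u}" for g u v
    using geo_reverse[OF that(1)] that(2) by (intro exI[of _ "\<lambda>i. g (d v u - i)"]) simp
  then show ?thesis
    using assms unfolding directed_space.side_def[OF dual_directed] side_def by blast
qed

lemma dual_side_iff: "directed_space.side (\<lambda>x y. reach y x) (\<lambda>x y. d y x) A x y \<longleftrightarrow> side A x y"
  using dual_side directed_space.dual_side[OF dual_directed] by blast

lemma near_commute: "near x n y \<longleftrightarrow> near y n x"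
  unfolding near_def by blast

lemma near_mono: "near x n y \<Longrightarrow> n \<le> m \<Longrightarrow> near x m y"
  unfolding near_def using reaches_mono by blast

text \<open>Quasi-geodesic rays and anti-rays, with both constants of quasi-geodesicity merged into the
  single integer \<open>C\<close>.\<close>
definition forward_ray :: "nat \<Rightarrow> (nat \<Rightarrow> 'a) \<Rightarrow> bool" where
  "forward_ray C R \<longleftrightarrow> (\<forall>i. reaches 1 (R i) (R (Suc i))) \<and>
     (\<forall>i j. i \<le> j \<longrightarrow> reach (R i) (R j) \<and> j - i \<le> C * (d (R i) (R j) + 1))"

definition backward_ray :: "nat \<Rightarrow> (nat \<Rightarrow> 'a) \<Rightarrow> bool" where
  "backward_ray C R \<longleftrightarrow> (\<forall>i. reaches 1 (R (Suc i)) (R i)) \<and>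
     (\<forall>i j. i \<le> j \<longrightarrow> reach (R j) (R i) \<and> j - i \<le> C * (d (R j) (R i) + 1))"

text \<open>The consequence of quasi-geodesicity that no longer mentions a direction: the indices at which
  the sequence comes close to a given vertex \<open>s\<close> lie in an interval of controlled length.\<close>
definition spread :: "nat \<Rightarrow> (nat \<Rightarrow> 'a) \<Rightarrow> bool" where
  "spread C R \<longleftrightarrow> (\<forall>s n m i j. near s n (R i) \<longrightarrow> near s m (R j) \<longrightarrow> i \<le> j \<longrightarrow>
     j - i \<le> C * (n + m + 1))"

lemma spread_escapes:
  assumes "spread C R" shows "\<forall>\<^sub>F i in sequentially. \<not> near s n (R i)"
proof (cases "\<exists>i. near s n (R i)")
  case True
  then obtain i where i: "near s n (R i)" by blast
  have "\<not> near s n (R j)" if "Suc (i + C * (n + n + 1)) \<le> j" for j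
  proof
    assume "near s n (R j)"
    moreover have "i \<le> j" using that by simp
    ultimately have "j - i \<le> C * (n + n + 1)" using assms i unfolding spread_def by blast
    then show False using that by linarith
  qed
  then show ?thesis unfolding eventually_sequentially by blast
qed auto

lemma ray_start_near:
  assumes "forward_ray C R \<or> backward_ray C R" shows "near (R 0) i (R i)"
proof (induction i)
  case 0
  have "reach (R 0) (R 0)" using assms unfolding forward_ray_def backward_ray_def by blast
  then show ?case using reach_in reaches_refl unfolding near_def by blast
next
  case (Suc i)
  show ?case using assms
  proof
    assume f: "forward_ray C R"
    have "reaches k (R 0) (R k)" for k
    proof (induction k)
      case 0
      have "reach (R 0) (R 0)" using f unfolding forward_ray_def by blast
      then show ?case using reach_in reaches_refl by blast
    next
      case (Suc k)
      then show ?case using reaches_trans[OF Suc, of 1 "R (Suc k)" "Suc k"] f unfolding forward_ray_def by simp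
    qed
    then show ?thesis unfolding near_def by blast
  next
    assume f: "backward_ray C R"
    have "reaches k (R k) (R 0)" for k
    proof (induction k)
      case 0
      have "reach (R 0) (R 0)" using f unfolding backward_ray_def by blast
      then show ?case using reach_in reaches_refl by blast
    next
      case (Suc k)
      then show ?case using reaches_trans[of 1 "R (Suc k)" "R k" k "R 0" "Suc k"] f unfolding backward_ray_def by simp
    qed
    then show ?thesis unfolding near_def by blast
  qed
qed

lemma seg_edge: "reaches 1 x y \<Longrightarrow> seg x y \<subseteq> {x, y}"
proof
  fix p assume "reaches 1 x y" "p \<in> seg x y"
  then have "reach x p" "reach p y" "d x p = 0 \<or> d p y = 0" unfolding reaches_def seg_def by auto
  then show "p \<in> {x, y}" using d_zero_iff by auto
qed

definition geodesic_ray :: "(nat \<Rightarrow> 'a) \<Rightarrow> bool" where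
  "geodesic_ray Q \<longleftrightarrow> (\<forall>i j. i \<le> j \<longrightarrow> reach (Q i) (Q j) \<and> d (Q i) (Q j) = j - i)"

lemma seg_trivial: assumes "p \<in> seg x x" shows "p = x"
proof -
  have "reach x p" "d x p + d p x = d x x" using assms unfolding seg_def by auto
  moreover have "d x x = 0" using \<open>reach x p\<close> reach_in by simp
  ultimately show ?thesis using d_zero_iff[of x p] by simp
qed

lemma geodesic_ray_forward: "geodesic_ray Q \<Longrightarrow> forward_ray 1 Q"
  unfolding geodesic_ray_def forward_ray_def reaches_def by auto

end

section \<open>Thin triangles\<close>

text \<open>For a digraph, \<open>\<delta>\<close> and \<open>b\<close> will be the integer parts of the real numbers \<open>\<delta>\<close> and \<open>f(\<delta> + 1)\<close>: all
  finite distances are integers.\<close>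
locale hyperbolic_space = directed_space V reach d
  for V :: "'a set" and reach :: "'a \<Rightarrow> 'a \<Rightarrow> bool" and d :: "'a \<Rightarrow> 'a \<Rightarrow> nat" +
  fixes \<delta> b :: nat
  assumes thin: "p \<in> seg x y \<Longrightarrow> side A x z \<Longrightarrow> side B y z \<Longrightarrow>
            (\<exists>q\<in>A. reaches \<delta> q p) \<or> (\<exists>q\<in>B. reaches \<delta> p q)"
    and bound_out: "reaches \<delta> x y \<Longrightarrow> reaches \<delta> x z \<Longrightarrow> reach y z \<Longrightarrow> d y z \<le> b"
    and bound_in: "reaches \<delta> y x \<Longrightarrow> reaches \<delta> z x \<Longrightarrow> reach y z \<Longrightarrow> d y z \<le> b"
begin

lemma dual_hyperbolic: "hyperbolic_space V (\<lambda>x y. reach y x) (\<lambda>x y. d y x) \<delta> b"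
proof (intro hyperbolic_space.intro dual_directed hyperbolic_space_axioms.intro)
  fix p x y z A B
  assume "p \<in> directed_space.seg (\<lambda>x y. reach y x) (\<lambda>x y. d y x) x y"
    "directed_space.side (\<lambda>x y. reach y x) (\<lambda>x y. d y x) A x z"
    "directed_space.side (\<lambda>x y. reach y x) (\<lambda>x y. d y x) B y z"
  then have "p \<in> seg y x" "side A x z" "side B y z" by (simp_all only: dual_seg dual_side_iff)
  from thin[OF this(1,3,2)]
  show "(\<exists>q\<in>A. directed_space.reaches (\<lambda>x y. reach y x) (\<lambda>x y. d y x) \<delta> q p) \<or>
    (\<exists>q\<in>B. directed_space.reaches (\<lambda>x y. reach y x) (\<lambda>x y. d y x) \<delta> p q)"
    unfolding dual_reaches by blast
qed (simp_all only: dual_reaches bound_out bound_in)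

text \<open>The case distinction matters: if \<open>\<delta> = 0\<close>, then the sides of a triangle are contained in the
  union of the other two, and \<open>\<kappa>\<close> has to vanish together with \<open>6 \<delta> + 2 \<delta> f(\<delta> + 1)\<close>.\<close>
definition \<kappa> :: nat where "\<kappa> = (if \<delta> = 0 then 0 else 3 * \<delta> + b + 1)"

text \<open>Thinness alone only says that \<open>p\<close> is shortly before a vertex of \<open>B\<close>, or shortly \<^emph>\<open>after\<close> a vertex of
  \<open>seg x z\<close>. In the second case look at the vertex \<open>p'\<close> that comes \<open>J\<close> steps after \<open>p\<close>. If it is
  shortly after \<open>q \<in> seg x z\<close>, then \<open>x\<close>, \<open>q\<close>, \<open>p'\<close> form a triangle with a short side, and near its
  corner \<open>q\<close> the side from \<open>x\<close> to \<open>q\<close> is shortly after the initial part of the geodesic through \<open>p\<close>,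
  ending in \<open>p'\<close>. This detour through \<open>seg x z\<close> reaches \<open>p'\<close> in at most \<open>J\<close> steps, so it leaves that geodesic
  at or after \<open>p\<close>, and a short path leads from \<open>p\<close> to \<open>seg x z\<close>.\<close>
lemma forward_close:
  assumes p: "p \<in> seg x y" and z: "reach x z" and B: "side B y z"
  shows "\<exists>q\<in>seg x z \<union> B. reaches \<kappa> p q"
proof -
  obtain A where A: "A \<subseteq> seg x z" "side A x z" using side_exists[OF z] by blast
  show ?thesis
  proof (cases "\<delta> = 0")
    case True
    have eq: "u = v" if "reaches \<delta> u v" for u v using that True d_zero_iff unfolding reaches_def by auto
    have "reach p y" using p unfolding seg_def by blast
    then have "reaches \<kappa> p p" using reaches_mono[OF reaches_refl] reach_in by blast
    moreover have "p \<in> A \<union> B" using thin[OF p A(2) B] eq by blast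
    ultimately show ?thesis using A(1) by blast
  next
    case False
    define J where "J = 2 * \<delta> + b + 1"
    have kJ: "\<kappa> = J + \<delta>" using False unfolding \<kappa>_def J_def by simp
    obtain g i where g: "geo g x y" "i \<le> d x y" "g i = p" using geo_through[OF p] by blast
    have G: "\<And>i j. i \<le> j \<Longrightarrow> j \<le> d x y \<Longrightarrow> reach (g i) (g j) \<and> d (g i) (g j) = j - i"
      and gy: "g (d x y) = y" using g unfolding geo_def by auto
    show ?thesis
    proof (cases "d x y \<le> i + J")
      case True
      have "reaches J p y" using G[of i "d x y"] g gy True unfolding reaches_def by auto
      then have "reaches \<kappa> p y" using kJ by (intro reaches_mono[of J p y \<kappa>]) auto
      then show ?thesis using side_left[OF B] by blast
    next
      case False
      define m where "m = i + J"
      define p' where "p' = g m"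
      have pp': "reaches J p p'" using G[of i m] g False unfolding reaches_def p'_def m_def by auto
      have mle: "m \<le> d x y" using False by (simp add: m_def)
      have p'seg: "p' \<in> seg x y" unfolding p'_def using geo_mem_seg[OF g(1) mle] .
      from thin[OF p'seg A(2) B] show ?thesis
      proof
        assume "\<exists>q\<in>B. reaches \<delta> p' q"
        then show ?thesis using reaches_trans[OF pp'] kJ by (metis UnCI order_refl)
      next
        assume "\<exists>q\<in>A. reaches \<delta> q p'"
        then obtain q where q: "q \<in> A" "reaches \<delta> q p'" by blast
        have qseg: "q \<in> seg x z" using q A by blast
        have rq: "reach x q" "reach q p'" using qseg q unfolding seg_def reaches_def by auto
        have gp: "geo g x p'" "d x p' = m" using geo_prefix[OF g(1) mle] by (auto simp: p'_def)
        obtain h where h: "geo h x q" using geo_exists rq by blast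
        \<comment> \<open>The last vertex on the way from \<open>x\<close> to \<open>q\<close> that is shortly after the geodesic through \<open>p\<close>.\<close>
        define T where "T = {n. n \<le> d x q \<and> (\<exists>l\<le>m. reaches \<delta> (g l) (h n))}"
        have "0 \<in> T" using h gp rq reach_in reaches_refl unfolding T_def geo_def by (auto intro!: exI[of _ 0])
        moreover have finT: "finite T" unfolding T_def by simp
        ultimately have "Max T \<in> T" using Max_in by blast
        define n where "n = Max T"
        have nT: "n \<in> T" "Suc n \<notin> T" using \<open>Max T \<in> T\<close> Max_ge[OF finT, of "Suc n"] unfolding n_def by auto
        then obtain l where l: "l \<le> m" "reaches \<delta> (g l) (h n)" and nq: "n \<le> d x q" unfolding T_def by blast
        have H: "\<And>i j. i \<le> j \<Longrightarrow> j \<le> d x q \<Longrightarrow> reach (h i) (h j) \<and> d (h i) (h j) = j - i" "h (d x q) = q"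
          using h unfolding geo_def by auto
        have hq: "reaches (b + 1) (h n) q"
        proof (cases "n = d x q")
          case True
          then show ?thesis using H rq reaches_refl reach_in by auto
        next
          case False
          then have sn: "Suc n \<le> d x q" using nq by simp
          obtain B' where B': "B' \<subseteq> seg q p'" "side B' q p'" using side_exists rq by blast
          have "\<not> (\<exists>q\<in>g ` {..d x p'}. reaches \<delta> q (h (Suc n)))" using nT(2) sn gp unfolding T_def by auto
          then obtain v where v: "v \<in> B'" "reaches \<delta> (h (Suc n)) v"
            using thin[OF geo_mem_seg[OF h sn] side_geo(1)[OF gp(1)] B'(2)] by blast
          have "reaches \<delta> q v" using v B' q(2) unfolding seg_def reaches_def by fastforce
          then have "d (h (Suc n)) q \<le> b" using bound_in[OF v(2), of q] H(1)[OF sn order_refl] H(2) by simp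
          then show ?thesis using H(1)[of "Suc n" "d x q"] H(1)[of n "d x q"] sn H(2)
            unfolding reaches_def by auto
        qed
        have "reaches J (g l) p'"
          using reaches_trans[OF reaches_trans[OF l(2) hq order_refl] q(2)] by (auto simp: J_def)
        then have li: "i \<le> l" using G[of l m] l mle unfolding reaches_def p'_def m_def by auto
        then have "reaches J p (g l)" using G[of i l] l mle g unfolding reaches_def m_def by auto
        then have "reaches \<kappa> p (h n)" using reaches_trans[OF _ l(2), of J p \<kappa>] kJ by simp
        moreover have "h n \<in> seg x z" using geo_mem_seg[OF h nq] seg_left[OF qseg] by blast
        ultimately show ?thesis by blast
      qed
    qed
  qed
qed

lemma backward_close:
  assumes p: "p \<in> seg x y" and z: "reach z y" and B: "side B x z"
  shows "\<exists>q\<in>seg z y \<union> B. reaches \<kappa> q p"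
proof -
  interpret dual: hyperbolic_space V "\<lambda>x y. reach y x" "\<lambda>x y. d y x" \<delta> b by (rule dual_hyperbolic)
  show ?thesis
    using dual.forward_close[of p y x z B] assms
    unfolding dual_reaches dual_seg dual_side_iff dual.\<kappa>_def \<kappa>_def by blast
qed

lemma side_of_near:
  assumes "near x a z" shows "\<exists>A. side A x z \<and> finite A \<and> card A \<le> Suc a"
proof -
  have "\<exists>A. side A x z \<and> finite A \<and> card A \<le> Suc a" if r: "reach u v" "d u v \<le> a" "(u, v) = (x, z) \<or> (v, u) = (x, z)" for u v
  proof -
    obtain A where "side A u v" "side A v u" "card A \<le> Suc (d u v)" "finite A"
      using side_exists r(1) by blast
    then show ?thesis using r by (intro exI[of _ A]) auto
  qed
  then show ?thesis using assms unfolding near_def reaches_def by blast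
qed

text \<open>By thinness each vertex of the side from \<open>x\<close> to \<open>y\<close> is \<open>\<delta>\<close>-close to one of the at most \<open>a + c + 2\<close>
  vertices of the other two sides, and each of those serves at most \<open>b + 1\<close> vertices. Thus \<open>d\<^sup>\<leftrightarrow>\<close>
  satisfies a linear substitute for the triangle inequality on reachable pairs.\<close>
lemma length_bound:
  assumes "reach x y" "near x a z" "near y c z"
  shows "d x y \<le> (a + c + 2) * (b + 1)"
proof -
  obtain A where A: "side A x z" "finite A" "card A \<le> Suc a" using side_of_near assms by blast
  obtain B where B: "side B y z" "finite B" "card B \<le> Suc c" using side_of_near assms by blast
  obtain g where g: "geo g x y" using geo_exists assms by blast
  have G: "\<And>i j. i \<le> j \<Longrightarrow> j \<le> d x y \<Longrightarrow> reach (g i) (g j) \<and> d (g i) (g j) = j - i"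
    using g unfolding geo_def by auto
  have small: "card T \<le> b + 1" if T: "T \<subseteq> {..d x y}" "\<And>i j. i \<in> T \<Longrightarrow> j \<in> T \<Longrightarrow> i \<le> j \<Longrightarrow> j \<le> i + b" for T
  proof (cases "T = {}")
    case False
    have "finite T" using T(1) finite_subset by blast
    then have "T \<subseteq> {Min T..Min T + b}" using T(2)[of "Min T"] False by auto
    then show ?thesis using card_mono[of "{Min T..Min T + b}" T] by simp
  qed simp
  define F where "F = (\<lambda>q. {i. i \<le> d x y \<and> reaches \<delta> q (g i)})"
  define H where "H = (\<lambda>q. {i. i \<le> d x y \<and> reaches \<delta> (g i) q})"
  have F: "card (F q) \<le> b + 1" for q
  proof (rule small)
    fix i j assume "i \<in> F q" "j \<in> F q" "i \<le> j"
    then show "j \<le> i + b" using G[of i j] bound_out[of q "g i" "g j"] unfolding F_def by auto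
  qed (auto simp: F_def)
  have H: "card (H q) \<le> b + 1" for q
  proof (rule small)
    fix i j assume "i \<in> H q" "j \<in> H q" "i \<le> j"
    then show "j \<le> i + b" using G[of i j] bound_in[of "g i" q "g j"] unfolding H_def by auto
  qed (auto simp: H_def)
  have "{..d x y} \<subseteq> (\<Union>q\<in>A. F q) \<union> (\<Union>q\<in>B. H q)"
    using thin[OF geo_mem_seg[OF g] A(1) B(1)] unfolding F_def H_def by auto
  then have "Suc (d x y) \<le> card ((\<Union>q\<in>A. F q) \<union> (\<Union>q\<in>B. H q))"
    using card_mono[of "(\<Union>q\<in>A. F q) \<union> (\<Union>q\<in>B. H q)" "{..d x y}"] A B by (auto simp: F_def H_def)
  also have "\<dots> \<le> card (\<Union>q\<in>A. F q) + card (\<Union>q\<in>B. H q)" by (rule card_Un_le)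
  also have "\<dots> \<le> (\<Sum>q\<in>A. card (F q)) + (\<Sum>q\<in>B. card (H q))"
    using card_UN_le[OF A(2), of F] card_UN_le[OF B(2), of H] by simp
  also have "\<dots> \<le> (\<Sum>q\<in>A. b + 1) + (\<Sum>q\<in>B. b + 1)"
    by (rule add_mono; rule sum_mono; rule F H)
  also have "\<dots> = (card A + card B) * (b + 1)" by (simp add: algebra_simps)
  also have "\<dots> \<le> (a + c + 2) * (b + 1)" by (rule mult_right_mono) (use A B in auto)
  finally show ?thesis by (rule Suc_leD)
qed

lemma spread_ray:
  assumes "forward_ray C R \<or> backward_ray C R" shows "spread (C * (2 * b + 3)) R"
  unfolding spread_def
proof (intro allI impI)
  fix s n m i j assume n: "near s n (R i)" "near s m (R j)" and ij: "i \<le> j"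
  have "\<exists>e. j - i \<le> C * (e + 1) \<and> e \<le> (n + m + 2) * (b + 1)"
  proof (cases "forward_ray C R")
    case True
    then have r: "reach (R i) (R j)" "j - i \<le> C * (d (R i) (R j) + 1)" using ij unfolding forward_ray_def by auto
    then show ?thesis using length_bound[OF r(1), of n s m] n near_commute by blast
  next
    case False
    then have r: "reach (R j) (R i)" "j - i \<le> C * (d (R j) (R i) + 1)" using ij assms unfolding backward_ray_def by auto
    then show ?thesis using length_bound[OF r(1), of m s n] n near_commute by (metis add.commute)
  qed
  then obtain e where "j - i \<le> C * (e + 1)" "e \<le> (n + m + 2) * (b + 1)" by blast
  moreover have "(n + m + 2) * (b + 1) + 1 \<le> (2 * b + 3) * (n + m + 1)" by (simp add: algebra_simps)
  ultimately have "j - i \<le> C * ((2 * b + 3) * (n + m + 1))"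
    by (meson add_le_mono1 le_trans mult_le_mono2)
  then show "j - i \<le> C * (2 * b + 3) * (n + m + 1)" by (simp only: mult.assoc)
qed

end

section \<open>Weights and chains of geodesics\<close>

text \<open>The smallness of \<open>\<epsilon>\<close> enters through \<open>K\<^sup>2 \<le> 2\<close> for \<open>K = exp (\<epsilon> \<kappa>)\<close>.\<close>
locale visual_space = hyperbolic_space V reach d \<delta> b
  for V :: "'a set" and reach :: "'a \<Rightarrow> 'a \<Rightarrow> bool" and d :: "'a \<Rightarrow> 'a \<Rightarrow> nat" and \<delta> b :: nat +
  fixes \<epsilon> :: real
  assumes eps_pos: "\<epsilon> > 0"
    and eps_small: "exp (\<epsilon> * real \<kappa>) ^ 2 \<le> 2"
begin

abbreviation K :: real where "K \<equiv> exp (\<epsilon> * real \<kappa>)"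

lemma K_ge_1: "1 \<le> K" using eps_pos by simp

lemma K_sq: "K * K \<le> 2" using eps_small by (simp add: power2_eq_square)

lemma K_le_2: "K \<le> 2"
proof -
  have "K * 1 \<le> K * K" using K_ge_1 by (intro mult_left_mono) auto
  then show ?thesis using K_sq by linarith
qed

definition out_weight :: "'a \<Rightarrow> 'a \<Rightarrow> real" where
  "out_weight s p = (if reach s p then exp (- \<epsilon> * real (d s p)) else 0)"

definition in_weight :: "'a \<Rightarrow> 'a \<Rightarrow> real" where
  "in_weight s p = (if reach p s then exp (- \<epsilon> * real (d p s)) else 0)"

text \<open>This is \<open>exp (- \<epsilon> d\<^sup>\<leftrightarrow>(s, p))\<close>, read as 0 if \<open>s\<close> and \<open>p\<close> are not connected in either direction. The two
  directions are kept apart because a short path from \<open>p\<close> to \<open>q\<close> bounds the out-weight of \<open>p\<close> by that of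
  \<open>q\<close>, but the in-weight of \<open>q\<close> by that of \<open>p\<close>.\<close>
definition weight :: "'a \<Rightarrow> 'a \<Rightarrow> real" where
  "weight s p = max (out_weight s p) (in_weight s p)"

lemma out_weight_nonneg: "0 \<le> out_weight s p" by (simp add: out_weight_def)
lemma in_weight_nonneg: "0 \<le> in_weight s p" by (simp add: in_weight_def)
lemma weight_nonneg: "0 \<le> weight s p" by (simp add: weight_def out_weight_nonneg le_max_iff_disj)
lemma out_le_weight: "out_weight s p \<le> weight s p" by (simp add: weight_def)
lemma in_le_weight: "in_weight s p \<le> weight s p" by (simp add: weight_def)

lemma weight_leI: "out_weight s p \<le> t \<Longrightarrow> in_weight s p \<le> t \<Longrightarrow> weight s p \<le> t"
  by (simp add: weight_def)

lemma out_weight_step: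
  assumes "reaches n p q" shows "out_weight s p \<le> exp (\<epsilon> * real n) * out_weight s q"
proof (cases "reach s p")
  case True
  then have "reach s q" "d s q \<le> d s p + n"
    using assms reach_trans d_triangle[of s p q] unfolding reaches_def by auto
  moreover from this have "- \<epsilon> * real (d s p) \<le> \<epsilon> * real n + - \<epsilon> * real (d s q)"
    using eps_pos mult_left_mono[of "real (d s q)" "real (d s p + n)" \<epsilon>]
    by (simp add: algebra_simps)
  ultimately show ?thesis using True by (simp add: out_weight_def flip: exp_add)
qed (simp add: out_weight_def)

lemma in_weight_step:
  assumes "reaches n q p" shows "in_weight s p \<le> exp (\<epsilon> * real n) * in_weight s q"
proof (cases "reach p s")
  case True
  then have "reach q s" "d q s \<le> d p s + n"
    using assms reach_trans d_triangle[of q p s] unfolding reaches_def by auto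
  moreover from this have "- \<epsilon> * real (d p s) \<le> \<epsilon> * real n + - \<epsilon> * real (d q s)"
    using eps_pos mult_left_mono[of "real (d q s)" "real (d p s + n)" \<epsilon>]
    by (simp add: algebra_simps)
  ultimately show ?thesis using True by (simp add: in_weight_def flip: exp_add)
qed (simp add: in_weight_def)

lemma weight_near: "0 < weight s p \<Longrightarrow> \<exists>n. near s n p \<and> weight s p = exp (- \<epsilon> * real n)"
  unfolding near_def reaches_def weight_def out_weight_def in_weight_def
  by (auto simp: max_def split: if_splits)

lemma weight_gt_near: "exp (- \<epsilon> * real n) < weight s p \<Longrightarrow> near s n p"
proof -
  assume a: "exp (- \<epsilon> * real n) < weight s p"
  then have "0 < weight s p" by (smt (verit) exp_gt_zero)
  then obtain m where m: "near s m p" "weight s p = exp (- \<epsilon> * real m)" using weight_near by blast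
  then have "m \<le> n" using a eps_pos by simp
  then show ?thesis using m(1) reaches_mono unfolding near_def by blast
qed

lemma small_exp: "0 < c \<Longrightarrow> \<exists>n. exp (- \<epsilon> * real n) < c"
proof -
  assume c: "0 < c"
  obtain n :: nat where "- ln c / \<epsilon> < real n" using reals_Archimedean2 by blast
  then have "- \<epsilon> * real n < ln c" using eps_pos by (simp add: field_simps)
  then show ?thesis using c by (metis exp_ln exp_less_cancel_iff)
qed

text \<open>The ultrametric-like inequality for the maximal weight on geodesics, which replaces the Gromov
  product inequality.\<close>
definition gromov :: "('a \<Rightarrow> real) \<Rightarrow> bool" where
  "gromov \<omega> \<longleftrightarrow> (\<forall>p. 0 \<le> \<omega> p) \<and> (\<forall>x y z p. reach x y \<longrightarrow> reach y z \<longrightarrow> p \<in> seg x z \<longrightarrow>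
     (\<exists>q\<in>seg x y \<union> seg y z. \<omega> p \<le> K * \<omega> q))"

lemma side_of_reach: "reach x z \<Longrightarrow> \<exists>A\<subseteq>seg x z. side A x z \<and> side A z x"
  using side_exists by blast

lemma gromov_out: "gromov (out_weight s)"
  unfolding gromov_def
proof (intro conjI allI impI)
  fix x y z p assume xy: "reach x y" and yz: "reach y z" and p: "p \<in> seg x z"
  obtain B where "B \<subseteq> seg y z" "side B z y" using side_of_reach yz by blast
  then obtain q where "q \<in> seg x y \<union> seg y z" "reaches \<kappa> p q"
    using forward_close[OF p xy] by blast
  then show "\<exists>q\<in>seg x y \<union> seg y z. out_weight s p \<le> K * out_weight s q"
    using out_weight_step by blast
qed (rule out_weight_nonneg)

lemma gromov_in: "gromov (in_weight s)"
  unfolding gromov_def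
proof (intro conjI allI impI)
  fix x y z p assume xy: "reach x y" and yz: "reach y z" and p: "p \<in> seg x z"
  obtain B where "B \<subseteq> seg x y" "side B x y" using side_of_reach xy by blast
  then obtain q where "q \<in> seg x y \<union> seg y z" "reaches \<kappa> q p"
    using backward_close[OF p yz] by blast
  then show "\<exists>q\<in>seg x y \<union> seg y z. in_weight s p \<le> K * in_weight s q"
    using in_weight_step by blast
qed (rule in_weight_nonneg)

lemma gromov_weight: "gromov (weight s)"
  unfolding gromov_def
proof (intro conjI allI impI)
  fix x y z p assume a: "reach x y" "reach y z" "p \<in> seg x z"
  have "\<exists>q\<in>seg x y \<union> seg y z. out_weight s p \<le> K * weight s q"
    using gromov_out[of s] a out_le_weight[of s] unfolding gromov_def
    by (meson exp_ge_zero mult_left_mono order_trans)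
  moreover have "\<exists>q\<in>seg x y \<union> seg y z. in_weight s p \<le> K * weight s q"
    using gromov_in[of s] a in_le_weight[of s] unfolding gromov_def
    by (meson exp_ge_zero mult_left_mono order_trans)
  ultimately show "\<exists>q\<in>seg x y \<union> seg y z. weight s p \<le> K * weight s q"
    unfolding weight_def[of s p] by (auto simp: max_def)
qed (rule weight_nonneg)

text \<open>All geodesics from \<open>x\<close> to \<open>y\<close> carry weight at most \<open>t\<close>. Working with upper bounds in place of
  suprema avoids all questions of attainment and of infinite values.\<close>
definition seg_le :: "('a \<Rightarrow> real) \<Rightarrow> 'a \<Rightarrow> 'a \<Rightarrow> real \<Rightarrow> bool" where
  "seg_le \<omega> x y t \<longleftrightarrow> reach x y \<and> (\<forall>p\<in>seg x y. \<omega> p \<le> t)"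

text \<open>The chain \<open>x = x\<^sub>0, x\<^sub>1, \<dots>, x\<^sub>n = y\<close> has cost at most \<open>t\<close>. The empty chain costs nothing, which
  corresponds to \<open>\<rho>\<^sub>s(x, x) = 0\<close>.\<close>
inductive chain for \<omega> :: "'a \<Rightarrow> real" where
  chain_refl: "x \<in> V \<Longrightarrow> 0 \<le> t \<Longrightarrow> chain \<omega> x x t"
| chain_step: "chain \<omega> x y a \<Longrightarrow> seg_le \<omega> y z c \<Longrightarrow> 0 \<le> c \<Longrightarrow> a + c \<le> t \<Longrightarrow> chain \<omega> x z t"

lemma seg_le_mono: "seg_le \<omega> x y s \<Longrightarrow> s \<le> t \<Longrightarrow> seg_le \<omega> x y t"
  unfolding seg_le_def by fastforce

lemma seg_le_combine:
  assumes "gromov \<omega>" "seg_le \<omega> x y t" "seg_le \<omega> y z t" shows "seg_le \<omega> x z (K * t)"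
  unfolding seg_le_def
proof (intro conjI ballI)
  show "reach x z" using assms reach_trans unfolding seg_le_def by blast
  fix p assume "p \<in> seg x z"
  then obtain q where "q \<in> seg x y \<union> seg y z" "\<omega> p \<le> K * \<omega> q"
    using assms unfolding gromov_def seg_le_def by blast
  moreover from this have "\<omega> q \<le> t" using assms unfolding seg_le_def by blast
  ultimately show "\<omega> p \<le> K * t" by (meson exp_ge_zero mult_left_mono order_trans)
qed

text \<open>The halving argument: cut the chain at the step in which the partial sums of the costs exceed half of
  the total \<open>T\<close>. By induction both remaining parts have weight at most \<open>T\<close>, as has the step itself, and
  joining the three pieces costs two factors \<open>K\<close>, where \<open>K\<^sup>2 T \<le> 2 T\<close>.\<close>
lemma seg_le_sum:
  assumes g: "gromov \<omega>" and t: "\<And>i. 0 \<le> t i"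
  shows "l < m \<Longrightarrow> (\<And>i. l \<le> i \<Longrightarrow> i < m \<Longrightarrow> seg_le \<omega> (c i) (c (Suc i)) (t i)) \<Longrightarrow>
     seg_le \<omega> (c l) (c m) (2 * (\<Sum>i=l..<m. t i))"
proof (induction "m - l" arbitrary: l m rule: less_induct)
  case less
  define T where "T = (\<Sum>i=l..<m. t i)"
  have T0: "0 \<le> T" unfolding T_def using t by (simp add: sum_nonneg)
  have tT: "t i \<le> T" if "l \<le> i" "i < m" for i
    unfolding T_def using that t by (intro member_le_sum) auto
  define P where "P = {p. l \<le> p \<and> p < m \<and> (\<Sum>i=l..<p. t i) \<le> T / 2}"
  have "finite P" "l \<in> P" using less.prems T0 unfolding P_def by auto
  then have mx: "Max P \<in> P" using Max_in by blast
  define p where "p = Max P"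
  have p: "l \<le> p" "p < m" "(\<Sum>i=l..<p. t i) \<le> T / 2" using mx unfolding P_def p_def by auto
  have right: "(\<Sum>i=Suc p..<m. t i) \<le> T / 2" if "Suc p < m"
  proof -
    have "Suc p \<notin> P" using Max_ge[OF \<open>finite P\<close>, of "Suc p"] unfolding p_def by auto
    then have "T / 2 < (\<Sum>i=l..<Suc p. t i)" using that p unfolding P_def by auto
    moreover have "T = (\<Sum>i=l..<Suc p. t i) + (\<Sum>i=Suc p..<m. t i)"
      unfolding T_def using sum.atLeastLessThan_concat[of l "Suc p" m t] that p by simp
    ultimately show ?thesis by simp
  qed
  have mid: "seg_le \<omega> (c p) (c (Suc p)) T" using seg_le_mono less.prems(2) p tT by blast
  have le: "T \<le> K * T" using K_ge_1 T0 mult_right_mono[of 1 K T] by simp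
  have left: "seg_le \<omega> (c l) (c (Suc p)) (K * T)"
  proof (cases "p = l")
    case True
    then show ?thesis using mid seg_le_mono le by blast
  next
    case False
    then have "seg_le \<omega> (c l) (c p) (2 * (\<Sum>i=l..<p. t i))" using less p by auto
    then have "seg_le \<omega> (c l) (c p) T" using seg_le_mono p(3) by force
    then show ?thesis using seg_le_combine[OF g _ mid] by blast
  qed
  show ?case
  proof (cases "Suc p = m")
    case True
    have "K * T \<le> 2 * T" using K_le_2 T0 mult_right_mono by blast
    then show ?thesis using left seg_le_mono True unfolding T_def by blast
  next
    case False
    then have "Suc p < m" using p by simp
    then have "seg_le \<omega> (c (Suc p)) (c m) (2 * (\<Sum>i=Suc p..<m. t i))" using less p by auto
    then have "seg_le \<omega> (c (Suc p)) (c m) (K * T)"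
      using seg_le_mono right[OF \<open>Suc p < m\<close>] le by force
    then have "seg_le \<omega> (c l) (c m) (K * (K * T))" using seg_le_combine[OF g left] by blast
    moreover have "K * (K * T) \<le> 2 * T" using K_sq T0 mult_right_mono[of "K * K" 2 T] by (simp add: mult.assoc)
    ultimately show ?thesis using seg_le_mono unfolding T_def by blast
  qed
qed

lemma chain_function:
  assumes "chain \<omega> x y t"
  shows "\<exists>n c u. c 0 = x \<and> c n = y \<and> (\<forall>i. 0 \<le> u i) \<and>
     (\<forall>i<n. seg_le \<omega> (c i) (c (Suc i)) (u i)) \<and> (\<Sum>i<n. u i) \<le> t"
  using assms
proof induction
  case (chain_refl x t)
  then show ?case by (intro exI[of _ 0] exI[of _ "\<lambda>_. x"] exI[of _ "\<lambda>_. 0"]) auto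
next
  case (chain_step x y a z e t)
  then obtain n c u where c: "c 0 = x" "c n = y" "\<forall>i. 0 \<le> u i"
    "\<forall>i<n. seg_le \<omega> (c i) (c (Suc i)) (u i)" "(\<Sum>i<n. u i) \<le> a" by blast
  have "(\<Sum>i<n. (u(n := e)) i) = (\<Sum>i<n. u i)" by (rule sum.cong) auto
  then show ?case using c chain_step
    by (intro exI[of _ "Suc n"] exI[of _ "c(Suc n := z)"] exI[of _ "u(n := e)"])
      (auto simp: less_Suc_eq)
qed

theorem chain_seg_le:
  assumes "gromov \<omega>" "chain \<omega> x y t" shows "x = y \<or> seg_le \<omega> x y (2 * t)"
proof -
  obtain n c u where c: "c 0 = x" "c n = y" "\<forall>i. 0 \<le> u i"
    "\<forall>i<n. seg_le \<omega> (c i) (c (Suc i)) (u i)" "(\<Sum>i<n. u i) \<le> t"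
    using chain_function[OF assms(2)] by blast
  show ?thesis
  proof (cases n)
    case 0
    then show ?thesis using c by simp
  next
    case (Suc k)
    then have "seg_le \<omega> (c 0) (c n) (2 * (\<Sum>i=0..<n. u i))" using seg_le_sum[OF assms(1), of u 0 n c] c by blast
    then show ?thesis using c seg_le_mono unfolding lessThan_atLeast0 by (metis mult_left_mono zero_le_numeral)
  qed
qed

lemma chain_in: "chain \<omega> x y t \<Longrightarrow> x \<in> V \<and> y \<in> V"
  by (induction rule: chain.induct) (auto simp: seg_le_def dest: reach_in)

lemma chain_reach: "chain \<omega> x y t \<Longrightarrow> reach x y"
  by (induction rule: chain.induct) (auto simp: seg_le_def intro: reach_refl reach_trans)

lemma chain_mono: "chain \<omega> x y s \<Longrightarrow> s \<le> t \<Longrightarrow> chain \<omega> x y t"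
  by (induction rule: chain.induct) (auto intro: chain.intros)

lemma chain_seg_leI: "seg_le \<omega> x y t \<Longrightarrow> 0 \<le> t \<Longrightarrow> chain \<omega> x y t"
  by (rule chain_step[of \<omega> x x 0 y t]) (auto intro: chain_refl simp: seg_le_def dest: reach_in)

lemma chain_trans:
  assumes "chain \<omega> y z c" "chain \<omega> x y a" "a + c \<le> t" shows "chain \<omega> x z t"
  using assms
proof (induction arbitrary: t rule: chain.induct)
  case (chain_refl y s)
  then show ?case using chain_mono by auto
next
  case (chain_step y u a' z e s)
  show ?case
    by (rule chain.chain_step[of \<omega> x u "a + a'" z e]) (use chain_step in auto)
qed

text \<open>In a triangle \<open>a \<rightarrow> x \<rightarrow> y\<close>, small weights on the sides from \<open>a\<close> do not control the whole weight
  on the third side from \<open>x\<close> to \<open>y\<close>, but they control its in-weight. A second triangle \<open>x \<rightarrow> y \<rightarrow> z\<close>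
  controls its out-weight.\<close>
lemma seg_le_quadrangle:
  assumes ab: "seg_le (weight s) a x t" and ac: "seg_le (weight s) a y t"
    and bc: "seg_le (weight s) x z t" and cc: "seg_le (weight s) y z t" and r: "reach x y"
  shows "seg_le (weight s) x y (K * t)"
  unfolding seg_le_def
proof (intro conjI r ballI weight_leI)
  fix p assume p: "p \<in> seg x y"
  have "reach x z" "reach y z" "reach a x" "reach a y" using assms unfolding seg_le_def by auto
  obtain B where "B \<subseteq> seg y z" "side B y z" using side_of_reach[OF \<open>reach y z\<close>] by blast
  then obtain q where "q \<in> seg x z \<union> seg y z" "reaches \<kappa> p q"
    using forward_close[OF p \<open>reach x z\<close>] by blast
  then have "out_weight s p \<le> K * out_weight s q" "weight s q \<le> t"
    using out_weight_step bc cc unfolding seg_le_def by blast+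
  then show "out_weight s p \<le> K * t"
    using out_le_weight[of s q] by (meson exp_ge_zero mult_left_mono order_trans)
  obtain B where "B \<subseteq> seg a x" "side B x a" using side_of_reach[OF \<open>reach a x\<close>] by blast
  then obtain q where "q \<in> seg a y \<union> seg a x" "reaches \<kappa> q p"
    using backward_close[OF p \<open>reach a y\<close>] by blast
  then have "in_weight s p \<le> K * in_weight s q" "weight s q \<le> t"
    using in_weight_step ab ac unfolding seg_le_def by blast+
  then show "in_weight s p \<le> K * t"
    using in_le_weight[of s q] by (meson exp_ge_zero mult_left_mono order_trans)
qed

end

section \<open>Rays, tails and links\<close>

context visual_space
begin

lemma spread_weight:
  assumes "spread C R" "0 < t" shows "\<forall>\<^sub>F i in sequentially. weight s (R i) \<le> t"
proof -
  obtain n where n: "exp (- \<epsilon> * real n) < t" using small_exp assms(2) by blast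
  have "weight s (R i) \<le> t" if "\<not> near s n (R i)" for i
    using weight_gt_near[of n s "R i"] that n by linarith
  then show ?thesis using spread_escapes[OF assms(1), of s n] by (rule eventually_mono[rotated])
qed

lemma geometric_sum_both_sides:
  fixes q :: real assumes "0 \<le> q" "q < 1" "finite F"
  shows "(\<Sum>j\<in>F. q ^ (if i \<le> j then j - i else i - j)) \<le> 2 / (1 - q)"
proof -
  have one: "(\<Sum>j\<in>G. q ^ h j) \<le> 1 / (1 - q)" if "inj_on h G" "G \<subseteq> F" for h :: "nat \<Rightarrow> nat" and G
  proof -
    have "(\<Sum>j\<in>G. q ^ h j) = (\<Sum>k\<in>h ` G. q ^ k)" using sum.reindex[OF that(1), of "\<lambda>k. q ^ k"] by simp
    also have "\<dots> \<le> (\<Sum>k. q ^ k)"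
      using assms that finite_subset by (intro sum_le_suminf summable_geometric) auto
    also have "\<dots> = 1 / (1 - q)" using assms by (intro suminf_geometric) auto
    finally show ?thesis .
  qed
  let ?h = "\<lambda>j. if i \<le> j then j - i else i - j"
  have "(\<Sum>j\<in>F. q ^ ?h j) = (\<Sum>j\<in>F \<inter> {i..}. q ^ ?h j) + (\<Sum>j\<in>F - {i..}. q ^ ?h j)"
    using sum.Int_Diff[OF assms(3)] by blast
  also have "\<dots> \<le> 1 / (1 - q) + 1 / (1 - q)"
    by (intro add_mono one) (auto simp: inj_on_def)
  finally show ?thesis by simp
qed

text \<open>Let \<open>i\<^sub>0\<close> be an index of maximal weight. By \<open>spread\<close> the distance from \<open>s\<close> grows at least linearly in
  \<open>|j - i\<^sub>0|\<close>, so the square roots of the weights are dominated by a geometric series. The other factor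
  \<open>sqrt t\<close> makes the sums uniformly small as soon as all their terms are small. The weights may be
  replaced by 0 at some indices, so that the lemma applies to in-weights as well.\<close>
lemma spread_weight_sum:
  assumes "spread C R"
  shows "\<exists>B\<ge>0. \<forall>s \<omega> F t. finite F \<longrightarrow> 0 \<le> t \<longrightarrow>
     (\<forall>i\<in>F. \<omega> i \<le> t \<and> (\<omega> i = 0 \<or> (\<exists>n. near s n (R i) \<and> \<omega> i = exp (- \<epsilon> * real n)))) \<longrightarrow>
     (\<Sum>i\<in>F. \<omega> i) \<le> B * sqrt t"
proof -
  define D where "D = real C + 1"
  have D: "0 < D" "real C \<le> D" unfolding D_def by auto
  define q where "q = exp (- \<epsilon> / (4 * D))"
  have q: "0 \<le> q" "q < 1" using eps_pos D unfolding q_def by auto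
  define B where "B = exp \<epsilon> * (2 / (1 - q))"
  have "0 \<le> B" using q unfolding B_def by simp
  moreover have "(\<Sum>i\<in>F. \<omega> i) \<le> B * sqrt t"
    if F: "finite F" and \<omega>: "\<forall>i\<in>F. \<omega> i \<le> t \<and> (\<omega> i = 0 \<or> (\<exists>n. near s n (R i) \<and> \<omega> i = exp (- \<epsilon> * real n)))"
      and t: "0 \<le> t" for s \<omega> F t
  proof (cases "\<forall>i\<in>F. \<omega> i = 0")
    case True
    then show ?thesis using \<open>0 \<le> B\<close> t by simp
  next
    case False
    define F' where "F' = {i\<in>F. \<omega> i \<noteq> 0}"
    have F': "finite F'" "F' \<noteq> {}" using F False unfolding F'_def by auto
    have "\<forall>i\<in>F'. \<exists>n. near s n (R i) \<and> \<omega> i = exp (- \<epsilon> * real n)"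
      using \<omega> unfolding F'_def by blast
    then obtain e where e: "\<And>i. i \<in> F' \<Longrightarrow> near s (e i) (R i) \<and> \<omega> i = exp (- \<epsilon> * real (e i))"
      by metis
    obtain i0 where i0: "i0 \<in> F'" "\<And>i. i \<in> F' \<Longrightarrow> e i0 \<le> e i"
      using arg_min_if_finite(1)[OF F', of e] arg_min_least[OF F', of _ e] by blast
    let ?h = "\<lambda>j. if i0 \<le> j then j - i0 else i0 - j"
    have key: "\<omega> j \<le> exp \<epsilon> * q ^ ?h j * sqrt t" if j: "j \<in> F'" for j
    proof -
      have "near s (e j) (R j)" "near s (e i0) (R i0)" using e j i0(1) by auto
      then have "?h j \<le> C * (e j + e i0 + 1)"
        using assms[unfolded spread_def, rule_format, of s "e j" j "e i0" i0]
          assms[unfolded spread_def, rule_format, of s "e i0" i0 "e j" j]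
        by (cases "i0 \<le> j") (auto simp: add.commute)
      also have "\<dots> \<le> C * (2 * e j + 1)" using i0(2)[OF j] by simp
      finally have "real (?h j) \<le> real (C * (2 * e j + 1))" by (rule of_nat_mono)
      also have "\<dots> = real C * (2 * real (e j) + 1)" by (simp add: algebra_simps)
      also have "\<dots> \<le> D * (2 * real (e j) + 1)" using D by (intro mult_right_mono) auto
      finally have h: "real (?h j) \<le> D * (2 * real (e j) + 1)" .
      then have "\<epsilon> * real (?h j) \<le> \<epsilon> * (D * (2 * real (e j) + 1))" using eps_pos by (intro mult_left_mono) auto
      then have "\<epsilon> * real (?h j) / (4 * D) \<le> \<epsilon> * (D * (2 * real (e j) + 1)) / (4 * D)"
        using D by (intro divide_right_mono) auto
      also have "\<dots> = \<epsilon> * (2 * real (e j) + 1) / 4" using D by simp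
      finally have "- \<epsilon> * real (e j) / 2 \<le> \<epsilon> + real (?h j) * (- \<epsilon> / (4 * D))"
        using eps_pos by (simp add: algebra_simps)
      then have "exp (- \<epsilon> * real (e j) / 2) \<le> exp \<epsilon> * q ^ ?h j"
        unfolding q_def exp_of_nat_mult[symmetric] exp_add[symmetric] by simp
      moreover have "exp (- \<epsilon> * real (e j) / 2) \<le> sqrt t"
      proof (rule real_le_rsqrt)
        have "(exp (- \<epsilon> * real (e j) / 2))\<^sup>2 = \<omega> j" using e[OF j] by (simp add: power2_eq_square flip: exp_add)
        then show "(exp (- \<epsilon> * real (e j) / 2))\<^sup>2 \<le> t" using \<omega> j unfolding F'_def by auto
      qed
      ultimately have "exp (- \<epsilon> * real (e j) / 2) * exp (- \<epsilon> * real (e j) / 2) \<le> (exp \<epsilon> * q ^ ?h j) * sqrt t"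
        using q by (intro mult_mono) auto
      then show ?thesis using e[OF j] by (simp flip: exp_add)
    qed
    have "(\<Sum>i\<in>F. \<omega> i) = (\<Sum>i\<in>F'. \<omega> i)"
      unfolding F'_def using F by (intro sum.mono_neutral_right) auto
    also have "\<dots> \<le> (\<Sum>i\<in>F'. exp \<epsilon> * q ^ ?h i * sqrt t)" by (intro sum_mono key)
    also have "\<dots> = exp \<epsilon> * sqrt t * (\<Sum>i\<in>F'. q ^ ?h i)" by (simp add: sum_distrib_left mult_ac)
    also have "\<dots> \<le> exp \<epsilon> * sqrt t * (2 / (1 - q))"
      using geometric_sum_both_sides[OF q F'(1)] t by (intro mult_left_mono) auto
    finally show ?thesis unfolding B_def by (simp add: mult_ac)
  qed
  ultimately show ?thesis by blast
qed

lemma seg_le_edge: "reaches 1 x y \<Longrightarrow> (\<And>p. 0 \<le> \<omega> p) \<Longrightarrow> seg_le \<omega> x y (\<omega> x + \<omega> y)"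
proof -
  assume e: "reaches 1 x y" and n: "\<And>p. 0 \<le> \<omega> p"
  have "\<omega> p \<le> \<omega> x + \<omega> y" if "p \<in> seg x y" for p
    using seg_edge[OF e] that n[of x] n[of y] by auto
  then show ?thesis using e unfolding seg_le_def reaches_def by blast
qed

lemma chain_along_forward:
  assumes "\<And>i. reaches 1 (R i) (R (Suc i))" "\<And>p. 0 \<le> \<omega> p" "l \<le> m"
  shows "chain \<omega> (R l) (R m) (2 * (\<Sum>i=l..m. \<omega> (R i)))"
proof -
  have "chain \<omega> (R l) (R m) (2 * (\<Sum>i=l..<m. \<omega> (R i)) + \<omega> (R m))"
    using assms(3)
  proof (induction m rule: dec_induct)
    case base
    then show ?case using assms reach_in unfolding reaches_def by (auto intro!: chain_refl)
  next
    case (step m)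
    show ?case
      by (rule chain_step[OF step.IH seg_le_edge[OF assms(1), of \<omega> m]]) (use assms step in auto)
  qed
  moreover have "(\<Sum>i=l..m. \<omega> (R i)) = (\<Sum>i=l..<m. \<omega> (R i)) + \<omega> (R m)"
    using assms(3) by (simp add: atLeastLessThanSuc_atLeastAtMost[symmetric])
  ultimately show ?thesis using assms(2)[of "R m"] by (auto intro: chain_mono)
qed

lemma chain_along_backward:
  assumes "\<And>i. reaches 1 (R (Suc i)) (R i)" "\<And>p. 0 \<le> \<omega> p" "l \<le> m"
  shows "chain \<omega> (R m) (R l) (2 * (\<Sum>i=l..m. \<omega> (R i)))"
proof -
  have "chain \<omega> (R m) (R l) (2 * (\<Sum>i=l..<m. \<omega> (R i)) + \<omega> (R m))"
    using assms(3)
  proof (induction m rule: dec_induct)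
    case base
    then show ?case using assms reach_in unfolding reaches_def by (auto intro!: chain_refl)
  next
    case (step m)
    have "chain \<omega> (R (Suc m)) (R m) (\<omega> (R (Suc m)) + \<omega> (R m))"
      by (rule chain_seg_leI[OF seg_le_edge[OF assms(1), of \<omega> m]]) (use assms in auto)
    then show ?case
      by (rule chain_trans[OF step.IH]) (use assms step in auto)
  qed
  moreover have "(\<Sum>i=l..m. \<omega> (R i)) = (\<Sum>i=l..<m. \<omega> (R i)) + \<omega> (R m)"
    using assms(3) by (simp add: atLeastLessThanSuc_atLeastAtMost[symmetric])
  ultimately show ?thesis using assms(2)[of "R m"] by (auto intro: chain_mono)
qed

text \<open>The members of the sequence are eventually joined, in increasing or in decreasing order, by chains of
  arbitrarily small cost. Every representative of a point of the extended digraph is of one of these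
  two kinds: constant sequences and rays of the first, anti-rays of the second.\<close>
definition out_tail :: "(nat \<Rightarrow> 'a) \<Rightarrow> bool" where
  "out_tail R \<longleftrightarrow> (\<forall>s t. 0 < t \<longrightarrow> (\<forall>\<^sub>F l in sequentially. \<forall>m\<ge>l. chain (weight s) (R l) (R m) t))"

definition in_tail :: "(nat \<Rightarrow> 'a) \<Rightarrow> bool" where
  "in_tail R \<longleftrightarrow> (\<forall>s t. 0 < t \<longrightarrow> (\<forall>\<^sub>F l in sequentially. \<forall>m\<ge>l. chain (weight s) (R m) (R l) t))"

lemma tail_sum:
  assumes "spread C R" "0 < t"
  shows "\<forall>\<^sub>F l in sequentially. \<forall>m\<ge>l. 2 * (\<Sum>i=l..m. weight s (R i)) \<le> t"
proof -
  obtain B where B: "0 \<le> B" "\<forall>s \<omega> F t. finite F \<longrightarrow> 0 \<le> t \<longrightarrow>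
     (\<forall>i\<in>F. \<omega> i \<le> t \<and> (\<omega> i = 0 \<or> (\<exists>n. near s n (R i) \<and> \<omega> i = exp (- \<epsilon> * real n)))) \<longrightarrow>
     (\<Sum>i\<in>F. \<omega> i) \<le> B * sqrt t" using spread_weight_sum[OF assms(1)] by blast
  have zero: "weight s p = 0 \<or> (\<exists>n. near s n p \<and> weight s p = exp (- \<epsilon> * real n))" for p
    using weight_near[of s p] weight_nonneg[of s p] by (cases "weight s p = 0") auto
  define u where "u = (t / (2 * (B + 1)))\<^sup>2"
  have u: "0 < u" "sqrt u = t / (2 * (B + 1))" using B assms unfolding u_def by auto
  have le: "2 * (B * sqrt u) \<le> t" using B assms unfolding u by (simp add: field_simps)
  from spread_weight[OF assms(1) u(1), of s] obtain N where N: "\<And>i. N \<le> i \<Longrightarrow> weight s (R i) \<le> u"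
    unfolding eventually_sequentially by blast
  have "2 * (\<Sum>i=l..m. weight s (R i)) \<le> t" if "N \<le> l" for l m
  proof -
    have "(\<Sum>i\<in>{l..m}. weight s (R i)) \<le> B * sqrt u"
      by (rule B(2)[rule_format, of _ _ _ s]) (use u N that zero in auto)
    then show ?thesis using le by linarith
  qed
  then show ?thesis unfolding eventually_sequentially by blast
qed

lemma forward_ray_tail: assumes "forward_ray C R" shows "out_tail R"
  unfolding out_tail_def
proof (intro allI impI)
  fix s :: 'a and t :: real assume "0 < t"
  have e: "\<And>i. reaches 1 (R i) (R (Suc i))" using assms unfolding forward_ray_def by blast
  from tail_sum[OF spread_ray \<open>0 < t\<close>, of C R s] assms
  have "\<forall>\<^sub>F l in sequentially. \<forall>m\<ge>l. 2 * (\<Sum>i=l..m. weight s (R i)) \<le> t" by blast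
  then show "\<forall>\<^sub>F l in sequentially. \<forall>m\<ge>l. chain (weight s) (R l) (R m) t"
  proof (rule eventually_mono, intro allI impI)
    fix l m assume "\<forall>m\<ge>l. 2 * (\<Sum>i=l..m. weight s (R i)) \<le> t" "l \<le> m"
    then show "chain (weight s) (R l) (R m) t"
      using chain_along_forward[of R "weight s" l m, OF e weight_nonneg] chain_mono by blast
  qed
qed

lemma backward_ray_tail: assumes "backward_ray C R" shows "in_tail R"
  unfolding in_tail_def
proof (intro allI impI)
  fix s :: 'a and t :: real assume "0 < t"
  have e: "\<And>i. reaches 1 (R (Suc i)) (R i)" using assms unfolding backward_ray_def by blast
  from tail_sum[OF spread_ray \<open>0 < t\<close>, of C R s] assms
  have "\<forall>\<^sub>F l in sequentially. \<forall>m\<ge>l. 2 * (\<Sum>i=l..m. weight s (R i)) \<le> t" by blast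
  then show "\<forall>\<^sub>F l in sequentially. \<forall>m\<ge>l. chain (weight s) (R m) (R l) t"
  proof (rule eventually_mono, intro allI impI)
    fix l m assume "\<forall>m\<ge>l. 2 * (\<Sum>i=l..m. weight s (R i)) \<le> t" "l \<le> m"
    then show "chain (weight s) (R m) (R l) t"
      using chain_along_backward[of R "weight s" l m, OF e weight_nonneg] chain_mono by blast
  qed
qed

lemma constant_tail: "x \<in> V \<Longrightarrow> out_tail (\<lambda>_. x)"
  unfolding out_tail_def by (auto intro: chain_refl)

text \<open>The sequences \<open>X\<close> and \<open>Y\<close> are joined by chains of cost at most \<open>t\<close> arbitrarily far out. Only
  some pairs of members are required to be joined, as a finite value of \<open>\<rho>\<^sub>s\<close> does not provide more.\<close>
definition link :: "'a \<Rightarrow> (nat \<Rightarrow> 'a) \<Rightarrow> (nat \<Rightarrow> 'a) \<Rightarrow> real \<Rightarrow> bool" where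
  "link s X Y t \<longleftrightarrow> (\<forall>N. \<exists>i\<ge>N. \<exists>j\<ge>N. chain (weight s) (X i) (Y j) t)"

lemma link_mono: "link s X Y t \<Longrightarrow> t \<le> u \<Longrightarrow> link s X Y u"
  unfolding link_def using chain_mono by metis

lemma link_constant: "x \<in> V \<Longrightarrow> 0 \<le> t \<Longrightarrow> link s (\<lambda>_. x) (\<lambda>_. x) t"
  unfolding link_def using chain_refl by auto

text \<open>A chain into \<open>Y\<close> and a chain out of \<open>Y\<close> have to be joined by a piece of \<open>Y\<close> itself. The kind of tail
  of \<open>Y\<close> decides which of the two chains has to be chosen first, so that this piece runs in the right
  direction.\<close>
lemma link_trans:
  assumes XY: "link s X Y t" and YZ: "link s Y Z u" and Y: "out_tail Y \<or> in_tail Y" and e: "0 < e"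
  shows "link s X Z (t + u + e)"
  unfolding link_def
proof
  fix N
  show "\<exists>i\<ge>N. \<exists>j\<ge>N. chain (weight s) (X i) (Z j) (t + u + e)"
    using Y
  proof
    assume "out_tail Y"
    then obtain M where M: "\<And>l m. M \<le> l \<Longrightarrow> l \<le> m \<Longrightarrow> chain (weight s) (Y l) (Y m) e"
      using e unfolding out_tail_def eventually_sequentially by blast
    obtain i j where ij: "i \<ge> N" "j \<ge> max M N" "chain (weight s) (X i) (Y j) t"
      using XY unfolding link_def by (meson max.bounded_iff)
    obtain k l where kl: "k \<ge> max j N" "l \<ge> max j N" "chain (weight s) (Y k) (Z l) u"
      using YZ unfolding link_def by blast
    have "chain (weight s) (Y j) (Z l) (e + u)"
      using chain_trans[OF kl(3) M[of j k]] ij kl by auto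
    from chain_trans[OF this ij(3)] have "chain (weight s) (X i) (Z l) (t + u + e)" by simp
    then show ?thesis using ij kl by (meson max.bounded_iff)
  next
    assume "in_tail Y"
    then obtain M where M: "\<And>l m. M \<le> l \<Longrightarrow> l \<le> m \<Longrightarrow> chain (weight s) (Y m) (Y l) e"
      using e unfolding in_tail_def eventually_sequentially by blast
    obtain k l where kl: "k \<ge> max M N" "l \<ge> max M N" "chain (weight s) (Y k) (Z l) u"
      using YZ unfolding link_def by blast
    obtain i j where ij: "i \<ge> max k N" "j \<ge> max k N" "chain (weight s) (X i) (Y j) t"
      using XY unfolding link_def by blast
    have "chain (weight s) (Y j) (Z l) (e + u)"
      using chain_trans[OF kl(3) M[of k j]] ij kl by auto
    from chain_trans[OF this ij(3)] have "chain (weight s) (X i) (Z l) (t + u + e)" by simp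
    then show ?thesis using ij kl by (meson max.bounded_iff)
  qed
qed

text \<open>For \<open>t > 0\<close> this says \<open>L\<^sub>s(X, Y) \<ge> - ln t / \<epsilon>\<close>, up to the difference between \<open>\<ge>\<close> and \<open>>\<close>; the first
  conjunct excludes \<open>L\<^sub>s(X, Y) = - \<infinity>\<close>.\<close>
definition limit_bound :: "'a \<Rightarrow> (nat \<Rightarrow> 'a) \<Rightarrow> (nat \<Rightarrow> 'a) \<Rightarrow> real \<Rightarrow> bool" where
  "limit_bound s X Y t \<longleftrightarrow> (\<forall>N. \<exists>i\<ge>N. \<exists>j\<ge>N. reach (X i) (Y j)) \<and>
     (\<exists>N. \<forall>i\<ge>N. \<forall>j\<ge>N. reach (X i) (Y j) \<longrightarrow> seg_le (weight s) (X i) (Y j) t)"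

lemma limit_bound_link:
  assumes "limit_bound s X Y t" "0 \<le> t" shows "link s X Y t"
  unfolding link_def
proof
  fix N
  obtain M where M: "\<And>i j. i \<ge> M \<Longrightarrow> j \<ge> M \<Longrightarrow> reach (X i) (Y j) \<Longrightarrow> seg_le (weight s) (X i) (Y j) t"
    using assms unfolding limit_bound_def by blast
  obtain i j where "i \<ge> max M N" "j \<ge> max M N" "reach (X i) (Y j)"
    using assms unfolding limit_bound_def by blast
  then show "\<exists>i\<ge>N. \<exists>j\<ge>N. chain (weight s) (X i) (Y j) t"
    using M chain_seg_leI[OF _ assms(2)] by (meson max.bounded_iff)
qed

lemma seg_le_short:
  assumes "reaches n x y" "out_weight s y \<le> t" "in_weight s x \<le> t"
  shows "seg_le (weight s) x y (exp (\<epsilon> * real n) * t)"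
  unfolding seg_le_def
proof (intro conjI ballI weight_leI)
  show "reach x y" using assms unfolding reaches_def by blast
  fix u assume "u \<in> seg x y"
  then have u: "reaches n u y" "reaches n x u" using assms(1) unfolding seg_def reaches_def by auto
  show "out_weight s u \<le> exp (\<epsilon> * real n) * t"
    using out_weight_step[OF u(1), of s] assms(2) by (meson exp_ge_zero mult_left_mono order_trans)
  show "in_weight s u \<le> exp (\<epsilon> * real n) * t"
    using in_weight_step[OF u(2), of s] assms(3) by (meson exp_ge_zero mult_left_mono order_trans)
qed

text \<open>This is how the preorder on rays is used. The short paths from \<open>X\<close> to \<open>Y\<close> start far out on \<open>X\<close>. They
  also end far out on \<open>Y\<close>, because a fixed vertex of \<open>Y\<close> is near to finitely many members of
  \<open>X\<close> only. Then both ends, and hence all vertices in between, have small weight for every \<open>s\<close>.\<close>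
lemma link_of_short_paths:
  assumes X: "spread C X" and Y: "spread C' Y" and X0: "\<And>i. near (X 0) i (X i)"
    and short: "\<And>n. \<exists>i j. reaches M (X i) (Y j) \<and> \<not> near (X 0) n (X i)"
    and t: "0 < t"
  shows "link s X Y t"
  unfolding link_def
proof
  fix N
  define u where "u = exp (- (\<epsilon> * real M)) * t"
  have u: "0 < u" "exp (\<epsilon> * real M) * u = t" using t unfolding u_def by (auto simp: exp_minus)
  obtain N' where N': "N \<le> N'" "\<And>j. N' \<le> j \<Longrightarrow> weight s (Y j) \<le> u"
    using spread_weight[OF Y u(1), of s] unfolding eventually_sequentially by (meson nat_le_linear order_trans)
  have "\<forall>\<^sub>F i in sequentially. (\<forall>j\<in>{..<N'}. \<not> near (Y j) M (X i)) \<and> weight s (X i) \<le> u \<and> N \<le> i"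
    using spread_escapes[OF X] spread_weight[OF X u(1), of s] eventually_ge_at_top
    by (intro eventually_conj eventually_ball_finite) auto
  then obtain A where A: "\<And>i. A \<le> i \<Longrightarrow> (\<forall>j<N'. \<not> near (Y j) M (X i)) \<and> weight s (X i) \<le> u \<and> N \<le> i"
    unfolding eventually_sequentially by auto
  obtain i j where ij: "reaches M (X i) (Y j)" "\<not> near (X 0) A (X i)" using short by blast
  have i: "A \<le> i" using ij(2) X0[of i] near_mono nat_le_linear by blast
  have j: "N' \<le> j" using A[OF i] ij(1) unfolding near_def by (meson not_le)
  have "seg_le (weight s) (X i) (Y j) t"
    using seg_le_short[OF ij(1), of s u] N'(2)[OF j] A[OF i] u out_le_weight[of s "Y j"] in_le_weight[of s "X i"]
    by (metis order_trans)
  then show "\<exists>i\<ge>N. \<exists>j\<ge>N. chain (weight s) (X i) (Y j) t"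
    using chain_seg_leI t A[OF i] N'(1) j by (meson less_imp_le order_trans)
qed


text \<open>Close to its corner \<open>p\<close>, a triangle \<open>x \<rightarrow> p \<rightarrow> s\<close> with a short side from \<open>p\<close> to \<open>s\<close> can be
  entered from the side opposite to \<open>p\<close>: follow the geodesic from \<open>x\<close> to \<open>p\<close> up to the last vertex that
  is shortly after \<open>seg x s\<close>. The next one is near \<open>s\<close> by thinness, and so is \<open>p\<close>.\<close>
lemma corner_close:
  assumes xp: "reach x p" and ps: "reaches e p s"
  shows "\<exists>v\<in>seg x s. reaches (\<delta> + 1 + (\<delta> + e + e + 2) * (b + 1)) v p"
proof -
  have ps': "reach p s" and xs: "reach x s" using assms reach_trans unfolding reaches_def by auto
  obtain A where A: "A \<subseteq> seg x s" "side A x s" using side_of_reach[OF xs] by blast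
  obtain B where B: "B \<subseteq> seg p s" "side B p s" using side_of_reach[OF ps'] by blast
  obtain g where g: "geo g x p" using geo_exists[OF xp] by blast
  have G: "\<And>i j. i \<le> j \<Longrightarrow> j \<le> d x p \<Longrightarrow> reach (g i) (g j) \<and> d (g i) (g j) = j - i" "g (d x p) = p" "g 0 = x"
    using g unfolding geo_def by auto
  define T where "T = {n. n \<le> d x p \<and> (\<exists>v\<in>seg x s. reaches \<delta> v (g n))}"
  have "reaches \<delta> x x" using reaches_mono[OF reaches_refl] reach_in[OF xs] by blast
  then have "0 \<in> T" using G(3) seg_ends(1)[OF xs] unfolding T_def by auto
  moreover have finT: "finite T" unfolding T_def by simp
  ultimately have mx: "Max T \<in> T" using Max_in by blast
  define n where "n = Max T"
  have n: "n \<in> T" "Suc n \<notin> T" using mx Max_ge[OF finT, of "Suc n"] unfolding n_def by auto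
  then obtain v where v: "v \<in> seg x s" "reaches \<delta> v (g n)" and nle: "n \<le> d x p" unfolding T_def by blast
  have "reaches (1 + (\<delta> + e + e + 2) * (b + 1)) (g n) p"
  proof (cases "n = d x p")
    case True
    have "reaches (1 + (\<delta> + e + e + 2) * (b + 1)) p p" by (rule reaches_mono[OF reaches_refl]) (use reach_in[OF ps'] in auto)
    then show ?thesis using True G(2) by simp
  next
    case False
    then have sn: "Suc n \<le> d x p" using nle by simp
    then obtain r where r: "r \<in> B" "reaches \<delta> (g (Suc n)) r"
      using thin[OF geo_mem_seg[OF g sn] A(2) B(2)] n(2) A(1) unfolding T_def by blast
    have "reaches e r s" using r(1) B(1) ps unfolding seg_def reaches_def by auto
    then have "near (g (Suc n)) (\<delta> + e) s" using reaches_trans[OF r(2)] unfolding near_def by blast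
    moreover have "near p e s" using ps unfolding near_def by blast
    moreover have gs: "reach (g (Suc n)) p" using G(1)[OF sn order_refl] G(2) by simp
    ultimately have "reaches ((\<delta> + e + e + 2) * (b + 1)) (g (Suc n)) p"
      using length_bound unfolding reaches_def by blast
    moreover have "reaches 1 (g n) (g (Suc n))" using G(1)[OF _ sn, of n] unfolding reaches_def by simp
    ultimately show ?thesis using reaches_trans by blast
  qed
  then show ?thesis using reaches_trans[OF v(2)] v(1) by (metis add.assoc order_refl)
qed

text \<open>A vertex \<open>p\<close> that is reached from far out on an anti-ray \<open>X\<close> and has a short path to \<open>s\<close> is close to one
  of finitely many members of \<open>X\<close>. A vertex shortly before \<open>p\<close> lies on a geodesic from \<open>X i\<close> to \<open>s\<close>, hence
  has large in-weight for the base \<open>p\<close>. Comparing with the chain that runs along \<open>X\<close> to \<open>X i0\<close> and on to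
  \<open>s\<close>, some member \<open>X l\<close> also has large in-weight, so it is shortly before \<open>p\<close> and hence shortly before \<open>s\<close>;
  this bounds \<open>l\<close>.\<close>
lemma near_backward_ray:
  assumes X: "backward_ray C X" and i0: "reach (X i0) s"
  shows "\<exists>F M. finite F \<and> F \<subseteq> V \<and> (\<forall>i\<ge>i0. \<forall>p. reach (X i) p \<longrightarrow> reaches e p s \<longrightarrow> (\<exists>q\<in>F. reaches M q p))"
proof -
  define C' where "C' = C * (2 * b + 3)"
  have spread: "spread C' X" using spread_ray X unfolding C'_def by blast
  define M1 where "M1 = \<delta> + 1 + (\<delta> + e + e + 2) * (b + 1)"
  define d0 where "d0 = d (X i0) s"
  obtain B where B: "0 \<le> B" "\<forall>s \<omega> F t. finite F \<longrightarrow> 0 \<le> t \<longrightarrow>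
     (\<forall>i\<in>F. \<omega> i \<le> t \<and> (\<omega> i = 0 \<or> (\<exists>n. near s n (X i) \<and> \<omega> i = exp (- \<epsilon> * real n)))) \<longrightarrow>
     (\<Sum>i\<in>F. \<omega> i) \<le> B * sqrt t" using spread_weight_sum[OF spread] by blast
  define A where "A = exp (\<epsilon> * real d0)"
  have A: "1 \<le> A" unfolding A_def using eps_pos by simp
  \<comment> \<open>The choice of \<open>n\<close> makes the chain cheaper than the in-weight of a vertex at most \<open>M1\<close> steps before \<open>p\<close>.\<close>
  obtain n where n: "exp (- \<epsilon> * real n) < exp (- \<epsilon> * real M1) / (4 * B + 2 * A)"
    using small_exp[of "exp (- \<epsilon> * real M1) / (4 * B + 2 * A)"] A B by auto
  define w where "w = exp (- \<epsilon> * real n)"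
  define \<theta> where "\<theta> = exp (- \<epsilon> * real (2 * n))"
  have w: "0 < w" "w \<le> 1" unfolding w_def using eps_pos by auto
  have \<theta>: "\<theta> = w * w" unfolding \<theta>_def w_def by (simp flip: exp_add)
  have \<theta>s: "sqrt \<theta> = w" "0 \<le> \<theta>" "\<theta> \<le> w" unfolding \<theta> using w mult_left_mono[of w 1 w] by auto
  have wM: "w * (4 * B + 2 * A) < exp (- \<epsilon> * real M1)"
    using n A B unfolding w_def[symmetric] by (simp add: pos_less_divide_eq)
  have small: "2 * (2 * (B * w) + A * \<theta>) < exp (- \<epsilon> * real M1)"
  proof -
    have "A * \<theta> \<le> A * w" using mult_left_mono[OF \<theta>s(3), of A] A by simp
    then have "2 * (2 * (B * w) + A * \<theta>) \<le> 2 * (2 * (B * w) + A * w)" by simp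
    also have "\<dots> = w * (4 * B + 2 * A)" by (simp add: algebra_simps)
    finally show ?thesis using wM by simp
  qed
  have \<theta>M: "\<theta> < exp (- \<epsilon> * real M1)"
  proof -
    have "1 \<le> 4 * B + 2 * A" using A B(1) by linarith
    then have "w * 1 \<le> w * (4 * B + 2 * A)" using w by (intro mult_left_mono) auto
    then have "\<theta> \<le> w * (4 * B + 2 * A)" using \<theta>s(3) by linarith
    then show ?thesis using wM by simp
  qed
  define M where "M = 2 * n"
  define L where "L = C' * (d0 + (M + e) + 1)"
  have "\<exists>q\<in>X ` {i0..i0 + L}. reaches M q p" if i: "i0 \<le> i" and ip: "reach (X i) p" and ps: "reaches e p s" for i p
  proof -
    have "\<exists>l\<in>{i0..i}. \<theta> < in_weight p (X l)"
    proof (rule ccontr)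
      assume "\<not> ?thesis"
      then have le: "in_weight p (X l) \<le> \<theta>" if "i0 \<le> l" "l \<le> i" for l using that by force
      have step: "\<And>i. reaches 1 (X (Suc i)) (X i)" using X unfolding backward_ray_def by blast
      have zero: "in_weight p q = 0 \<or> (\<exists>n. near p n q \<and> in_weight p q = exp (- \<epsilon> * real n))" for q
        unfolding in_weight_def near_def reaches_def by auto
      have sum: "(\<Sum>l\<in>{i0..i}. in_weight p (X l)) \<le> B * sqrt \<theta>"
        by (rule B(2)[rule_format, of _ _ _ p]) (use le zero \<theta>s in auto)
      have c1: "chain (in_weight p) (X i) (X i0) (2 * (B * w))"
        by (rule chain_mono[OF chain_along_backward[of X "in_weight p", OF step in_weight_nonneg i]])
          (use sum \<theta>s(1) in simp)
      have "in_weight p q \<le> A * \<theta>" if "q \<in> seg (X i0) s" for q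
      proof -
        have "reaches d0 (X i0) q" using that unfolding seg_def reaches_def d0_def by auto
        from in_weight_step[OF this, of p] have "in_weight p q \<le> A * in_weight p (X i0)" unfolding A_def .
        also have "\<dots> \<le> A * \<theta>" using le[of i0] i A by (intro mult_left_mono) auto
        finally show ?thesis .
      qed
      then have "seg_le (in_weight p) (X i0) s (A * \<theta>)" using i0 unfolding seg_le_def by blast
      then have "chain (in_weight p) (X i) s (2 * (B * w) + A * \<theta>)"
        by (rule chain_step[OF c1]) (use A \<theta>s in auto)
      from chain_seg_le[OF gromov_in this]
      have cases: "X i = s \<or> seg_le (in_weight p) (X i) s (2 * (2 * (B * w) + A * \<theta>))" .
      obtain v where v: "v \<in> seg (X i) s" "reaches M1 v p"
        using corner_close[OF ip ps] unfolding M1_def by blast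
      have v': "exp (- \<epsilon> * real M1) \<le> in_weight p v"
        using v(2) eps_pos unfolding in_weight_def reaches_def by simp
      from cases show False
      proof
        assume "X i = s"
        then have "v = X i" using v(1) seg_trivial by simp
        then show False using v' le[of i] i \<theta>M by simp
      next
        assume "seg_le (in_weight p) (X i) s (2 * (2 * (B * w) + A * \<theta>))"
        then have "in_weight p v \<le> 2 * (2 * (B * w) + A * \<theta>)" using v(1) unfolding seg_le_def by blast
        then show False using v' small by linarith
      qed
    qed
    then obtain l where l: "i0 \<le> l" "\<theta> < in_weight p (X l)" by auto
    have r: "reach (X l) p"
      using l(2) \<theta>s(2) unfolding in_weight_def by (simp split: if_splits)
    then have "\<epsilon> * real (d (X l) p) < \<epsilon> * real M"
      using l(2) unfolding in_weight_def \<theta>_def M_def by simp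
    then have lp: "reaches M (X l) p" using r eps_pos unfolding reaches_def by simp
    have "near s (M + e) (X l)" using reaches_trans[OF lp ps order_refl] unfolding near_def by blast
    moreover have "near s d0 (X i0)" using i0 unfolding near_def reaches_def d0_def by blast
    ultimately have "l - i0 \<le> L" using spread l(1) unfolding spread_def L_def by blast
    then show ?thesis using lp l(1) by (intro bexI[of _ "X l"]) auto
  qed
  moreover have "X ` {i0..i0 + L} \<subseteq> V"
    using X reach_in unfolding backward_ray_def by blast
  ultimately show ?thesis by (intro exI[of _ "X ` {i0..i0 + L}"] exI[of _ M]) blast
qed

end

section \<open>Limits of rays under finite out-degree\<close>

locale out_finite_visual_space = visual_space +
  assumes finite_out: "x \<in> V \<Longrightarrow> finite {y. reach x y \<and> d x y = 1}"
begin

lemma finite_out_ball: assumes "x \<in> V" shows "finite {y. reaches n x y}"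
proof (induction n)
  case 0
  have "{y. reaches 0 x y} \<subseteq> {x}" unfolding reaches_def using d_zero_iff by auto
  then show ?case using finite_subset by blast
next
  case (Suc n)
  have "{y. reaches (Suc n) x y} \<subseteq> {y. reaches n x y} \<union> (\<Union>z\<in>{y. reaches n x y}. {y. reach z y \<and> d z y = 1})"
  proof
    fix y assume "y \<in> {y. reaches (Suc n) x y}"
    then have y: "reach x y" "d x y \<le> Suc n" unfolding reaches_def by auto
    show "y \<in> {y. reaches n x y} \<union> (\<Union>z\<in>{y. reaches n x y}. {y. reach z y \<and> d z y = 1})"
    proof (cases "d x y \<le> n")
      case False
      then obtain z where "reach x z" "reach z y" "d x z = n" "d z y = 1"
        using d_between[OF y(1), of n] y(2) by auto
      then show ?thesis unfolding reaches_def by auto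
    qed (use y in \<open>auto simp: reaches_def\<close>)
  qed
  moreover have "finite {y. reach z y \<and> d z y = 1}" if "z \<in> {y. reaches n x y}" for z
    using that reach_in unfolding reaches_def by (intro finite_out) auto
  ultimately show ?case using Suc finite_subset by (metis (no_types, lifting) finite_UN finite_UnI)
qed

text \<open>Koenig's lemma: a vertex on geodesics from \<open>v\<close> to infinitely many of the \<open>y m\<close> has a successor of the
  same kind, since it has only finitely many out-neighbours.\<close>
lemma koenig_ray:
  assumes v: "v \<in> V" and r: "\<forall>\<^sub>F m in sequentially. reach v (y m)"
    and far: "\<And>n. \<forall>\<^sub>F m in sequentially. \<not> reaches n v (y m)"
  shows "\<exists>Q. Q 0 = v \<and> geodesic_ray Q \<and> (\<forall>k. \<exists>\<^sub>F m in sequentially. Q k \<in> seg v (y m))"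
proof -
  define P where "P = (\<lambda>k z. reach v z \<and> d v z = k \<and> (\<exists>\<^sub>F m in sequentially. z \<in> seg v (y m)))"
  have "\<forall>\<^sub>F m in sequentially. v \<in> seg v (y m)" using r by eventually_elim (rule seg_ends)
  then have P0: "P 0 v"
    unfolding P_def using v reach_refl by (auto intro: eventually_frequently)
  have step: "\<exists>z'. P (Suc k) z' \<and> reach z z' \<and> d z z' = 1" if "P k z" for k z
  proof -
    have z: "reach v z" "d v z = k" "\<exists>\<^sub>F m in sequentially. z \<in> seg v (y m)"
      using that unfolding P_def by auto
    let ?N = "{z'. reach z z' \<and> d z z' = 1}"
    have "finite ?N" using finite_out reach_in[OF z(1)] by blast
    have nxt: "\<exists>z'\<in>?N. d v z' = Suc k \<and> z' \<in> seg v (y m)" if "z \<in> seg v (y m)" "\<not> reaches k v (y m)" for m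
    proof -
      have s: "reach z (y m)" "d v z + d z (y m) = d v (y m)"
        using that(1) unfolding seg_def by auto
      have "reach v (y m)" using seg_reach[OF that(1)] .
      then have "1 \<le> d z (y m)" using that(2) z(2) s(2) unfolding reaches_def by simp
      then obtain z' where z': "reach z z'" "reach z' (y m)" "d z z' = 1" "d z' (y m) = d z (y m) - 1"
        using d_between[OF s(1)] by blast
      then have "z' \<in> seg z (y m)" using \<open>1 \<le> d z (y m)\<close> unfolding seg_def by auto
      then have zs: "z' \<in> seg v (y m)" using seg_right[OF that(1)] by blast
      then have "d v z' = Suc k" using z' z s \<open>1 \<le> d z (y m)\<close> unfolding seg_def by auto
      then show ?thesis using zs z' by blast
    qed
    have "\<exists>z'\<in>?N. d v z' = Suc k \<and> (\<exists>\<^sub>F m in sequentially. z' \<in> seg v (y m))"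
    proof (rule ccontr)
      assume "\<not> ?thesis"
      then have "\<forall>z'\<in>?N. \<forall>\<^sub>F m in sequentially. \<not> (d v z' = Suc k \<and> z' \<in> seg v (y m))"
        unfolding not_frequently[symmetric] by (auto elim: frequently_elim1)
      then have "\<forall>\<^sub>F m in sequentially. \<forall>z'\<in>?N. \<not> (d v z' = Suc k \<and> z' \<in> seg v (y m))"
        by (rule eventually_ball_finite[OF \<open>finite ?N\<close>])
      then have "\<forall>\<^sub>F m in sequentially. z \<notin> seg v (y m)"
        using far[of k]
      proof eventually_elim
        case (elim m)
        then show ?case using nxt[of m] by blast
      qed
      then show False using z(3) unfolding frequently_def by simp
    qed
    then obtain z' where "z' \<in> ?N" "d v z' = Suc k" "\<exists>\<^sub>F m in sequentially. z' \<in> seg v (y m)" by blast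
    then show ?thesis using z(1) reach_trans unfolding P_def by blast
  qed
  have "\<exists>Q. \<forall>k. (P k (Q k) \<and> (k = 0 \<longrightarrow> Q k = v)) \<and> reach (Q k) (Q (Suc k)) \<and> d (Q k) (Q (Suc k)) = 1"
    by (rule dependent_nat_choice) (use P0 step in auto)
  then obtain Q where Q: "Q 0 = v" "\<And>k. P k (Q k)" "\<And>k. reach (Q k) (Q (Suc k)) \<and> d (Q k) (Q (Suc k)) = 1"
    by blast
  have "reach (Q i) (Q (i + n)) \<and> d (Q i) (Q (i + n)) = n" for i n
  proof (induction n)
    case 0
    then show ?case using Q(2)[of i] reach_in reach_refl unfolding P_def by auto
  next
    case (Suc n)
    have r: "reach (Q i) (Q (i + Suc n))" using Suc Q(3)[of "i + n"] reach_trans by auto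
    have "d (Q i) (Q (i + Suc n)) \<le> n + 1" using d_triangle[of "Q i" "Q (i + n)" "Q (i + Suc n)"] Suc Q(3)[of "i + n"] by auto
    moreover have "d v (Q (i + Suc n)) \<le> d v (Q i) + d (Q i) (Q (i + Suc n))"
      using d_triangle[OF _ r] Q(2)[of i] unfolding P_def by blast
    moreover have "d v (Q (i + Suc n)) = i + Suc n" "d v (Q i) = i" using Q(2) unfolding P_def by blast+
    ultimately have "d (Q i) (Q (i + Suc n)) = Suc n" by linarith
    then show ?case using r by blast
  qed
  then have "geodesic_ray Q" unfolding geodesic_ray_def by (metis add_diff_cancel_left' le_Suc_ex)
  then show ?thesis using Q unfolding P_def by blast
qed

text \<open>Among the vertices reached from \<open>v\<close>, being far from \<open>v\<close> implies being far from any other base vertex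
  \<open>s\<close>: the out-ball around \<open>s\<close> is finite, and the vertices of its in-ball are controlled by
  \<open>length_bound\<close> for the triangle with corners \<open>v\<close>, \<open>p\<close>, \<open>s\<close>.\<close>
lemma far_from_root:
  assumes v: "v \<in> V" and s: "s \<in> V" and t: "0 < t"
  shows "\<exists>n. \<forall>p. reach v p \<longrightarrow> \<not> reaches n v p \<longrightarrow> weight s p \<le> t"
proof -
  obtain e where e: "exp (- \<epsilon> * real e) < t" using small_exp t by blast
  let ?F = "{p. reaches e s p}"
  define n where "n = Max (insert 0 (d v ` ?F)) + (d v s + e + 2) * (b + 1)"
  have "weight s p \<le> t" if p: "reach v p" "\<not> reaches n v p" for p
  proof (rule ccontr)
    assume "\<not> weight s p \<le> t"
    then have "near s e p" using weight_gt_near[of e s p] e by linarith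
    then show False
      unfolding near_def
    proof
      assume "reaches e s p"
      then have "d v p \<le> Max (insert 0 (d v ` ?F))" using finite_out_ball[OF s] by (intro Max_ge) auto
      then show False using p unfolding reaches_def n_def by auto
    next
      assume ps: "reaches e p s"
      then have "reach v s" using p(1) reach_trans unfolding reaches_def by blast
      then have "near v (d v s) s" "near p e s" using ps unfolding near_def reaches_def by auto
      then have "d v p \<le> (d v s + e + 2) * (b + 1)" using length_bound p(1) by blast
      then show False using p unfolding reaches_def n_def by auto
    qed
  qed
  then show ?thesis by blast
qed

text \<open>In the triangle with corners \<open>v\<close>, \<open>x\<close>, \<open>y m\<close>, a vertex \<open>Q j\<close> of the side from \<open>v\<close> to \<open>y m\<close> which is
  farther than \<open>x\<close> from \<open>v\<close> is shortly after the side from \<open>x\<close> to \<open>y m\<close>. So \<open>Q j\<close> is reached from \<open>x\<close>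
  along this side, on which the weight is small, and a short path.\<close>
lemma approach_ray:
  assumes Q: "Q 0 = v" "geodesic_ray Q" and freq: "\<And>k. \<exists>\<^sub>F m in sequentially. Q k \<in> seg v (y m)"
    and x: "reach v x" and seg_le: "\<forall>\<^sub>F m in sequentially. seg_le (weight s) x (y m) t" and t: "0 < t"
  shows "\<forall>\<^sub>F j in sequentially. seg_le (weight s) x (Q j) (2 * t)"
proof -
  have dQ: "d v (Q j) = j" for j using Q unfolding geodesic_ray_def by (metis diff_zero le0)
  have "spread (1 * (2 * b + 3)) Q" using spread_ray geodesic_ray_forward[OF Q(2)] by blast
  from spread_weight[OF this t, of s] eventually_gt_at_top[of "d v x + \<kappa>"]
  show ?thesis
  proof eventually_elim
    case (elim j)
    have "\<exists>\<^sub>F m in sequentially. Q j \<in> seg v (y m) \<and> seg_le (weight s) x (y m) t"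
      using frequently_eventually_conj[OF freq seg_le] by (simp add: conj_commute)
    then obtain m where m: "Q j \<in> seg v (y m)" "seg_le (weight s) x (y m) t"
      using frequently_ex by blast
    then have r: "reach x (y m)" unfolding seg_le_def by blast
    obtain B where B: "B \<subseteq> seg v x" "side B v x" using side_of_reach[OF x] by blast
    obtain q where q: "q \<in> seg x (y m) \<union> B" "reaches \<kappa> q (Q j)"
      using backward_close[OF m(1) r B(2)] by blast
    have "q \<notin> B"
    proof
      assume "q \<in> B"
      then have "reach v q" "d v q \<le> d v x" using B unfolding seg_def by auto
      then have "d v (Q j) \<le> d v x + \<kappa>" using d_triangle[of v q "Q j"] q(2) unfolding reaches_def by auto
      then show False using elim(2) unfolding dQ by simp
    qed
    then have qs: "q \<in> seg x (y m)" using q by blast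
    then have xq: "seg_le (weight s) x q t"
      using m(2) seg_left[OF qs] unfolding seg_le_def seg_def by blast
    have le: "t \<le> K * t" using K_ge_1 t mult_right_mono[of 1 K t] by simp
    have "weight s q \<le> t" using m(2) qs unfolding seg_le_def by blast
    then have "seg_le (weight s) q (Q j) (K * t)"
      using seg_le_short[OF q(2), of s t] elim(1) out_le_weight[of s "Q j"] in_le_weight[of s q] by linarith
    then have "seg_le (weight s) x (Q j) (K * (K * t))"
      using seg_le_combine[OF gromov_weight] seg_le_mono[OF xq le] by blast
    moreover have "K * (K * t) \<le> 2 * t" using K_sq t mult_right_mono[of "K * K" 2 t] by (simp add: mult.assoc)
    ultimately show ?case using seg_le_mono by blast
  qed
qed

text \<open>The vertex \<open>y m\<close> is a member of \<open>R m\<close>, chosen so late that it is reached by cheap chains not only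
  from the first relevant member of each earlier \<open>R k\<close> but from all of them up to index \<open>m\<close>. In this way
  one ray \<open>Q\<close> serves all late members of \<open>R k\<close>, which is needed because \<open>L\<^sub>s(R k, Q)\<close> is about pairs in
  which the index on \<open>R k\<close> may be much larger than the index on \<open>Q\<close>. For such pairs
  \<open>seg_le_quadrangle\<close> is applied with an early member \<open>?a\<close> of \<open>R k\<close> and a late member of \<open>Q\<close>.\<close>
theorem ray_limit:
  assumes S: "finite S" "S \<noteq> {}" and tail: "\<And>k. out_tail (R k)" and t: "\<And>k. 0 < t k"
    and link: "\<And>k m s. k < m \<Longrightarrow> s \<in> S \<Longrightarrow> link s (R k) (R m) (t k)"
    and escape: "\<And>v n. v \<in> V \<Longrightarrow> \<forall>\<^sub>F m in sequentially. \<forall>\<^sub>F j in sequentially. \<not> reaches n v (R m j)"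
  shows "\<exists>Q. geodesic_ray Q \<and> (\<forall>k>0. \<forall>s\<in>S. limit_bound s (R k) Q (24 * t k))"
proof -
  have "\<forall>k. \<exists>I. \<forall>l\<ge>I. \<forall>m\<ge>l. \<forall>s\<in>S. chain (weight s) (R k l) (R k m) (t k)"
  proof
    fix k
    have "\<forall>\<^sub>F l in sequentially. \<forall>s\<in>S. \<forall>m\<ge>l. chain (weight s) (R k l) (R k m) (t k)"
      using tail[of k] t[of k] unfolding out_tail_def by (intro eventually_ball_finite[OF S(1)]) blast
    then show "\<exists>I. \<forall>l\<ge>I. \<forall>m\<ge>l. \<forall>s\<in>S. chain (weight s) (R k l) (R k m) (t k)"
      unfolding eventually_sequentially by blast
  qed
  then obtain I where I: "\<And>k l m s. I k \<le> l \<Longrightarrow> l \<le> m \<Longrightarrow> s \<in> S \<Longrightarrow> chain (weight s) (R k l) (R k m) (t k)"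
    by metis
  \<comment> \<open>Late members of \<open>R m\<close> are reached cheaply from each member of \<open>R k\<close> after \<open>I k\<close>: move along \<open>R k\<close>, cross over, move along \<open>R m\<close>.\<close>
  have cross: "\<forall>\<^sub>F j in sequentially. \<forall>s\<in>S. chain (weight s) (R k i) (R m j) (3 * t k)"
    if km: "k < m" and ki: "I k \<le> i" for k m i
  proof (rule eventually_ball_finite[OF S(1)], rule ballI)
    fix s assume s: "s \<in> S"
    obtain N where N: "\<And>l n. N \<le> l \<Longrightarrow> l \<le> n \<Longrightarrow> chain (weight s) (R m l) (R m n) (t k)"
      using tail[of m] t[of k] unfolding out_tail_def eventually_sequentially by blast
    obtain i' j where ij: "i' \<ge> max i N" "j \<ge> max i N" "chain (weight s) (R k i') (R m j) (t k)"
      using link[OF km s] unfolding link_def by blast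
    have a: "chain (weight s) (R k i) (R m j) (2 * t k)"
      using chain_trans[OF ij(3) I[OF ki _ s, of i']] ij(1) by simp
    have "chain (weight s) (R k i) (R m n) (3 * t k)" if "j \<le> n" for n
      using chain_trans[OF N[of j n] a] ij(2) that by simp
    then show "\<forall>\<^sub>F j in sequentially. chain (weight s) (R k i) (R m j) (3 * t k)"
      unfolding eventually_sequentially by blast
  qed
  obtain s0 where s0: "s0 \<in> S" using S by blast
  define v where "v = R 0 (I 0)"
  have v: "v \<in> V" using chain_in[OF I[of 0 "I 0" "I 0" s0]] s0 unfolding v_def by simp
  have "\<forall>k. \<exists>I'\<ge>I k. 0 < k \<longrightarrow> (\<forall>j\<ge>I'. reach v (R k j))"
  proof
    fix k
    show "\<exists>I'\<ge>I k. 0 < k \<longrightarrow> (\<forall>j\<ge>I'. reach v (R k j))"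
    proof (cases "0 < k")
      case True
      from cross[OF this order_refl] obtain N where "\<And>j. N \<le> j \<Longrightarrow> reach v (R k j)"
        using chain_reach s0 unfolding eventually_sequentially v_def by blast
      then show ?thesis by (intro exI[of _ "max N (I k)"]) auto
    qed auto
  qed
  then obtain J where J: "\<And>k. I k \<le> J k" "\<And>k j. 0 < k \<Longrightarrow> J k \<le> j \<Longrightarrow> reach v (R k j)" by metis
  \<comment> \<open>The third conjunct makes the sequence \<open>y\<close> escape: it holds for all small \<open>n\<close> for which \<open>R m\<close> itself leaves the ball.\<close>
  have "\<forall>m. \<exists>j. (\<forall>k\<in>{..<m}. \<forall>i\<in>{J k..m}. \<forall>s\<in>S. chain (weight s) (R k i) (R m j) (3 * t k)) \<and>
      (0 < m \<longrightarrow> reach v (R m j)) \<and>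
      (\<forall>n\<in>{..m}. (\<forall>\<^sub>F j in sequentially. \<not> reaches n v (R m j)) \<longrightarrow> \<not> reaches n v (R m j))" (is "\<forall>m. \<exists>j. ?P m j")
  proof
    fix m
    have "\<forall>\<^sub>F j in sequentially. \<forall>k\<in>{..<m}. \<forall>i\<in>{J k..m}. \<forall>s\<in>S. chain (weight s) (R k i) (R m j) (3 * t k)"
    proof (intro eventually_ball_finite ballI)
      fix k i s assume "k \<in> {..<m}" "i \<in> {J k..m}" "s \<in> S"
      then show "\<forall>\<^sub>F j in sequentially. chain (weight s) (R k i) (R m j) (3 * t k)"
        using cross[of k m i] J(1)[of k] by (auto elim: eventually_mono)
    qed (use S in auto)
    moreover have "\<forall>\<^sub>F j in sequentially. 0 < m \<longrightarrow> reach v (R m j)"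
      using J(2)[of m] unfolding eventually_sequentially by blast
    moreover have "\<forall>\<^sub>F j in sequentially. \<forall>n\<in>{..m}. (\<forall>\<^sub>F j in sequentially. \<not> reaches n v (R m j)) \<longrightarrow> \<not> reaches n v (R m j)"
      by (intro eventually_ball_finite) auto
    ultimately have "\<forall>\<^sub>F j in sequentially. ?P m j"
      by (intro eventually_conj)
    then show "\<exists>j. ?P m j" using eventually_happens trivial_limit_sequentially by blast
  qed
  then obtain h where h: "\<And>m k i s. k < m \<Longrightarrow> J k \<le> i \<Longrightarrow> i \<le> m \<Longrightarrow> s \<in> S \<Longrightarrow> chain (weight s) (R k i) (R m (h m)) (3 * t k)"
    "\<And>m. 0 < m \<Longrightarrow> reach v (R m (h m))"
    "\<And>m n. n \<le> m \<Longrightarrow> \<forall>\<^sub>F j in sequentially. \<not> reaches n v (R m j) \<Longrightarrow> \<not> reaches n v (R m (h m))"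
    by (metis atLeastAtMost_iff atMost_iff lessThan_iff)
  define y where "y = (\<lambda>m. R m (h m))"
  have ry: "\<forall>\<^sub>F m in sequentially. reach v (y m)"
    using eventually_gt_at_top[of "0::nat"] by eventually_elim (use h(2) in \<open>simp add: y_def\<close>)
  have fy: "\<forall>\<^sub>F m in sequentially. \<not> reaches n v (y m)" for n
    using escape[OF v, of n] eventually_ge_at_top[of n]
    by eventually_elim (use h(3) in \<open>simp add: y_def\<close>)
  obtain Q where Q: "Q 0 = v" "geodesic_ray Q" "\<And>k. \<exists>\<^sub>F m in sequentially. Q k \<in> seg v (y m)"
    using koenig_ray[OF v ry fy] by blast
  have near: "\<forall>\<^sub>F j in sequentially. seg_le (weight s) (R k i) (Q j) (12 * t k)"
    if k: "0 < k" and i: "J k \<le> i" and s: "s \<in> S" for k i s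
  proof -
    have r: "reach v (R k i)" using J(2) k i by blast
    have "\<forall>\<^sub>F m in sequentially. seg_le (weight s) (R k i) (y m) (6 * t k)"
      using fy[of "d v (R k i)"] eventually_gt_at_top[of "max k i"]
    proof eventually_elim
      case (elim m)
      then have "chain (weight s) (R k i) (y m) (3 * t k)" using h(1)[of k m i s] i s unfolding y_def by simp
      from chain_seg_le[OF gromov_weight this] show ?case
        using elim(1) reaches_d[OF r] by auto
    qed
    from approach_ray[OF Q r this] t[of k] show ?thesis by simp
  qed
  have "limit_bound s (R k) Q (24 * t k)" if k: "0 < k" and s: "s \<in> S" for k s
    unfolding limit_bound_def
  proof (intro conjI allI)
    fix N
    have "\<forall>\<^sub>F j in sequentially. seg_le (weight s) (R k (max N (J k))) (Q j) (12 * t k) \<and> N \<le> j"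
      using near[OF k _ s, of "max N (J k)"] eventually_ge_at_top by (intro eventually_conj) auto
    then obtain j where "seg_le (weight s) (R k (max N (J k))) (Q j) (12 * t k)" "N \<le> j"
      using eventually_happens trivial_limit_sequentially by blast
    then show "\<exists>i\<ge>N. \<exists>j\<ge>N. reach (R k i) (Q j)"
      unfolding seg_le_def by (meson max.cobounded1)
  next
    let ?a = "R k (J k)"
    have "out_tail Q" using forward_ray_tail geodesic_ray_forward Q(2) by blast
    then have "\<forall>\<^sub>F l in sequentially. \<forall>m\<ge>l. chain (weight s) (Q l) (Q m) (t k)"
      using t unfolding out_tail_def by blast
    with near[OF k order_refl s]
    have "\<forall>\<^sub>F j in sequentially. seg_le (weight s) ?a (Q j) (12 * t k) \<and> (\<forall>m\<ge>j. chain (weight s) (Q j) (Q m) (t k))"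
      by (rule eventually_conj)
    then obtain N where N: "\<And>j. N \<le> j \<Longrightarrow> seg_le (weight s) ?a (Q j) (12 * t k)"
      "\<And>j m. N \<le> j \<Longrightarrow> j \<le> m \<Longrightarrow> chain (weight s) (Q j) (Q m) (t k)"
      unfolding eventually_sequentially by blast
    have "seg_le (weight s) (R k i) (Q j) (24 * t k)"
      if i: "max N (J k) \<le> i" and j: "max N (J k) \<le> j" and r: "reach (R k i) (Q j)" for i j
    proof -
      have tk: "0 < t k" by (rule t)
      have ac: "seg_le (weight s) ?a (Q j) (12 * t k)" using N j by simp
      have "\<forall>\<^sub>F j' in sequentially. seg_le (weight s) (R k i) (Q j') (12 * t k) \<and> j \<le> j'"
        using near[OF k _ s, of i] i eventually_ge_at_top by (intro eventually_conj) auto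
      then obtain j' where j': "seg_le (weight s) (R k i) (Q j') (12 * t k)" "j \<le> j'"
        using eventually_happens trivial_limit_sequentially by blast
      have cc: "Q j = Q j' \<or> seg_le (weight s) (Q j) (Q j') (12 * t k)"
        using chain_seg_le[OF gromov_weight N(2)[of j j']] j j'(2) seg_le_mono[of _ _ _ "2 * t k" "12 * t k"] tk by auto
      have ab: "?a = R k i \<or> seg_le (weight s) ?a (R k i) (12 * t k)"
        using chain_seg_le[OF gromov_weight I[of k "J k" i s]] J(1)[of k] i s seg_le_mono[of _ _ _ "2 * t k" "12 * t k"] tk by auto
      have "seg_le (weight s) (R k i) (Q j) (12 * t k) \<or> seg_le (weight s) (R k i) (Q j) (K * (12 * t k))"
        using ab cc seg_le_quadrangle[OF _ ac j'(1) _ r] ac j'(1) by auto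
      moreover have "K * (12 * t k) \<le> 24 * t k" using K_le_2 tk mult_right_mono[of K 2 "12 * t k"] by simp
      moreover have "12 * t k \<le> 24 * t k" using tk by simp
      ultimately show ?thesis using seg_le_mono by blast
    qed
    then show "\<exists>N. \<forall>i\<ge>N. \<forall>j\<ge>N. reach (R k i) (Q j) \<longrightarrow> seg_le (weight s) (R k i) (Q j) (24 * t k)"
      by blast
  qed
  then show ?thesis using Q(2) by blast
qed

text \<open>The ray \<open>R\<close> is a limit of geodesics from \<open>v\<close> to \<open>Q\<close>. As everything is reached from \<open>v\<close>, by
  \<open>far_from_root\<close> it suffices to bound out-weights for the base \<open>v\<close>. For a geodesic from \<open>R i\<close> to \<open>Q j\<close> take
  a later \<open>Q j'\<close> such that \<open>R i\<close> is on a geodesic from \<open>v\<close> to \<open>Q j'\<close>; then \<open>forward_close\<close> compares it with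
  the remaining part of that geodesic and with the tail of \<open>Q\<close> between \<open>Q j'\<close> and \<open>Q j\<close>.\<close>
theorem ray_below_backward_ray:
  assumes v: "v \<in> V" and Q: "backward_ray C Q" and vQ: "\<And>j. reach v (Q j)"
  shows "\<exists>R. geodesic_ray R \<and> (\<forall>s\<in>V. \<forall>t>0. limit_bound s R Q t)"
proof -
  have sp: "spread (C * (2 * b + 3)) Q" using spread_ray Q by blast
  have far: "\<forall>\<^sub>F m in sequentially. \<not> reaches n v (Q m)" for n
    using spread_escapes[OF sp, of v n] by eventually_elim (simp add: near_def)
  have "\<forall>\<^sub>F m in sequentially. reach v (Q m)" using vQ by simp
  from koenig_ray[OF v this far] obtain R where
    R: "R 0 = v" "geodesic_ray R" "\<And>k. \<exists>\<^sub>F m in sequentially. R k \<in> seg v (Q m)" by blast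
  have dR: "d v (R j) = j" for j using R unfolding geodesic_ray_def by (metis diff_zero le0)
  have late: "\<exists>m\<ge>N. R k \<in> seg v (Q m)" for N k
    using R(3)[of k] unfolding frequently_sequentially by blast
  have "limit_bound s R Q t" if s: "s \<in> V" and t: "0 < t" for s t
    unfolding limit_bound_def
  proof (intro conjI allI)
    fix N
    show "\<exists>i\<ge>N. \<exists>j\<ge>N. reach (R i) (Q j)"
      using late[of N N] unfolding seg_def by blast
  next
    obtain n where n: "\<And>p. reach v p \<Longrightarrow> \<not> reaches n v p \<Longrightarrow> weight s p \<le> t"
      using far_from_root[OF v s t] by blast
    define u where "u = exp (- \<epsilon> * real n) / 4"
    have u: "0 < u" unfolding u_def by simp
    have "in_tail Q" using backward_ray_tail Q by blast
    then obtain N1 where N1: "\<And>l m. N1 \<le> l \<Longrightarrow> l \<le> m \<Longrightarrow> chain (weight v) (Q m) (Q l) (u / 2)"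
      using u unfolding in_tail_def eventually_sequentially by (metis half_gt_zero)
    obtain N2 where N2: "exp (- \<epsilon> * real N2) < u" using small_exp[OF u] by blast
    have "seg_le (weight s) (R i) (Q j) t"
      if i: "max N1 N2 \<le> i" and j: "max N1 N2 \<le> j" and r: "reach (R i) (Q j)" for i j
      unfolding seg_le_def
    proof (intro conjI r ballI)
      fix p assume p: "p \<in> seg (R i) (Q j)"
      obtain j' where j': "j \<le> j'" "R i \<in> seg v (Q j')" using late by blast
      have rj: "reach (R i) (Q j')" "reach (Q j') (Q j)" "reach v (R i)"
        using j' Q unfolding seg_def backward_ray_def by auto
      obtain B where B: "B \<subseteq> seg (Q j') (Q j)" "side B (Q j) (Q j')" using side_of_reach[OF rj(2)] by blast
      obtain q where q: "q \<in> seg (R i) (Q j') \<union> B" "reaches \<kappa> p q"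
        using forward_close[OF p rj(1) B(2)] by blast
      have first: "out_weight v q \<le> u" if "q \<in> seg (R i) (Q j')"
      proof -
        have a: "reach (R i) q" "reach q (Q j')" "d (R i) q + d q (Q j') = d (R i) (Q j')" using that unfolding seg_def by auto
        have "d v (R i) + d (R i) (Q j') = d v (Q j')" using j' unfolding seg_def by auto
        moreover have "d v (Q j') \<le> d v q + d q (Q j')" using d_triangle a reach_trans rj(3) by blast
        ultimately have "N2 \<le> d v q" using a i dR[of i] by simp
        then have "out_weight v q \<le> exp (- \<epsilon> * real N2)" using eps_pos unfolding out_weight_def by auto
        then show ?thesis using N2 by simp
      qed
      have "out_weight v q \<le> u"
      proof (cases "q \<in> seg (R i) (Q j')")
        case False
        then have qB: "q \<in> seg (Q j') (Q j)" using q B by blast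
        have "chain (weight v) (Q j') (Q j) (u / 2)" using N1 j j' by simp
        from chain_seg_le[OF gromov_weight this] show ?thesis
        proof
          assume e: "Q j' = Q j"
          then have "q = Q j'" using qB seg_trivial by simp
          then show ?thesis using False seg_ends(2)[OF rj(1)] by simp
        next
          assume "seg_le (weight v) (Q j') (Q j) (2 * (u / 2))"
          then have "weight v q \<le> u" using qB unfolding seg_le_def by auto
          then show ?thesis using out_le_weight[of v q] by linarith
        qed
      qed (rule first)
      then have "out_weight v p \<le> K * u"
        using out_weight_step[OF q(2), of v] by (meson exp_ge_zero mult_left_mono order_trans)
      also have "\<dots> \<le> 2 * u" using K_le_2 u by (intro mult_right_mono) auto
      also have "\<dots> < exp (- \<epsilon> * real n)" unfolding u_def by simp
      finally have "\<not> reaches n v p" using eps_pos unfolding reaches_def out_weight_def by auto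
      moreover have "reach v p" using rj(3) p reach_trans unfolding seg_def by blast
      ultimately show "weight s p \<le> t" using n by blast
    qed
    then show "\<exists>N. \<forall>i\<ge>N. \<forall>j\<ge>N. reach (R i) (Q j) \<longrightarrow> seg_le (weight s) (R i) (Q j) t" by blast
  qed
  then show ?thesis using R(2) by blast
qed

text \<open>Suppose that geodesics from \<open>X\<close> to \<open>Q\<close> pass infinitely often, arbitrarily far out, through vertices \<open>p\<close>
  with \<open>d\<^sup>\<leftrightarrow>(s, p) \<le> e\<close>. Since \<open>s\<close> does not reach late members of \<open>Q\<close>, there is a short path from \<open>p\<close> to \<open>s\<close>.
  By \<open>near_backward_ray\<close> and finiteness of out-balls there are only finitely many such \<open>p\<close>, so one of
  them reaches all members of \<open>Q\<close>.\<close>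
theorem backward_rays_far:
  assumes X: "backward_ray C X" and Q: "backward_ray C' Q"
    and un: "\<And>v. v \<in> V \<Longrightarrow> \<exists>j. \<not> reach v (Q j)" and s: "s \<in> V" and t: "0 < t"
  shows "\<exists>N. \<forall>i\<ge>N. \<forall>j\<ge>N. reach (X i) (Q j) \<longrightarrow> seg_le (weight s) (X i) (Q j) t"
proof (rule ccontr)
  assume "\<not> ?thesis"
  then have neg: "\<exists>i\<ge>N. \<exists>j\<ge>N. \<exists>p\<in>seg (X i) (Q j). t < weight s p" for N
    unfolding seg_le_def by (meson not_le)
  obtain e where e: "exp (- \<epsilon> * real e) < t" using small_exp t by blast
  have mono: "\<not> reach v (Q j)" if "\<not> reach v (Q i)" "i \<le> j" for v i j
    using that reach_trans Q unfolding backward_ray_def by blast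
  obtain j1 where j1: "\<not> reach s (Q j1)" using un s by blast
  have ps: "reaches e p s" if "p \<in> seg (X i) (Q j)" "j1 \<le> j" "t < weight s p" for i j p
  proof -
    have "near s e p" using weight_gt_near[of e s p] e that(3) by simp
    moreover have "\<not> reaches e s p"
      using that mono[OF j1 that(2)] reach_trans unfolding reaches_def seg_def by blast
    ultimately show ?thesis unfolding near_def by blast
  qed
  obtain i0 j0 p0 where i0: "j1 \<le> j0" "p0 \<in> seg (X i0) (Q j0)" "t < weight s p0" using neg by blast
  then have "reach (X i0) s" using ps[OF i0(2,1,3)] reach_trans unfolding seg_def reaches_def by blast
  from near_backward_ray[OF X this, of e] obtain F M where
    F: "finite F" "F \<subseteq> V" "\<And>i p. i0 \<le> i \<Longrightarrow> reach (X i) p \<Longrightarrow> reaches e p s \<Longrightarrow> \<exists>q\<in>F. reaches M q p" by blast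
  define G where "G = (\<Union>q\<in>F. {p. reaches M q p})"
  have "finite G" unfolding G_def using F finite_out_ball by blast
  have "\<forall>p\<in>G. \<exists>j. \<not> reach p (Q j)" using un reach_in unfolding G_def reaches_def by blast
  then obtain h where h: "\<And>p. p \<in> G \<Longrightarrow> \<not> reach p (Q (h p))" by metis
  define N where "N = Max (insert 0 (h ` G)) + i0 + j1"
  obtain i j p where p: "i \<ge> N" "j \<ge> N" "p \<in> seg (X i) (Q j)" "t < weight s p" using neg by blast
  have "reaches e p s" using ps[OF p(3) _ p(4)] p(2) unfolding N_def by simp
  then have "p \<in> G" using F(3)[of i p] p unfolding G_def N_def seg_def by auto
  then have "h p \<le> Max (insert 0 (h ` G))" using \<open>finite G\<close> by (intro Max_ge) auto
  then have "\<not> reach p (Q j)" using mono[OF h[OF \<open>p \<in> G\<close>]] p(2) unfolding N_def by simp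
  then show False using p(3) unfolding seg_def by blast
qed

end

section \<open>Digraphs as spaces of directed geodesics\<close>

definition walkable :: "('a,'b) pre_digraph \<Rightarrow> 'a \<Rightarrow> 'a \<Rightarrow> bool" where
  "walkable G x y \<longleftrightarrow> (\<exists>p. vwalk p G \<and> hd p = x \<and> last p = y)"

definition hops :: "('a,'b) pre_digraph \<Rightarrow> 'a \<Rightarrow> 'a \<Rightarrow> nat" where
  "hops G x y = (LEAST n. \<exists>p. vwalk p G \<and> hd p = x \<and> last p = y \<and> length p - 1 = n)"

lemma vwalk_nth:
  "vwalk p G \<longleftrightarrow> p \<noteq> [] \<and> set p \<subseteq> verts G \<and> (\<forall>i. Suc i < length p \<longrightarrow> (p ! i, p ! Suc i) \<in> arcs_ends G)"
proof -
  have "set (vwalk_arcs p) = {(p ! i, p ! Suc i) | i. Suc i < length p}"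
  proof (induction p rule: vwalk_arcs.induct)
    case (3 x y xs)
    have "{((x # y # xs) ! i, (x # y # xs) ! Suc i) | i. Suc i < length (x # y # xs)} =
      insert (x, y) {((y # xs) ! i, (y # xs) ! Suc i) | i. Suc i < length (y # xs)}" (is "?L = ?R")
    proof
      show "?L \<subseteq> ?R"
      proof
        fix e assume "e \<in> ?L"
        then obtain i where "e = ((x # y # xs) ! i, (x # y # xs) ! Suc i)" "Suc i < length (x # y # xs)" by blast
        then show "e \<in> ?R" by (cases i) auto
      qed
      show "?R \<subseteq> ?L"
      proof
        fix e assume "e \<in> ?R"
        then consider "e = (x, y)" | i where "e = ((y # xs) ! i, (y # xs) ! Suc i)" "Suc i < length (y # xs)" by blast
        then show "e \<in> ?L"
        proof cases
          case 1
          then show ?thesis by (auto intro!: exI[of _ 0])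
        next
          case 2
          then show ?thesis by (auto intro!: exI[of _ "Suc i"])
        qed
      qed
    qed
    then show ?case using 3 by simp
  qed auto
  then show ?thesis unfolding vwalk_def by auto
qed

lemma vwalk_take: "vwalk p G \<Longrightarrow> k < length p \<Longrightarrow> vwalk (take (Suc k) p) G"
  unfolding vwalk_nth by (auto dest: in_set_takeD)

lemma vwalk_drop: "vwalk p G \<Longrightarrow> k < length p \<Longrightarrow> vwalk (drop k p) G"
  unfolding vwalk_nth by (auto dest: in_set_dropD)

lemma vwalk_append_tl:
  assumes "vwalk p G" "vwalk q G" "last p = hd q"
  shows "vwalk (p @ tl q) G \<and> hd (p @ tl q) = hd p \<and> last (p @ tl q) = last q \<and>
    length (p @ tl q) - 1 = (length p - 1) + (length q - 1)"
proof (cases q)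
  case Nil
  then show ?thesis using assms by (simp add: vwalk_def)
next
  case (Cons a r)
  have p: "p \<noteq> []" using assms by (simp add: vwalk_def)
  then have [simp]: "length p > 0" by simp
  show ?thesis
  proof (cases "r = []")
    case True
    then show ?thesis using assms Cons by simp
  next
    case False
    have "vwalk_arcs (p @ r) = vwalk_arcs p @ (last p, hd r) # vwalk_arcs r"
      using vwalk_arcs_append[OF p False] .
    then have "vwalk (p @ r) G" using assms Cons False p unfolding vwalk_def by auto
    then show ?thesis using Cons False p by (cases p) auto
  qed
qed

lemma walkable_hops: "walkable G x y \<Longrightarrow> \<exists>p. vwalk p G \<and> hd p = x \<and> last p = y \<and> length p - 1 = hops G x y"
proof -
  assume "walkable G x y"
  then have "\<exists>n p. vwalk p G \<and> hd p = x \<and> last p = y \<and> length p - 1 = n"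
    unfolding walkable_def by blast
  then show ?thesis unfolding hops_def by (rule LeastI_ex)
qed

lemma hops_le: "vwalk p G \<Longrightarrow> hd p = x \<Longrightarrow> last p = y \<Longrightarrow> walkable G x y \<and> hops G x y \<le> length p - 1"
proof -
  assume p: "vwalk p G" "hd p = x" "last p = y"
  then have "walkable G x y" unfolding walkable_def by blast
  moreover have "hops G x y \<le> length p - 1" unfolding hops_def by (rule Least_le) (use p in blast)
  ultimately show ?thesis by blast
qed

lemma vwalk_split:
  assumes p: "vwalk p G" and k: "k < length p"
  shows "walkable G (hd p) (p ! k)" "hops G (hd p) (p ! k) \<le> k"
    "walkable G (p ! k) (last p)" "hops G (p ! k) (last p) \<le> length p - 1 - k"
proof -
  have "hd (take (Suc k) p) = hd p" by simp
  moreover have "last (take (Suc k) p) = p ! k" using k by (simp add: take_Suc_conv_app_nth)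
  moreover have "length (take (Suc k) p) - 1 = k" using k by simp
  ultimately show "walkable G (hd p) (p ! k)" "hops G (hd p) (p ! k) \<le> k"
    using hops_le[OF vwalk_take[OF p k]] by auto
  have "hd (drop k p) = p ! k" "last (drop k p) = last p" "length (drop k p) - 1 = length p - 1 - k"
    using k by (auto simp: hd_drop_conv_nth)
  then show "walkable G (p ! k) (last p)" "hops G (p ! k) (last p) \<le> length p - 1 - k"
    using hops_le[OF vwalk_drop[OF p k]] by auto
qed

lemma directed_space_digraph: "directed_space (verts G) (walkable G) (hops G)"
proof
  fix x y z :: 'a
  show "x \<in> verts G \<and> y \<in> verts G" if "walkable G x y"
    using that unfolding walkable_def vwalk_def by auto
  show "walkable G x x" if "x \<in> verts G"
    using that unfolding walkable_def vwalk_def by (intro exI[of _ "[x]"]) auto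
  show "walkable G x z" if xy: "walkable G x y" and yz: "walkable G y z"
    using that vwalk_append_tl unfolding walkable_def by metis
  show "hops G x z \<le> hops G x y + hops G y z" if xy: "walkable G x y" and yz: "walkable G y z"
    using walkable_hops[OF xy] walkable_hops[OF yz] vwalk_append_tl hops_le by metis
  show "hops G x y = 0 \<longleftrightarrow> x = y" if xy: "walkable G x y"
  proof
    obtain p where p: "vwalk p G" "hd p = x" "last p = y" "length p - 1 = hops G x y"
      using walkable_hops[OF xy] by blast
    then have "p \<noteq> []" by (simp add: vwalk_def)
    {
      assume "hops G x y = 0"
      then have "length p = 1" using p \<open>p \<noteq> []\<close> by (cases p) auto
      then show "x = y" using p by (auto simp: length_Suc_conv)
    }
    assume "x = y"
    moreover have "x \<in> verts G" using p \<open>p \<noteq> []\<close> unfolding vwalk_def by auto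
    ultimately show "hops G x y = 0" using hops_le[of "[x]" G x y] by (simp add: vwalk_def)
  qed
  show "\<exists>z. walkable G x z \<and> walkable G z y \<and> hops G x z = k \<and> hops G z y = hops G x y - k"
    if xy: "walkable G x y" and k: "k \<le> hops G x y" for k
  proof -
    obtain p where p: "vwalk p G" "hd p = x" "last p = y" "length p - 1 = hops G x y"
      using walkable_hops[OF xy] by blast
    then have "p \<noteq> []" by (simp add: vwalk_def)
    then have kp: "k < length p" using p k by (cases p) auto
    let ?z = "p ! k"
    have a: "walkable G x ?z" "hops G x ?z \<le> k"
      using vwalk_split(1,2)[OF p(1) kp] p(2) by auto
    have c: "walkable G ?z y" "hops G ?z y \<le> hops G x y - k"
      using vwalk_split(3,4)[OF p(1) kp] p(3,4) by auto
    obtain q1 where q1: "vwalk q1 G" "hd q1 = x" "last q1 = ?z" "length q1 - 1 = hops G x ?z"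
      using walkable_hops[OF a(1)] by blast
    obtain q2 where q2: "vwalk q2 G" "hd q2 = ?z" "last q2 = y" "length q2 - 1 = hops G ?z y"
      using walkable_hops[OF c(1)] by blast
    have "hops G x y \<le> hops G x ?z + hops G ?z y"
      using vwalk_append_tl[OF q1(1) q2(1)] hops_le[of "q1 @ tl q2" G x y] q1 q2 by simp
    then show ?thesis using a c k by (intro exI[of _ ?z]) auto
  qed
qed

lemma ddist_walkable: "walkable G x y \<Longrightarrow> ddist G x y = ereal (real (hops G x y))"
proof -
  assume r: "walkable G x y"
  obtain p where p: "vwalk p G" "hd p = x" "last p = y" "length p - 1 = hops G x y"
    using walkable_hops[OF r] by blast
  show ?thesis
    unfolding ddist_def
  proof (rule antisym)
    show "(INF p\<in>{p. vwalk p G \<and> hd p = x \<and> last p = y}. ereal (real (vwalk_length p))) \<le> ereal (real (hops G x y))"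
      by (rule INF_lower2[of p]) (use p in auto)
    show "ereal (real (hops G x y)) \<le> (INF p\<in>{p. vwalk p G \<and> hd p = x \<and> last p = y}. ereal (real (vwalk_length p)))"
      by (rule INF_greatest) (use hops_le in force)
  qed
qed

lemma ddist_unwalkable: "\<not> walkable G x y \<Longrightarrow> ddist G x y = \<infinity>"
proof -
  assume "\<not> walkable G x y"
  then have "{p. vwalk p G \<and> hd p = x \<and> last p = y} = {}" unfolding walkable_def by auto
  then show ?thesis unfolding ddist_def by (simp only: image_empty Inf_empty top_ereal_def)
qed

lemma ddist_le_iff: "ddist G x y \<le> ereal r \<longleftrightarrow> walkable G x y \<and> real (hops G x y) \<le> r"
  using ddist_walkable ddist_unwalkable by (cases "walkable G x y") force+

lemma geodesic_iff:
  "geodesic G p x y \<longleftrightarrow> vwalk p G \<and> hd p = x \<and> last p = y \<and> length p - 1 = hops G x y"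
proof -
  have "walkable G x y" if "vwalk p G" "hd p = x" "last p = y" using that unfolding walkable_def by blast
  then show ?thesis unfolding geodesic_def using ddist_walkable by force
qed

lemma arc_hops: "wf_digraph G \<Longrightarrow> (x, y) \<in> arcs_ends G \<Longrightarrow> directed_space.reaches (walkable G) (hops G) 1 x y"
proof -
  assume wf: "wf_digraph G" and e: "(x, y) \<in> arcs_ends G"
  then have "x \<in> verts G" "y \<in> verts G" using wf_digraph.adj_in_verts by fast+
  then have "vwalk [x, y] G" using e by (simp add: vwalk_def)
  then show ?thesis
    using hops_le[of "[x, y]" G x y] directed_space.reaches_def[OF directed_space_digraph, of G 1 x y] by simp
qed

lemma hops_arc: "walkable G x y \<Longrightarrow> hops G x y = 1 \<Longrightarrow> (x, y) \<in> arcs_ends G"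
proof -
  assume r: "walkable G x y" "hops G x y = 1"
  obtain p where p: "vwalk p G" "hd p = x" "last p = y" "length p - 1 = hops G x y"
    using walkable_hops[OF r(1)] by blast
  then have "length p = Suc (Suc 0)" using r by simp
  then obtain u w where "p = [u, w]" by (auto simp: length_Suc_conv)
  then show ?thesis using p by (simp add: vwalk_def)
qed

lemma geo_geodesic:
  assumes "directed_space.geo (walkable G) (hops G) g x y"
  shows "geodesic G (map g [0..<Suc (hops G x y)]) x y"
proof -
  interpret directed_space "verts G" "walkable G" "hops G" by (rule directed_space_digraph)
  have g: "g 0 = x" "g (hops G x y) = y"
    "\<And>i j. i \<le> j \<Longrightarrow> j \<le> hops G x y \<Longrightarrow> walkable G (g i) (g j) \<and> hops G (g i) (g j) = j - i"
    using assms unfolding geo_def by auto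
  have "vwalk (map g [0..<Suc (hops G x y)]) G"
    unfolding vwalk_nth
  proof (intro conjI allI impI)
    show "set (map g [0..<Suc (hops G x y)]) \<subseteq> verts G"
    proof
      fix z assume "z \<in> set (map g [0..<Suc (hops G x y)])"
      then obtain i where "i \<le> hops G x y" "z = g i"
        by (auto simp add: less_Suc_eq_le simp del: upt_Suc)
      then show "z \<in> verts G" using g(3)[of i i] reach_in by blast
    qed
    fix i assume "Suc i < length (map g [0..<Suc (hops G x y)])"
    then have i: "Suc i \<le> hops G x y" by simp
    have "(g i, g (Suc i)) \<in> arcs_ends G" using g(3)[OF _ i, of i] by (intro hops_arc) auto
    then show "(map g [0..<Suc (hops G x y)] ! i, map g [0..<Suc (hops G x y)] ! Suc i) \<in> arcs_ends G"
      using i by (simp del: upt_Suc)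
  qed simp
  then show ?thesis using g unfolding geodesic_iff by (simp add: hd_map del: upt_Suc) (simp add: last_map)
qed

lemma geodesic_seg:
  assumes "geodesic G p x y" shows "set p \<subseteq> directed_space.seg (walkable G) (hops G) x y"
proof
  interpret directed_space "verts G" "walkable G" "hops G" by (rule directed_space_digraph)
  have p: "vwalk p G" "hd p = x" "last p = y" "length p - 1 = hops G x y" using assms unfolding geodesic_iff by auto
  then have "p \<noteq> []" by (simp add: vwalk_def)
  fix z assume "z \<in> set p"
  then obtain k where k: "k < length p" "p ! k = z" by (auto simp: in_set_conv_nth)
  have a: "walkable G x z" "hops G x z \<le> k"
    using vwalk_split(1,2)[OF p(1) k(1)] p(2) k(2) by auto
  have c: "walkable G z y" "hops G z y \<le> hops G x y - k"
    using vwalk_split(3,4)[OF p(1) k(1)] p(3,4) k(2) by auto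
  have "k \<le> hops G x y" using k p by simp
  then show "z \<in> seg x y" unfolding seg_def using a c d_triangle[OF a(1) c(1)] by auto
qed

lemma seg_geodesic:
  assumes "z \<in> directed_space.seg (walkable G) (hops G) x y" shows "\<exists>p. geodesic G p x y \<and> z \<in> set p"
proof -
  interpret directed_space "verts G" "walkable G" "hops G" by (rule directed_space_digraph)
  obtain g i where "geo g x y" "i \<le> hops G x y" "g i = z" using geo_through[OF assms] by blast
  then show ?thesis using geo_geodesic[of G g x y]
    by (intro exI[of _ "map g [0..<Suc (hops G x y)]"]) (auto simp del: upt_Suc)
qed

lemma side_geodesic:
  assumes "directed_space.side (walkable G) (hops G) A x z"
  shows "\<exists>p. (geodesic G p x z \<or> geodesic G p z x) \<and> set p = A"
proof -
  interpret directed_space "verts G" "walkable G" "hops G" by (rule directed_space_digraph)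
  have "\<exists>p. geodesic G p u v \<and> set p = g ` {..hops G u v}" if "geo g u v" for g u v
    using geo_geodesic[OF that]
    by (intro exI[of _ "map g [0..<Suc (hops G u v)]"]) (auto simp: atLeast0LessThan lessThan_Suc_atMost simp del: upt_Suc)
  then show ?thesis using assms unfolding side_def by blast
qed

lemma hyperbolic_space_digraph:
  assumes \<delta>: "0 \<le> \<delta>" and hyp: "hyperbolic G \<delta>" and B1: "B1 G f" and B2: "B2 G f"
  shows "hyperbolic_space (verts G) (walkable G) (hops G) (nat \<lfloor>\<delta>\<rfloor>) (nat \<lfloor>f (\<delta> + 1)\<rfloor>)"
proof -
  interpret directed_space "verts G" "walkable G" "hops G" by (rule directed_space_digraph)
  have reaches: "reaches (nat \<lfloor>r\<rfloor>) x y" if "ddist G x y \<le> ereal r" for r x y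
    using that unfolding ddist_le_iff reaches_def by (simp add: le_nat_floor)
  have reaches': "ddist G x y \<le> ereal (\<delta> + 1)" if "reaches (nat \<lfloor>\<delta>\<rfloor>) x y" for x y
  proof -
    have "real (hops G x y) \<le> real (nat \<lfloor>\<delta>\<rfloor>)" using that unfolding reaches_def by simp
    also have "\<dots> \<le> \<delta>" using \<delta> by simp
    finally show ?thesis using that unfolding ddist_le_iff reaches_def by simp
  qed
  show ?thesis
  proof
    fix p x y z A B
    assume p: "p \<in> seg x y" and A: "side A x z" and B: "side B y z"
    obtain P where P: "geodesic G P x y" "p \<in> set P" using seg_geodesic[OF p] by blast
    obtain Q where Q: "geodesic G Q x z \<or> geodesic G Q z x" "set Q = A" using side_geodesic[OF A] by blast
    obtain R where R: "geodesic G R y z \<or> geodesic G R z y" "set R = B" using side_geodesic[OF B] by blast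
    have "geodesic_triangle G x y z P R Q" using P Q R unfolding geodesic_triangle_def by blast
    then have "thin_triangle G \<delta> P R Q" using hyp unfolding hyperbolic_def by blast
    moreover have "mset [P, Q, R] = mset [P, R, Q]" by simp
    moreover have "hd P \<in> {hd Q, last Q}" "last P \<in> {hd R, last R}"
      using P Q R unfolding geodesic_def by auto
    ultimately have "set P \<subseteq> (\<Union>q\<in>set Q. out_ball G \<delta> q) \<union> (\<Union>q\<in>set R. in_ball G \<delta> q)"
      unfolding thin_triangle_def by blast
    then have "p \<in> (\<Union>q\<in>A. out_ball G \<delta> q) \<union> (\<Union>q\<in>B. in_ball G \<delta> q)" using P Q R by blast
    then show "(\<exists>q\<in>A. reaches (nat \<lfloor>\<delta>\<rfloor>) q p) \<or> (\<exists>q\<in>B. reaches (nat \<lfloor>\<delta>\<rfloor>) p q)"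
      using reaches unfolding out_ball_def in_ball_def by blast
  next
    fix x y z
    assume a: "reaches (nat \<lfloor>\<delta>\<rfloor>) x y" "reaches (nat \<lfloor>\<delta>\<rfloor>) x z" and r: "walkable G y z"
    have "y \<in> out_ball G (\<delta> + 1) x" "z \<in> out_ball G (\<delta> + 1) x" "x \<in> verts G"
      using a reaches' reach_in unfolding out_ball_def reaches_def by auto
    then have "ddist G y z = \<infinity> \<or> ddist G y z \<le> ereal (f (\<delta> + 1))"
      using B1 \<delta> unfolding B1_def by (metis add_nonneg_nonneg zero_le_one)
    then show "hops G y z \<le> nat \<lfloor>f (\<delta> + 1)\<rfloor>"
      using r ddist_walkable[OF r] by (auto intro: le_nat_floor)
  next
    fix x y z
    assume a: "reaches (nat \<lfloor>\<delta>\<rfloor>) y x" "reaches (nat \<lfloor>\<delta>\<rfloor>) z x" and r: "walkable G y z"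
    have "y \<in> in_ball G (\<delta> + 1) x" "z \<in> in_ball G (\<delta> + 1) x" "x \<in> verts G"
      using a reaches' reach_in unfolding in_ball_def reaches_def by auto
    then have "ddist G y z = \<infinity> \<or> ddist G y z \<le> ereal (f (\<delta> + 1))"
      using B2 \<delta> unfolding B2_def by (metis add_nonneg_nonneg zero_le_one)
    then show "hops G y z \<le> nat \<lfloor>f (\<delta> + 1)\<rfloor>"
      using r ddist_walkable[OF r] by (auto intro: le_nat_floor)
  qed
qed


section \<open>The visual semimetric and links\<close>

text \<open>There are no sequences in an empty digraph. In a nonempty one the base is nonempty and \<open>f(\<delta> + 1) \<ge> 0\<close>.\<close>
locale visual_digraph =
  fixes D :: "('a,'b) pre_digraph" and \<delta> \<epsilon> :: real and f :: "real \<Rightarrow> real" and S :: "'a set"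
  assumes wf: "wf_digraph D"
    and delta: "\<delta> \<ge> 0"
    and hyp: "hyperbolic D \<delta>"
    and B1: "B1 D f" and B2: "B2 D f"
    and finite_S: "finite S" and base: "is_base D S"
    and eps: "\<epsilon> > 0"
    and small: "exp (2 * \<epsilon> * (6 * \<delta> + 2 * \<delta> * f (\<delta> + 1))) < sqrt 2"
    and nonempty: "verts D \<noteq> {}"
begin

sublocale hyperbolic_space "verts D" "walkable D" "hops D" "nat \<lfloor>\<delta>\<rfloor>" "nat \<lfloor>f (\<delta> + 1)\<rfloor>"
  using hyperbolic_space_digraph delta hyp B1 B2 by blast

lemma f_nonneg: "0 \<le> f (\<delta> + 1)"
proof -
  obtain x where x: "x \<in> verts D" using nonempty by blast
  then have d: "ddist D x x = 0" using ddist_walkable[OF reach_refl[OF x]] d_self[OF x] by simp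
  then have "x \<in> out_ball D (\<delta> + 1) x" using x delta unfolding out_ball_def by simp
  then have "ddist D x x = \<infinity> \<or> ddist D x x \<le> ereal (f (\<delta> + 1))"
    using B1 x delta unfolding B1_def by (metis add_nonneg_nonneg zero_le_one)
  then show ?thesis using d by simp
qed

text \<open>If \<open>\<delta> \<ge> 1\<close>, then \<open>\<kappa>\<close> is at most \<open>4 \<delta> + f(\<delta> + 1)\<close>, and \<open>f(\<delta> + 1) \<le> 2 \<delta> f(\<delta> + 1)\<close>.\<close>
lemma kappa_le: "real \<kappa> \<le> 6 * \<delta> + 2 * \<delta> * f (\<delta> + 1)"
proof (cases "nat \<lfloor>\<delta>\<rfloor> = 0")
  case True
  then show ?thesis using delta f_nonneg unfolding \<kappa>_def by simp
next
  case False
  then have d1: "1 \<le> \<delta>" by linarith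
  have "real (nat \<lfloor>\<delta>\<rfloor>) \<le> \<delta>" "real (nat \<lfloor>f (\<delta> + 1)\<rfloor>) \<le> f (\<delta> + 1)" using delta f_nonneg by auto
  moreover have "f (\<delta> + 1) \<le> 2 * \<delta> * f (\<delta> + 1)" using d1 f_nonneg mult_right_mono[of 1 "2 * \<delta>" "f (\<delta> + 1)"] by simp
  moreover have "real \<kappa> = 3 * real (nat \<lfloor>\<delta>\<rfloor>) + real (nat \<lfloor>f (\<delta> + 1)\<rfloor>) + 1"
    using False unfolding \<kappa>_def by (simp only: if_False of_nat_add of_nat_mult of_nat_numeral of_nat_1)
  ultimately show ?thesis using d1 by linarith
qed

sublocale visual_space "verts D" "walkable D" "hops D" "nat \<lfloor>\<delta>\<rfloor>" "nat \<lfloor>f (\<delta> + 1)\<rfloor>" \<epsilon>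
proof
  show "0 < \<epsilon>" by (rule eps)
  have "(exp (\<epsilon> * real \<kappa>))\<^sup>2 = exp (2 * \<epsilon> * real \<kappa>)" by (simp add: power2_eq_square flip: exp_add)
  also have "\<dots> \<le> exp (2 * \<epsilon> * (6 * \<delta> + 2 * \<delta> * f (\<delta> + 1)))"
    using kappa_le eps by (intro exp_le_cancel_iff[THEN iffD2] mult_left_mono) auto
  also have "\<dots> \<le> 2" using small sqrt2_less_2 by linarith
  finally show "(exp (\<epsilon> * real \<kappa>))\<^sup>2 \<le> 2" .
qed

lemma eexp_le_iff:
  assumes "0 < t" shows "eexp (- (ereal \<epsilon> * x)) \<le> ereal t \<longleftrightarrow> ereal (- ln t / \<epsilon>) \<le> x"
proof (cases x)
  case (real r)
  have "exp (- (\<epsilon> * r)) \<le> t \<longleftrightarrow> - (\<epsilon> * r) \<le> ln t" using assms by (metis exp_le_cancel_iff exp_ln)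
  also have "\<dots> \<longleftrightarrow> - ln t / \<epsilon> \<le> r" using eps_pos by (auto simp: field_simps)
  finally show ?thesis using real by (simp add: eexp_def)
qed (use eps_pos assms in \<open>auto simp: eexp_def\<close>)

lemma eexp_less_iff:
  assumes "0 < t" shows "eexp (- (ereal \<epsilon> * x)) < ereal t \<longleftrightarrow> ereal (- ln t / \<epsilon>) < x"
proof (cases x)
  case (real r)
  have "exp (- (\<epsilon> * r)) < t \<longleftrightarrow> - (\<epsilon> * r) < ln t" using assms by (metis exp_less_cancel_iff exp_ln)
  also have "\<dots> \<longleftrightarrow> - ln t / \<epsilon> < r" using eps_pos by (auto simp: field_simps)
  finally show ?thesis using real by (simp add: eexp_def)
qed (use eps_pos assms in \<open>auto simp: eexp_def\<close>)

lemma eexp_nonneg: "0 \<le> eexp x"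
  by (cases x) (auto simp: eexp_def)

lemma weight_le_iff:
  assumes "0 < t" shows "weight s p \<le> t \<longleftrightarrow> ereal (- ln t / \<epsilon>) \<le> sdist D s p"
proof -
  have "(if walkable D x y then exp (- \<epsilon> * real (hops D x y)) else 0) \<le> t \<longleftrightarrow> ereal (- ln t / \<epsilon>) \<le> ddist D x y" for x y
  proof (cases "walkable D x y")
    case True
    have "exp (- \<epsilon> * real (hops D x y)) \<le> t \<longleftrightarrow> - \<epsilon> * real (hops D x y) \<le> ln t"
      using assms by (metis exp_le_cancel_iff exp_ln)
    also have "\<dots> \<longleftrightarrow> - ln t / \<epsilon> \<le> real (hops D x y)" using eps_pos by (auto simp: field_simps)
    finally show ?thesis using True ddist_walkable[OF True] by simp
  qed (use assms in \<open>simp add: ddist_unwalkable\<close>)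
  then show ?thesis unfolding weight_def out_weight_def in_weight_def sdist_def by simp
qed

lemma tail_geodesics_nonempty:
  "tail_geodesics D R Q n \<noteq> {} \<longleftrightarrow> (\<exists>i\<ge>n. \<exists>j\<ge>n. walkable D (R i) (Q j))"
proof -
  have "(\<exists>P. geodesic D P x y) \<longleftrightarrow> walkable D x y" for x y
  proof
    show "walkable D x y" if "\<exists>P. geodesic D P x y" using that unfolding geodesic_def walkable_def by blast
    show "\<exists>P. geodesic D P x y" if "walkable D x y"
      using seg_geodesic[OF seg_ends(1)[OF that]] by blast
  qed
  then show ?thesis unfolding tail_geodesics_def by blast
qed

text \<open>A bound on the weights of all late pairs bounds the supremum of infima that defines \<open>L\<^sub>s\<close>. In the
  converse direction (\<open>visual_L_greater\<close>) the inequality has to be strict, since the supremum need not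
  be attained.\<close>
lemma visual_L_ge:
  assumes "limit_bound s R Q t" "0 < t" shows "ereal (- ln t / \<epsilon>) \<le> visual_L D s R Q"
proof -
  have "tail_geodesics D R Q n \<noteq> {}" for n
    using assms unfolding limit_bound_def tail_geodesics_nonempty by blast
  then have L: "visual_L D s R Q = (SUP n. INF P \<in> tail_geodesics D R Q n. sdist_path D s P)"
    unfolding visual_L_def by simp
  obtain N where N: "\<And>i j. i \<ge> N \<Longrightarrow> j \<ge> N \<Longrightarrow> walkable D (R i) (Q j) \<Longrightarrow> seg_le (weight s) (R i) (Q j) t"
    using assms unfolding limit_bound_def by blast
  have "ereal (- ln t / \<epsilon>) \<le> sdist_path D s P" if "P \<in> tail_geodesics D R Q N" for P
  proof -
    obtain i j where ij: "N \<le> i" "N \<le> j" "geodesic D P (R i) (Q j)"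
      using \<open>P \<in> _\<close> unfolding tail_geodesics_def by blast
    then have "walkable D (R i) (Q j)" unfolding geodesic_def walkable_def by blast
    then have "seg_le (weight s) (R i) (Q j) t" using N ij by blast
    then have "ereal (- ln t / \<epsilon>) \<le> sdist D s p" if "p \<in> set P" for p
      using geodesic_seg[OF ij(3)] that weight_le_iff[OF assms(2)] unfolding seg_le_def by blast
    moreover have "P \<noteq> []" using ij(3) unfolding geodesic_def vwalk_def by blast
    ultimately show ?thesis unfolding sdist_path_def by simp
  qed
  then have "ereal (- ln t / \<epsilon>) \<le> (INF P \<in> tail_geodesics D R Q N. sdist_path D s P)"
    by (rule INF_greatest)
  then show ?thesis unfolding L by (rule SUP_upper2[OF UNIV_I])
qed

lemma visual_L_greater:
  assumes "ereal (- ln t / \<epsilon>) < visual_L D s R Q" "0 < t" shows "limit_bound s R Q t"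
proof -
  have ne: "tail_geodesics D R Q n \<noteq> {}" for n
    using assms(1) unfolding visual_L_def by (auto split: if_splits)
  then have L: "visual_L D s R Q = (SUP n. INF P \<in> tail_geodesics D R Q n. sdist_path D s P)"
    unfolding visual_L_def by simp
  obtain N where N: "ereal (- ln t / \<epsilon>) < (INF P \<in> tail_geodesics D R Q N. sdist_path D s P)"
    using assms(1) unfolding L less_SUP_iff by blast
  have "weight s p \<le> t" if ij: "N \<le> i" "N \<le> j" and p: "p \<in> seg (R i) (Q j)" for i j p
  proof -
    obtain P where P: "geodesic D P (R i) (Q j)" "p \<in> set P" using seg_geodesic[OF p] by blast
    then have "P \<in> tail_geodesics D R Q N" using ij unfolding tail_geodesics_def by blast
    then have "ereal (- ln t / \<epsilon>) \<le> sdist_path D s P" using N by (meson INF_lower le_less_trans less_imp_le order_less_le_trans)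
    also have "\<dots> \<le> sdist D s p" unfolding sdist_path_def using P by simp
    finally show ?thesis using weight_le_iff[OF assms(2)] by blast
  qed
  then have "\<forall>i\<ge>N. \<forall>j\<ge>N. walkable D (R i) (Q j) \<longrightarrow> seg_le (weight s) (R i) (Q j) t"
    unfolding seg_le_def by blast
  then show ?thesis unfolding limit_bound_def using ne tail_geodesics_nonempty by blast
qed

lemma visual_rho_nonneg: "0 \<le> visual_rho D \<epsilon> s \<eta> \<mu>"
  unfolding visual_rho_def by (auto intro!: INF_greatest eexp_nonneg)

lemma visual_rho_le:
  assumes "R \<in> representatives \<eta>" "Q \<in> representatives \<mu>" "limit_bound s R Q t" "0 < t"
  shows "visual_rho D \<epsilon> s \<eta> \<mu> \<le> ereal t"
proof (cases "\<eta> = \<mu> \<and> \<eta> \<in> range Inl")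
  case False
  have "eexp (- (ereal \<epsilon> * visual_L D s R Q)) \<le> ereal t"
    using eexp_le_iff[OF assms(4)] visual_L_ge[OF assms(3,4)] by blast
  moreover have "visual_rho D \<epsilon> s \<eta> \<mu> \<le> eexp (- (ereal \<epsilon> * visual_L D s R Q))"
    unfolding visual_rho_def using assms(1,2) False
    by (auto intro!: INF_lower2[of "(R, Q)"])
  ultimately show ?thesis by simp
qed (use assms in \<open>auto simp: visual_rho_def\<close>)

lemma representatives_vertex: "Inl x \<in> with_boundary D \<Longrightarrow> x \<in> verts D"
  unfolding with_boundary_def by auto

lemma visual_rho_less_link:
  assumes "visual_rho D \<epsilon> s \<eta> \<mu> < ereal t" "\<eta> \<in> with_boundary D"
  shows "\<exists>R\<in>representatives \<eta>. \<exists>Q\<in>representatives \<mu>. link s R Q t"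
proof -
  have t: "0 < t" using assms(1) visual_rho_nonneg[of s \<eta> \<mu>] by (metis ereal_less(2) order_le_less_trans)
  show ?thesis
  proof (cases "\<eta> = \<mu> \<and> \<eta> \<in> range Inl")
    case True
    then obtain x where x: "\<eta> = Inl x" "\<mu> = Inl x" by auto
    then have "x \<in> verts D" using assms(2) representatives_vertex by blast
    then show ?thesis using x t link_constant[of x t s] by simp
  next
    case False
    have "(INF (R, Q) \<in> representatives \<eta> \<times> representatives \<mu>. eexp (- (ereal \<epsilon> * visual_L D s R Q))) < ereal t"
      using assms(1) unfolding visual_rho_def if_not_P[OF False] .
    then obtain R Q where RQ: "R \<in> representatives \<eta>" "Q \<in> representatives \<mu>"
      "eexp (- (ereal \<epsilon> * visual_L D s R Q)) < ereal t" unfolding INF_less_iff by auto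
    then have "limit_bound s R Q t" using eexp_less_iff[OF t] visual_L_greater[OF _ t] by blast
    then show ?thesis using RQ limit_bound_link t by fastforce
  qed
qed

lemma S_nonempty: "S \<noteq> {}"
  using base nonempty unfolding is_base_def by blast

lemma S_verts: "S \<subseteq> verts D"
  using base unfolding is_base_def by blast

lemma visual_rho_le_base: "s \<in> S \<Longrightarrow> visual_rho D \<epsilon> s \<eta> \<mu> \<le> visual_rho_base D \<epsilon> S \<eta> \<mu>"
  unfolding visual_rho_base_def using finite_S by (intro Max_ge) auto

lemma visual_rho_base_nonneg: "0 \<le> visual_rho_base D \<epsilon> S \<eta> \<mu>"
  using S_nonempty visual_rho_le_base visual_rho_nonneg order_trans by blast

lemma visual_dist_le:
  assumes "\<eta> \<in> with_boundary D" "\<mu> \<in> with_boundary D" "R \<in> representatives \<eta>" "Q \<in> representatives \<mu>"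
    "\<And>s. s \<in> S \<Longrightarrow> limit_bound s R Q t" "0 < t"
  shows "visual_dist D S \<epsilon> \<eta> \<mu> \<le> ereal t"
proof -
  let ?c = "\<lambda>i::nat. if i = 0 then \<eta> else \<mu>"
  have "visual_dist D S \<epsilon> \<eta> \<mu> \<le> (\<Sum>i<1. visual_rho_base D \<epsilon> S (?c i) (?c (Suc i)))"
    unfolding visual_dist_def
    by (intro Inf_lower CollectI exI[of _ "1::nat"] exI[of _ ?c]) (use assms in auto)
  also have "\<dots> = visual_rho_base D \<epsilon> S \<eta> \<mu>" by simp
  also have "\<dots> \<le> ereal t"
    unfolding visual_rho_base_def using finite_S S_nonempty visual_rho_le[OF assms(3,4) assms(5) assms(6)]
    by (intro Max.boundedI) auto
  finally show ?thesis .
qed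

lemma quasi_geodesic_length:
  assumes q: "quasi_geodesic D \<gamma> c P" and C: "\<gamma> \<le> real C" "c \<le> real C"
  shows "walkable D (hd P) (last P) \<and> length P - 1 \<le> C * (hops D (hd P) (last P) + 1)"
proof -
  have P: "vwalk P D" "P \<noteq> []" using q unfolding quasi_geodesic_def vwalk_def by auto
  have w: "walkable D (hd P) (last P)" using P(1) unfolding walkable_def by blast
  have "ereal (real (vwalk_length P)) \<le> ereal \<gamma> * ddist D (hd P) (last P) + ereal c"
    using q P(2) unfolding quasi_geodesic_def by blast
  then have "real (length P - 1) \<le> \<gamma> * real (hops D (hd P) (last P)) + c"
    using ddist_walkable[OF w] by simp
  also have "\<dots> \<le> real C * real (hops D (hd P) (last P)) + real C" using C by (intro add_mono mult_right_mono) auto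
  also have "\<dots> = real (C * (hops D (hd P) (last P) + 1))" by (simp add: algebra_simps)
  finally show ?thesis using w by (simp only: of_nat_le_iff)
qed

lemma qg_constant: "\<exists>C. \<gamma> \<le> real C \<and> c \<le> real C" for \<gamma> c :: real
  using real_arch_simple[of "max \<gamma> c"] by auto

lemma quasi_geodesic_forward:
  assumes "quasi_geodesic_ray D R" shows "\<exists>C. forward_ray C R"
proof -
  obtain \<gamma> c where g: "\<And>i j. i \<le> j \<Longrightarrow> quasi_geodesic D \<gamma> c (map R [i..<Suc j])"
    and r: "ray D R" using assms unfolding quasi_geodesic_ray_def by blast
  obtain C where C: "\<gamma> \<le> real C" "c \<le> real C" using qg_constant by blast
  have edge: "reaches 1 (R i) (R (Suc i))" for i using r arc_hops[OF wf] unfolding ray_def by blast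
  have "walkable D (R i) (R j) \<and> j - i \<le> C * (hops D (R i) (R j) + 1)" if ij: "i \<le> j" for i j
  proof -
    let ?P = "map R [i..<Suc j]"
    have "hd ?P = R i" "last ?P = R j" "length ?P - 1 = j - i"
      using ij by (auto simp: hd_map last_map hd_append)
    then show ?thesis using quasi_geodesic_length[OF g[OF ij] C] by (simp only:)
  qed
  then show ?thesis using edge unfolding forward_ray_def by blast
qed

lemma quasi_geodesic_backward:
  assumes "quasi_geodesic_anti_ray D R" shows "\<exists>C. backward_ray C R"
proof -
  obtain \<gamma> c where g: "\<And>i j. i \<le> j \<Longrightarrow> quasi_geodesic D \<gamma> c (rev (map R [i..<Suc j]))"
    and r: "anti_ray D R" using assms unfolding quasi_geodesic_anti_ray_def by blast
  obtain C where C: "\<gamma> \<le> real C" "c \<le> real C" using qg_constant by blast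
  have edge: "reaches 1 (R (Suc i)) (R i)" for i using r arc_hops[OF wf] unfolding anti_ray_def by blast
  have "walkable D (R j) (R i) \<and> j - i \<le> C * (hops D (R j) (R i) + 1)" if ij: "i \<le> j" for i j
  proof -
    let ?P = "rev (map R [i..<Suc j])"
    have "hd ?P = R j" "last ?P = R i" "length ?P - 1 = j - i"
      using ij by (auto simp: hd_map last_map hd_append last_rev)
    then show ?thesis using quasi_geodesic_length[OF g[OF ij] C] by (simp only:)
  qed
  then show ?thesis using edge unfolding backward_ray_def by blast
qed

lemma qg_rays_kinds: "R \<in> qg_rays D \<Longrightarrow> \<exists>C. forward_ray C R \<or> backward_ray C R"
  unfolding qg_rays_def using quasi_geodesic_forward quasi_geodesic_backward by blast

lemma qg_rays_spread: "R \<in> qg_rays D \<Longrightarrow> \<exists>C. spread C R"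
  using qg_rays_kinds spread_ray by blast

lemma qg_rays_tail: "R \<in> qg_rays D \<Longrightarrow> out_tail R \<or> in_tail R"
  using qg_rays_kinds forward_ray_tail backward_ray_tail by blast

lemma qg_rays_verts: "R \<in> qg_rays D \<Longrightarrow> R i \<in> verts D"
  unfolding qg_rays_def quasi_geodesic_ray_def quasi_geodesic_anti_ray_def ray_def anti_ray_def by blast

lemma ball_near: "p \<in> verts D \<Longrightarrow> p \<in> out_ball D (real n) x \<union> in_ball D (real n) x \<longleftrightarrow> near x n p"
  unfolding out_ball_def in_ball_def near_def reaches_def ddist_le_iff by auto

lemma ray_le_link:
  assumes R: "R1 \<in> qg_rays D" "R2 \<in> qg_rays D" and le: "ray_le D R1 R2" and t: "0 < t"
  shows "link s R1 R2 t"
proof -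
  obtain M :: real where M: "0 \<le> M" "\<And>r x. r \<ge> 0 \<Longrightarrow> x \<in> verts D \<Longrightarrow> \<exists>p. vwalk p D \<and> hd p \<in> range R1 \<and>
     last p \<in> range R2 \<and> real (vwalk_length p) \<le> M \<and> set p \<inter> (out_ball D r x \<union> in_ball D r x) = {}"
    using le unfolding ray_le_def by blast
  obtain C C' where C: "spread C R1" "spread C' R2" using qg_rays_spread R by blast
  have "near (R1 0) i (R1 i)" for i using ray_start_near qg_rays_kinds[OF R(1)] by blast
  moreover have "\<exists>i j. reaches (nat \<lfloor>M\<rfloor>) (R1 i) (R2 j) \<and> \<not> near (R1 0) n (R1 i)" for n
  proof -
    obtain p where p: "vwalk p D" "hd p \<in> range R1" "last p \<in> range R2" "real (vwalk_length p) \<le> M"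
      "set p \<inter> (out_ball D (real n) (R1 0) \<union> in_ball D (real n) (R1 0)) = {}"
      using M(2)[of "real n" "R1 0"] qg_rays_verts[OF R(1)] by auto
    then obtain i j where ij: "hd p = R1 i" "last p = R2 j" by auto
    have "hd p \<in> set p" using p(1) unfolding vwalk_def by simp
    then have "\<not> near (R1 0) n (R1 i)" using p(5) ball_near[of "R1 i" n "R1 0"] qg_rays_verts[OF R(1)] ij by auto
    moreover have "reaches (nat \<lfloor>M\<rfloor>) (R1 i) (R2 j)"
      using hops_le[OF p(1) ij] p(4) le_nat_floor[of "length p - 1" M] unfolding reaches_def by simp
    ultimately show ?thesis by blast
  qed
  ultimately show ?thesis using link_of_short_paths[OF C _ _ t] by blast
qed

lemma ray_le_refl:
  assumes R: "R \<in> qg_rays D" shows "ray_le D R R"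
proof -
  obtain C where C: "spread C R" using qg_rays_spread R by blast
  have "\<exists>p. vwalk p D \<and> hd p \<in> range R \<and> last p \<in> range R \<and> real (vwalk_length p) \<le> 0 \<and>
     set p \<inter> (out_ball D r x \<union> in_ball D r x) = {}" if "0 \<le> r" "x \<in> verts D" for r x
  proof -
    define n where "n = nat \<lceil>r\<rceil>"
    have n: "r \<le> real n" unfolding n_def by linarith
    obtain i where i: "\<not> near x n (R i)"
      using spread_escapes[OF C, of x n] eventually_happens trivial_limit_sequentially by blast
    have "R i \<notin> out_ball D (real n) x \<union> in_ball D (real n) x"
      using i ball_near[OF qg_rays_verts[OF R]] by blast
    moreover have "e \<le> ereal (real n)" if "e \<le> ereal r" for e
      using order_trans[OF that, of "ereal (real n)"] n by simp
    ultimately have "R i \<notin> out_ball D r x \<union> in_ball D r x"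
      unfolding out_ball_def in_ball_def by blast
    then show ?thesis using qg_rays_verts[OF R] by (intro exI[of _ "[R i]"]) (simp add: vwalk_def)
  qed
  then show ?thesis unfolding ray_le_def by blast
qed

lemma boundary_class:
  assumes "R \<in> qg_rays D"
  shows "Inr (ray_equiv D `` {R}) \<in> with_boundary D" "R \<in> representatives (Inr (ray_equiv D `` {R}))"
proof -
  show "Inr (ray_equiv D `` {R}) \<in> with_boundary D"
    using assms unfolding with_boundary_def qg_boundary_def quotient_def by auto
  show "R \<in> representatives (Inr (ray_equiv D `` {R}))"
    using assms ray_le_refl unfolding ray_equiv_def by auto
qed

lemma representative_cases:
  assumes "\<eta> \<in> with_boundary D" "R \<in> representatives \<eta>"
  obtains (vertex) x where "x \<in> verts D" "\<eta> = Inl x" "R = (\<lambda>_. x)" | (boundary) "R \<in> qg_rays D"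
proof (cases \<eta>)
  case (Inl x)
  then show ?thesis using assms representatives_vertex that(1) by auto
next
  case (Inr A)
  then have "A \<in> qg_boundary D" using assms unfolding with_boundary_def by auto
  then have "R \<in> qg_rays D" using assms Inr unfolding qg_boundary_def quotient_def ray_equiv_def by auto
  then show ?thesis by (rule that(2))
qed

lemma representatives_nonempty: "\<eta> \<in> with_boundary D \<Longrightarrow> \<exists>R. R \<in> representatives \<eta>"
proof (cases \<eta>)
  case (Inr A)
  assume "\<eta> \<in> with_boundary D"
  then have "A \<in> qg_boundary D" using Inr unfolding with_boundary_def by auto
  then obtain R where "R \<in> qg_rays D" "A = ray_equiv D `` {R}" unfolding qg_boundary_def quotient_def by auto
  then show ?thesis using boundary_class Inr by blast
qed auto

lemma representative_tail:
  "\<eta> \<in> with_boundary D \<Longrightarrow> R \<in> representatives \<eta> \<Longrightarrow> out_tail R \<or> in_tail R"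
  by (erule (1) representative_cases) (use constant_tail qg_rays_tail in auto)

text \<open>Two members of a class are compared through a member \<open>P\<close> to which the class consists of the
  equivalent rays.\<close>
lemma representatives_link:
  assumes \<eta>: "\<eta> \<in> with_boundary D" and R: "R \<in> representatives \<eta>" and Q: "Q \<in> representatives \<eta>" and t: "0 < t"
  shows "link s R Q t"
proof (cases \<eta>)
  case (Inl x)
  then show ?thesis using assms representatives_vertex link_constant by auto
next
  case (Inr A)
  then have "A \<in> qg_boundary D" using \<eta> unfolding with_boundary_def by auto
  then obtain P where "P \<in> qg_rays D" "A = ray_equiv D `` {P}" unfolding qg_boundary_def quotient_def by auto
  then have eq: "P \<in> qg_rays D" "R \<in> qg_rays D" "Q \<in> qg_rays D" "ray_le D R P" "ray_le D P Q"
    using R Q Inr unfolding ray_equiv_def by auto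
  have "link s R Q (t / 3 + t / 3 + t / 3)"
    using link_trans[OF ray_le_link[OF eq(2,1,4), of "t / 3" s] ray_le_link[OF eq(1,3,5), of "t / 3" s]
        qg_rays_tail[OF eq(1)], of "t / 3"] t by simp
  then show ?thesis by simp
qed

text \<open>The representatives that realise \<open>\<rho>\<^sub>s\<close> on two consecutive pairs of a chain may differ at the common
  point; they are linked at arbitrarily small cost by \<open>representatives_link\<close>. The base vertex \<open>s\<close> is fixed
  here, since these representatives may also depend on \<open>s\<close>.\<close>
lemma link_of_chain:
  assumes s: "s \<in> S"
  shows "(\<And>i. i \<le> n \<Longrightarrow> c i \<in> with_boundary D) \<Longrightarrow>
    (\<Sum>i<n. visual_rho_base D \<epsilon> S (c i) (c (Suc i))) < ereal t \<Longrightarrow>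
    R \<in> representatives (c 0) \<Longrightarrow> Q \<in> representatives (c n) \<Longrightarrow> link s R Q t"
proof (induction n arbitrary: t Q)
  case 0
  then show ?case using representatives_link by auto
next
  case (Suc n)
  define a where "a = (\<Sum>i<n. visual_rho_base D \<epsilon> S (c i) (c (Suc i)))"
  define r where "r = visual_rho_base D \<epsilon> S (c n) (c (Suc n))"
  have ar: "0 \<le> a" "0 \<le> r" "a + r < ereal t"
    using Suc.prems(2) visual_rho_base_nonneg unfolding a_def r_def by (auto intro: sum_nonneg)
  obtain a' where a': "a = ereal a'" using ar by (cases a; cases r) auto
  obtain r' where r': "r = ereal r'" using ar by (cases a; cases r) auto
  define e where "e = (t - a' - r') / 4"
  have "4 * e = t - a' - r'" unfolding e_def by simp
  moreover have "a' + r' < t" using ar unfolding a' r' by simp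
  ultimately have e: "0 < e" "a' + r' + 4 * e = t" by auto
  have cn: "c n \<in> with_boundary D" "c (Suc n) \<in> with_boundary D" using Suc.prems(1) by auto
  have "visual_rho D \<epsilon> s (c n) (c (Suc n)) < ereal (r' + e)"
    using visual_rho_le_base[OF s, of "c n" "c (Suc n)"] e unfolding r_def[symmetric] r'
    by (metis ereal_less_eq(3) less_add_same_cancel1 less_ereal.simps(1) order_le_less_trans)
  then obtain A B where AB: "A \<in> representatives (c n)" "B \<in> representatives (c (Suc n))" "link s A B (r' + e)"
    using visual_rho_less_link cn by blast
  have "a < ereal (a' + e)" using a' e by simp
  then have "link s R A (a' + e)" using Suc.IH[of "a' + e" A] Suc.prems AB unfolding a_def by auto
  from link_trans[OF this AB(3) representative_tail[OF cn(1) AB(1)], of "e / 2"] e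
  have "link s R B (a' + e + (r' + e) + e / 2)" by simp
  from link_trans[OF this representatives_link[OF cn(2) AB(2) Suc.prems(4), of "e / 2" s]
      representative_tail[OF cn(2) AB(2)], of e] e
  have "link s R Q (a' + e + (r' + e) + e / 2 + e / 2 + e)" by simp
  then show ?case by (rule link_mono) (use e in simp)
qed

lemma visual_dist_less_link:
  assumes "visual_dist D S \<epsilon> \<eta> \<mu> < ereal t" "R \<in> representatives \<eta>" "Q \<in> representatives \<mu>" "s \<in> S"
  shows "link s R Q t"
proof -
  from assms(1) obtain n c where "c 0 = \<eta>" "c n = \<mu>" "\<forall>i\<le>n. c i \<in> with_boundary D"
    "(\<Sum>i<n. visual_rho_base D \<epsilon> S (c i) (c (Suc i))) < ereal t"
    unfolding visual_dist_def Inf_less_iff by blast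
  then show ?thesis using link_of_chain[OF assms(4), of n c t R Q] assms by blast
qed

lemma geodesic_ray_quasi_geodesic:
  assumes Q: "geodesic_ray Q" shows "quasi_geodesic_ray D Q"
proof -
  have g: "\<And>i j. i \<le> j \<Longrightarrow> walkable D (Q i) (Q j) \<and> hops D (Q i) (Q j) = j - i"
    using Q unfolding geodesic_ray_def by blast
  have V: "Q i \<in> verts D" for i using g[of i i] reach_in by blast
  have arc: "(Q i, Q (Suc i)) \<in> arcs_ends D" for i using g[of i "Suc i"] by (intro hops_arc) auto
  have "inj Q"
  proof (rule linorder_injI)
    fix i j :: nat assume "i < j"
    then show "Q i \<noteq> Q j" using g[of i j] d_self[OF V[of i]] by auto
  qed
  then have ray: "ray D Q" unfolding ray_def using V arc by auto
  have "quasi_geodesic D 1 0 (map Q [i..<Suc j])" if "i \<le> j" for i j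
    unfolding quasi_geodesic_def
  proof (intro conjI allI impI)
    show "vwalk (map Q [i..<Suc j]) D"
      unfolding vwalk_nth using V arc \<open>i \<le> j\<close> by (auto simp del: upt_Suc)
    fix p assume "sublist p (map Q [i..<Suc j])" and pne: "p \<noteq> []"
    then obtain ps ss where eq: "map Q [i..<Suc j] = ps @ p @ ss" unfolding sublist_def by blast
    have nth: "p ! k = Q (i + length ps + k)" if "k < length p" for k
    proof -
      have len: "length ps + k < Suc j - i" using arg_cong[OF eq, of length] that by (simp del: upt_Suc)
      have "p ! k = (ps @ p @ ss) ! (length ps + k)" using that by (simp add: nth_append)
      also have "\<dots> = map Q [i..<Suc j] ! (length ps + k)" using eq by simp
      also have "\<dots> = Q (i + length ps + k)" using len by (simp add: add.assoc del: upt_Suc)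
      finally show ?thesis .
    qed
    have "hd p = Q (i + length ps)" "last p = Q (i + length ps + (length p - 1))"
      using nth[of 0] nth[of "length p - 1"] pne by (auto simp: hd_conv_nth last_conv_nth)
    then have "ddist D (hd p) (last p) = ereal (real (length p - 1))"
      using g[of "i + length ps" "i + length ps + (length p - 1)"] ddist_walkable[of D "hd p" "last p"] by simp
    then show "ereal (real (vwalk_length p)) \<le> ereal 1 * ddist D (hd p) (last p) + ereal 0" by simp
  qed
  then show ?thesis unfolding quasi_geodesic_ray_def using ray by (meson order_refl)
qed

end

section \<open>Completeness\<close>

text \<open>For an f-Cauchy sequence, small distances from infinitely many members to \<open>l\<close> pass on to all late
  members by the triangle inequality, and then to every in-ball that contains \<open>l\<close>.\<close>
lemma b_limit_in:
  assumes sm: "semimetric_on Y \<rho>" and c: "f_Cauchy Y \<rho> \<sigma>" and l: "l \<in> Y"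
    and near: "\<And>e N. 0 < e \<Longrightarrow> \<exists>n\<ge>N. \<rho> (\<sigma> n) l < ereal e"
  shows "limitin (b_topology Y \<rho>) \<sigma> l sequentially"
proof -
  have \<sigma>: "\<sigma> n \<in> Y" for n using c unfolding f_Cauchy_def by blast
  have tri: "\<rho> x z \<le> \<rho> x y + \<rho> y z" if "x \<in> Y" "y \<in> Y" "z \<in> Y" for x y z
    using sm that unfolding semimetric_on_def by blast
  have nonneg: "0 \<le> \<rho> x y" if "x \<in> Y" "y \<in> Y" for x y using sm that unfolding semimetric_on_def by blast
  have ev: "\<forall>\<^sub>F n in sequentially. \<rho> (\<sigma> n) l < ereal e" if e: "0 < e" for e
  proof -
    obtain N where N: "\<And>n m. N \<le> n \<Longrightarrow> n \<le> m \<Longrightarrow> \<rho> (\<sigma> n) (\<sigma> m) < ereal (e / 2)"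
      using c e unfolding f_Cauchy_def by (meson half_gt_zero)
    have "\<rho> (\<sigma> n) l < ereal e" if n: "N \<le> n" for n
    proof -
      obtain m where m: "m \<ge> n" "\<rho> (\<sigma> m) l < ereal (e / 2)" using near[of "e / 2" n] e by auto
      have "\<rho> (\<sigma> n) l \<le> \<rho> (\<sigma> n) (\<sigma> m) + \<rho> (\<sigma> m) l" using tri \<sigma> l by blast
      also have "\<dots> < ereal (e / 2) + ereal (e / 2)" using N[OF n m(1)] m(2) by (rule ereal_add_strict_mono2)
      finally show ?thesis by simp
    qed
    then show ?thesis unfolding eventually_sequentially by blast
  qed
  let ?B = "{{y \<in> Y. \<rho> y x < ereal r} | x r. x \<in> Y \<and> r > 0}"
  have "l \<in> U \<longrightarrow> (\<forall>\<^sub>F n in sequentially. \<sigma> n \<in> U)" if "generate_topology_on ?B U" for U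
    using that
  proof induction
    case (Int a b)
    then show ?case by (auto intro: eventually_conj)
  next
    case (UN K)
    show ?case
    proof
      assume "l \<in> \<Union> K"
      then obtain U where U: "U \<in> K" "l \<in> U" by blast
      then have "\<forall>\<^sub>F n in sequentially. \<sigma> n \<in> U" using UN.IH by blast
      then show "\<forall>\<^sub>F n in sequentially. \<sigma> n \<in> \<Union> K" by eventually_elim (use U in blast)
    qed
  next
    case (Basis U)
    then obtain x r where U: "U = {y \<in> Y. \<rho> y x < ereal r}" "x \<in> Y" by blast
    show ?case
    proof
      assume "l \<in> U"
      then have lx: "\<rho> l x < ereal r" using U by blast
      obtain a where a: "\<rho> l x = ereal a" using lx nonneg[OF l U(2)] by (cases "\<rho> l x") auto
      then have "0 < r - a" using lx by simp
      from ev[OF this] show "\<forall>\<^sub>F n in sequentially. \<sigma> n \<in> U"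
      proof eventually_elim
        case (elim n)
        have "\<rho> (\<sigma> n) x \<le> \<rho> (\<sigma> n) l + \<rho> l x" using tri \<sigma> l U by blast
        also have "\<dots> < ereal (r - a) + ereal a" using elim a by (simp add: ereal_add_strict_mono2) (use nonneg[OF \<sigma> l] in \<open>cases "\<rho> (\<sigma> n) l"; auto\<close>)
        finally show ?case using U \<sigma> by simp
      qed
    qed
  qed auto
  moreover have "l \<in> topspace (b_topology Y \<rho>)"
  proof -
    have "\<rho> l l < ereal 1" using sm l unfolding semimetric_on_def by auto
    then have "l \<in> \<Union> ?B" using l by (auto intro!: exI[of _ "{y \<in> Y. \<rho> y l < ereal 1}"] exI[of _ l] exI[of _ "1::real"])
    then show ?thesis unfolding b_topology_def topology_generated_by_topspace .
  qed
  ultimately show ?thesis unfolding limitin_def b_topology_def openin_topology_generated_by_iff by blast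
qed

context visual_digraph
begin

text \<open>A class is called outward here if it contains a ray, and so is every vertex: these points have
  representatives with an \<open>out_tail\<close>, to which \<open>ray_limit\<close> applies.\<close>
theorem f_complete_digraph:
  assumes fin: "\<And>x. x \<in> verts D \<Longrightarrow> finite_out_degree D x"
    and sm: "semimetric_on (with_boundary D) (visual_dist D S \<epsilon>)"
  shows "f_complete (with_boundary D) (visual_dist D S \<epsilon>)"
  unfolding f_complete_def
proof (intro allI impI)
  interpret out_finite_visual_space "verts D" "walkable D" "hops D" "nat \<lfloor>\<delta>\<rfloor>" "nat \<lfloor>f (\<delta> + 1)\<rfloor>" \<epsilon>
  proof
    fix x assume x: "x \<in> verts D"
    have "{y. walkable D x y \<and> hops D x y = 1} \<subseteq> {y \<in> verts D. ddist D x y = 1}"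
      using ddist_walkable reach_in by (fastforce simp: one_ereal_def)
    then show "finite {y. walkable D x y \<and> hops D x y = 1}"
      using fin[OF x] finite_subset unfolding finite_out_degree_def by blast
  qed
  let ?Y = "with_boundary D"
  let ?\<rho> = "visual_dist D S \<epsilon>"
  fix \<sigma> assume c: "f_Cauchy ?Y ?\<rho> \<sigma>"
  have \<sigma>: "\<sigma> n \<in> ?Y" for n using c unfolding f_Cauchy_def by blast
  have zero: "\<eta> = \<mu>" if "\<eta> \<in> ?Y" "\<mu> \<in> ?Y" "\<And>t. 0 < t \<Longrightarrow> ?\<rho> \<eta> \<mu> \<le> ereal t" for \<eta> \<mu>
  proof -
    have "?\<rho> \<eta> \<mu> \<le> 0" by (rule ereal_le_epsilon2) (use that(3) in auto)
    then have "?\<rho> \<eta> \<mu> = 0" using sm that unfolding semimetric_on_def by (simp add: antisym)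
    then show ?thesis using sm that unfolding semimetric_on_def by blast
  qed
  have "\<exists>l\<in>?Y. \<forall>e>0. \<forall>N. \<exists>n\<ge>N. ?\<rho> (\<sigma> n) l < ereal e"
  proof (cases "\<exists>l. \<exists>\<^sub>F n in sequentially. \<sigma> n = l")
    case True
    then obtain l where l: "\<And>N. \<exists>n\<ge>N. \<sigma> n = l" unfolding frequently_sequentially by blast
    then have "l \<in> ?Y" using \<sigma> by blast
    moreover from this have "?\<rho> l l = 0" using sm unfolding semimetric_on_def by blast
    ultimately show ?thesis using l by (metis ereal_less(2))
  next
    case False
    then have avoid: "\<forall>\<^sub>F n in sequentially. \<sigma> n \<noteq> l" for l unfolding frequently_def by auto
    define outward where "outward = (\<lambda>\<eta>. \<exists>R\<in>representatives \<eta>. (\<exists>x\<in>verts D. \<eta> = Inl x \<and> R = (\<lambda>_. x)) \<or> (\<exists>C. forward_ray C R))"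
    have cls: "Inr (ray_equiv D `` {Q}) \<in> ?Y" "Q \<in> representatives (Inr (ray_equiv D `` {Q}))" if "geodesic_ray Q" for Q
      using boundary_class geodesic_ray_quasi_geodesic[OF that] unfolding qg_rays_def by blast+
    show ?thesis
    proof (cases "\<exists>\<^sub>F n in sequentially. outward (\<sigma> n)")
      case True
      have "\<exists>\<nu>. \<forall>k. (outward (\<sigma> (\<nu> k)) \<and> (\<forall>m\<ge>\<nu> k. ?\<rho> (\<sigma> (\<nu> k)) (\<sigma> m) < ereal ((1 / 2) ^ k))) \<and> \<nu> k < \<nu> (Suc k)"
      proof (rule dependent_nat_choice)
        have "\<exists>n\<ge>M. outward (\<sigma> n) \<and> (\<forall>m\<ge>n. ?\<rho> (\<sigma> n) (\<sigma> m) < ereal ((1 / 2) ^ k))" for k :: nat and M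
        proof -
          have "(0::real) < (1 / 2) ^ k" by simp
          then obtain N where N: "\<And>n m. N \<le> n \<Longrightarrow> n \<le> m \<Longrightarrow> ?\<rho> (\<sigma> n) (\<sigma> m) < ereal ((1 / 2) ^ k)"
            using c unfolding f_Cauchy_def by blast
          obtain n where "n \<ge> max M N" "outward (\<sigma> n)" using True unfolding frequently_sequentially by blast
          then show ?thesis using N by (intro exI[of _ n]) auto
        qed
        note ex = this
        show "\<exists>n. outward (\<sigma> n) \<and> (\<forall>m\<ge>n. ?\<rho> (\<sigma> n) (\<sigma> m) < ereal ((1 / 2) ^ 0))" using ex by blast
        show "\<exists>y. (outward (\<sigma> y) \<and> (\<forall>m\<ge>y. ?\<rho> (\<sigma> y) (\<sigma> m) < ereal ((1 / 2) ^ Suc n))) \<and> x < y" for x n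
          using ex[of "Suc x" "Suc n"] by (meson Suc_le_lessD)
      qed
      then obtain \<nu> where \<nu>: "\<And>k. outward (\<sigma> (\<nu> k))" "\<And>k m. \<nu> k \<le> m \<Longrightarrow> ?\<rho> (\<sigma> (\<nu> k)) (\<sigma> m) < ereal ((1 / 2) ^ k)"
        "strict_mono \<nu>" by (metis strict_mono_Suc_iff)
      obtain R where R: "\<And>k. R k \<in> representatives (\<sigma> (\<nu> k))"
        "\<And>k. (\<exists>x\<in>verts D. \<sigma> (\<nu> k) = Inl x \<and> R k = (\<lambda>_. x)) \<or> (\<exists>C. forward_ray C (R k))"
        using \<nu>(1) unfolding outward_def by metis
      have "out_tail (R k)" for k using R(2)[of k] constant_tail forward_ray_tail by auto
      moreover have "link s (R k) (R m) ((1 / 2) ^ k)" if "k < m" "s \<in> S" for k m s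
        using visual_dist_less_link[OF \<nu>(2) R(1) R(1) that(2)] \<nu>(3) that(1) by (simp add: strict_mono_less_eq)
      moreover have "\<forall>\<^sub>F m in sequentially. \<forall>\<^sub>F j in sequentially. \<not> reaches n v (R m j)" if v: "v \<in> verts D" for v n
      proof -
        have "\<forall>\<^sub>F i in sequentially. \<forall>x\<in>{p. reaches n v p}. \<sigma> i \<noteq> Inl x"
          using avoid by (intro eventually_ball_finite finite_out_ball v) blast
        then have "\<forall>\<^sub>F m in sequentially. \<forall>x\<in>{p. reaches n v p}. \<sigma> (\<nu> m) \<noteq> Inl x"
          using eventually_subseq[OF \<nu>(3)] by blast
        then show ?thesis
        proof eventually_elim
          case (elim m)
          from R(2)[of m] show ?case
          proof
            assume "\<exists>x\<in>verts D. \<sigma> (\<nu> m) = Inl x \<and> R m = (\<lambda>_. x)"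
            then show ?thesis using elim by auto
          next
            assume "\<exists>C. forward_ray C (R m)"
            then obtain C where "spread C (R m)" using spread_ray by blast
            from spread_escapes[OF this, of v n] show ?thesis
              by (rule eventually_mono) (auto simp: near_def)
          qed
        qed
      qed
      ultimately have "\<exists>Q. geodesic_ray Q \<and> (\<forall>k>0. \<forall>s\<in>S. limit_bound s (R k) Q (24 * (1 / 2) ^ k))"
        by (intro ray_limit[of S R "\<lambda>k. (1 / 2) ^ k"] finite_S S_nonempty) auto
      then obtain Q where Q: "geodesic_ray Q" "\<And>k s. 0 < k \<Longrightarrow> s \<in> S \<Longrightarrow> limit_bound s (R k) Q (24 * (1 / 2) ^ k)"
        by blast
      let ?l = "Inr (ray_equiv D `` {Q})"
      have close: "?\<rho> (\<sigma> (\<nu> k)) ?l \<le> ereal (24 * (1 / 2) ^ k)" if "0 < k" for k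
        by (rule visual_dist_le[OF \<sigma> cls(1)[OF Q(1)] R(1) cls(2)[OF Q(1)] Q(2)[OF that]]) auto
      have "\<exists>n\<ge>N. ?\<rho> (\<sigma> n) ?l < ereal e" if e: "0 < e" for e N
      proof -
        obtain k0 where k0: "(1 / 2) ^ k0 < e / 24" using real_arch_pow_inv[of "e / 24" "1 / 2"] e by auto
        define k where "k = Suc (k0 + N)"
        have "(1 / 2) ^ k \<le> (1 / 2 :: real) ^ k0" unfolding k_def by (intro power_decreasing) auto
        then have "24 * (1 / 2) ^ k < e" using k0 by linarith
        then have "?\<rho> (\<sigma> (\<nu> k)) ?l < ereal e" using close[of k] unfolding k_def
          by (metis less_ereal.simps(1) order_le_less_trans zero_less_Suc)
        moreover have "N \<le> \<nu> k" using seq_suble[OF \<nu>(3), of k] unfolding k_def by simp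
        ultimately show ?thesis by blast
      qed
      then show ?thesis using cls(1)[OF Q(1)] by blast
    next
      case False
      then have "\<forall>\<^sub>F n in sequentially. \<not> outward (\<sigma> n)" unfolding frequently_def by simp
      then obtain N0 where N0: "\<And>n. N0 \<le> n \<Longrightarrow> \<not> outward (\<sigma> n)" unfolding eventually_sequentially by blast
      obtain N1 where N1: "\<And>n m. N1 \<le> n \<Longrightarrow> n \<le> m \<Longrightarrow> ?\<rho> (\<sigma> n) (\<sigma> m) < ereal 1"
        using c unfolding f_Cauchy_def by (metis zero_less_one)
      have backward: "\<exists>C. backward_ray C X" if "N0 \<le> n" "X \<in> representatives (\<sigma> n)" for n X
        using \<sigma>[of n] that(2)
      proof (cases rule: representative_cases)
        case (vertex x)
        then show ?thesis using N0[OF that(1)] that(2) unfolding outward_def by blast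
      next
        case boundary
        then show ?thesis using qg_rays_kinds N0[OF that(1)] that(2) unfolding outward_def by blast
      qed
      define n where "n = max N0 N1"
      have "\<sigma> n = \<sigma> m" if nm: "n \<le> m" for m
      proof -
        obtain X where X: "X \<in> representatives (\<sigma> n)" using representatives_nonempty \<sigma> by blast
        obtain Q where Q: "Q \<in> representatives (\<sigma> m)" using representatives_nonempty \<sigma> by blast
        obtain C C' where C: "backward_ray C X" "backward_ray C' Q"
          using backward X Q nm unfolding n_def by (meson max.bounded_iff order_refl)
        \<comment> \<open>Otherwise a ray at distance 0 from \<open>\<sigma> m\<close> would belong to \<open>\<sigma> m\<close>.\<close>
        have un: "\<exists>j. \<not> walkable D v (Q j)" if v: "v \<in> verts D" for v
        proof (rule ccontr)
          assume "\<not> ?thesis"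
          then obtain R where R: "geodesic_ray R" "\<And>s t. s \<in> verts D \<Longrightarrow> 0 < t \<Longrightarrow> limit_bound s R Q t"
            using ray_below_backward_ray[OF v C(2)] by blast
          have "?\<rho> (Inr (ray_equiv D `` {R})) (\<sigma> m) \<le> ereal t" if "0 < t" for t
            by (rule visual_dist_le[OF cls(1)[OF R(1)] \<sigma> cls(2)[OF R(1)] Q R(2)]) (use S_verts that in auto)
          then have "Inr (ray_equiv D `` {R}) = \<sigma> m" using zero cls(1)[OF R(1)] \<sigma> by blast
          then have "R \<in> representatives (\<sigma> m)" using cls(2)[OF R(1)] by simp
          then have "outward (\<sigma> m)" using geodesic_ray_forward[OF R(1)] unfolding outward_def by blast
          then show False using N0[of m] nm unfolding n_def by simp
        qed
        have "?\<rho> (\<sigma> n) (\<sigma> m) \<le> ereal t" if t: "0 < t" for t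
        proof (rule visual_dist_le[OF \<sigma> \<sigma> X Q _ t])
          fix s assume s: "s \<in> S"
          have "link s X Q 1" using visual_dist_less_link[OF N1 X Q s] nm unfolding n_def by simp
          then have "\<forall>N. \<exists>i\<ge>N. \<exists>j\<ge>N. walkable D (X i) (Q j)" unfolding link_def using chain_reach by blast
          then show "limit_bound s X Q t"
            unfolding limit_bound_def using backward_rays_far[OF C un _ t] s S_verts by blast
        qed
        then show ?thesis using zero \<sigma> by blast
      qed
      moreover obtain m where "n \<le> m" "\<sigma> m \<noteq> \<sigma> n"
        using avoid[of "\<sigma> n"] unfolding eventually_sequentially by (meson nat_le_linear)
      ultimately show ?thesis by metis
    qed
  qed
  then show "\<exists>l\<in>?Y. limitin (b_topology ?Y ?\<rho>) \<sigma> l sequentially"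
    using b_limit_in[OF sm c] by metis
qed

end

lemma f_complete_hyperbolic_digraph:
  assumes "wf_digraph D" "\<delta> \<ge> 0" "hyperbolic D \<delta>" "B1 D f" "B2 D f" "finite S" "is_base D S" "\<epsilon> > 0"
    and "exp (2 * \<epsilon> * (6 * \<delta> + 2 * \<delta> * f (\<delta> + 1))) < sqrt 2"
    and "\<forall>x\<in>verts D. finite_out_degree D x"
    and "semimetric_on (with_boundary D) (visual_dist D S \<epsilon>)"
  shows "f_complete (with_boundary D) (visual_dist D S \<epsilon>)"
proof (cases "verts D = {}")
  case True
  then have "qg_rays D = {}"
    unfolding qg_rays_def quasi_geodesic_ray_def quasi_geodesic_anti_ray_def ray_def anti_ray_def by auto
  then have "with_boundary D = {}"
    using True unfolding with_boundary_def qg_boundary_def by simp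
  then show ?thesis unfolding f_complete_def f_Cauchy_def by auto
next
  case False
  interpret visual_digraph D \<delta> \<epsilon> f S
    by (rule visual_digraph.intro[OF assms(1-9) False])
  show ?thesis using f_complete_digraph assms(10,11) by blast
qed

section \<open>Reversing all edges\<close>

definition converse_digraph :: "('a,'b) pre_digraph \<Rightarrow> ('a,'b) pre_digraph" where
  "converse_digraph G = G\<lparr>tail := head G, head := tail G\<rparr>"

lemma converse_converse: "converse_digraph (converse_digraph G) = G"
  by (simp add: converse_digraph_def)

lemma verts_converse [simp]: "verts (converse_digraph G) = verts G"
  by (simp add: converse_digraph_def)

lemma arcs_ends_converse: "arcs_ends (converse_digraph G) = (arcs_ends G)\<inverse>"
  by (auto simp: converse_digraph_def arcs_ends_conv)

lemma wf_converse: "wf_digraph G \<Longrightarrow> wf_digraph (converse_digraph G)"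
  unfolding wf_digraph_def converse_digraph_def by simp

lemma vwalk_rev: "vwalk p G \<Longrightarrow> vwalk (rev p) (converse_digraph G)"
proof (induction p)
  case (Cons x p)
  show ?case
  proof (cases "p = []")
    case False
    then have "vwalk p G" "(x, hd p) \<in> arcs_ends G" "x \<in> verts G"
      using Cons.prems by (auto simp: vwalk_def)
    moreover from this have "vwalk (rev p) (converse_digraph G)" using Cons.IH by blast
    moreover have "vwalk_arcs (rev p @ [x]) = vwalk_arcs (rev p) @ [(hd p, x)]"
      using vwalk_arcs_append[of "rev p" "[x]"] False by (simp add: last_rev)
    ultimately show ?thesis unfolding vwalk_def by (simp add: arcs_ends_converse)
  qed (use Cons in \<open>simp add: vwalk_def\<close>)
qed (simp add: vwalk_def)

lemma vwalk_converse: "vwalk p (converse_digraph G) \<longleftrightarrow> vwalk (rev p) G"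
  using vwalk_rev[of p "converse_digraph G"] vwalk_rev[of "rev p" G] unfolding converse_converse by auto

lemma image_rev_eqI:
  assumes "\<And>p. p \<in> L \<longleftrightarrow> rev p \<in> A" shows "L = rev ` A"
proof (intro equalityI subsetI)
  fix p assume "p \<in> L"
  then show "p \<in> rev ` A" using assms[of p] by (intro image_eqI[of _ _ "rev p"]) simp_all
next
  fix p assume "p \<in> rev ` A"
  then obtain q where "p = rev q" "q \<in> A" by blast
  then show "p \<in> L" using assms[of p] by simp
qed

lemma walks_converse:
  "{p. vwalk p (converse_digraph G) \<and> hd p = x \<and> last p = y} = rev ` {p. vwalk p G \<and> hd p = y \<and> last p = x}"
  by (rule image_rev_eqI) (auto simp: vwalk_converse hd_rev last_rev)

lemma ddist_converse: "ddist (converse_digraph G) x y = ddist G y x"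
  unfolding ddist_def walks_converse by (simp add: image_comp comp_def)

lemma geodesic_converse: "geodesic (converse_digraph G) p x y \<longleftrightarrow> geodesic G (rev p) y x"
  unfolding geodesic_def ddist_converse vwalk_converse
  by (cases "p = []") (auto simp: hd_rev last_rev vwalk_def)

lemma out_ball_converse: "out_ball (converse_digraph G) r x = in_ball G r x"
  unfolding out_ball_def in_ball_def ddist_converse by simp

lemma in_ball_converse: "in_ball (converse_digraph G) r x = out_ball G r x"
  unfolding out_ball_def in_ball_def ddist_converse by simp

lemma B1_converse: "B2 G f \<Longrightarrow> B1 (converse_digraph G) f"
  unfolding B1_def B2_def out_ball_converse ddist_converse verts_converse by blast

lemma B2_converse: "B1 G f \<Longrightarrow> B2 (converse_digraph G) f"
  unfolding B1_def B2_def in_ball_converse ddist_converse verts_converse by blast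

lemma thin_triangle_converse:
  assumes "thin_triangle G \<delta> (rev A) (rev B) (rev C)"
  shows "thin_triangle (converse_digraph G) \<delta> A B C"
  unfolding thin_triangle_def out_ball_converse in_ball_converse
proof (intro allI impI)
  fix P Q R :: "'a list"
  assume m: "mset [P, Q, R] = mset [A, B, C]" and h: "hd P \<in> {hd Q, last Q}" "last P \<in> {hd R, last R}"
  have "mset [rev P, rev R, rev Q] = image_mset rev (mset [P, Q, R])" by simp
  also have "\<dots> = mset [rev A, rev B, rev C]" unfolding m by simp
  finally have "mset [rev P, rev R, rev Q] = mset [rev A, rev B, rev C]" .
  moreover have "hd (rev P) \<in> {hd (rev R), last (rev R)}" "last (rev P) \<in> {hd (rev Q), last (rev Q)}"
    using h by (auto simp: hd_rev last_rev)
  ultimately have "set (rev P) \<subseteq> (\<Union>q\<in>set (rev R). out_ball G \<delta> q) \<union> (\<Union>q\<in>set (rev Q). in_ball G \<delta> q)"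
    using assms unfolding thin_triangle_def by blast
  then show "set P \<subseteq> (\<Union>q\<in>set Q. in_ball G \<delta> q) \<union> (\<Union>q\<in>set R. out_ball G \<delta> q)" by auto
qed

lemma hyperbolic_converse:
  assumes "hyperbolic G \<delta>" shows "hyperbolic (converse_digraph G) \<delta>"
  unfolding hyperbolic_def
proof (intro allI impI)
  fix x y z A B C assume "geodesic_triangle (converse_digraph G) x y z A B C"
  then have "geodesic_triangle G x y z (rev A) (rev B) (rev C)"
    unfolding geodesic_triangle_def geodesic_converse by blast
  then show "thin_triangle (converse_digraph G) \<delta> A B C"
    using assms thin_triangle_converse unfolding hyperbolic_def by blast
qed

lemma sdist_converse: "sdist (converse_digraph G) = sdist G"
  unfolding sdist_def ddist_converse by (simp add: min.commute)

lemma is_base_converse: "is_base (converse_digraph G) S = is_base G S"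
  unfolding is_base_def sdist_converse by simp

lemma ray_converse: "ray (converse_digraph G) R = anti_ray G R"
  unfolding ray_def anti_ray_def arcs_ends_converse by simp

lemma quasi_geodesic_converse: "quasi_geodesic (converse_digraph G) \<gamma> c P = quasi_geodesic G \<gamma> c (rev P)"
proof -
  have "(\<forall>p. sublist p P \<longrightarrow> p \<noteq> [] \<longrightarrow> F (length p) (last p) (hd p)) \<longleftrightarrow>
    (\<forall>p. sublist p (rev P) \<longrightarrow> p \<noteq> [] \<longrightarrow> F (length p) (hd p) (last p))" (is "?L \<longleftrightarrow> ?R")
    for F :: "nat \<Rightarrow> 'a \<Rightarrow> 'a \<Rightarrow> bool"
  proof
    assume L: ?L
    show ?R
    proof (intro allI impI)
      fix p assume "sublist p (rev P)" "p \<noteq> []"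
      then show "F (length p) (hd p) (last p)"
        using L[rule_format, of "rev p"] by (simp add: sublist_rev_left hd_rev last_rev)
    qed
  next
    assume R: ?R
    show ?L
    proof (intro allI impI)
      fix p assume "sublist p P" "p \<noteq> []"
      then show "F (length p) (last p) (hd p)"
        using R[rule_format, of "rev p"] by (simp add: hd_rev last_rev)
    qed
  qed
  from this[of "\<lambda>n x y. ereal (real (n - 1)) \<le> ereal \<gamma> * ddist G x y + ereal c"]
  show ?thesis unfolding quasi_geodesic_def vwalk_converse ddist_converse by simp
qed

lemma quasi_geodesic_ray_converse: "quasi_geodesic_ray (converse_digraph G) R = quasi_geodesic_anti_ray G R"
  unfolding quasi_geodesic_ray_def quasi_geodesic_anti_ray_def ray_converse quasi_geodesic_converse by simp

lemma quasi_geodesic_anti_ray_converse: "quasi_geodesic_anti_ray (converse_digraph G) R = quasi_geodesic_ray G R"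
  using quasi_geodesic_ray_converse[of "converse_digraph G" R] by (simp add: converse_converse)

lemma qg_rays_converse: "qg_rays (converse_digraph G) = qg_rays G"
  unfolding qg_rays_def quasi_geodesic_ray_converse quasi_geodesic_anti_ray_converse by blast

lemma ray_le_converse: "ray_le (converse_digraph G) R1 R2 = ray_le G R2 R1"
proof -
  have "(\<exists>p. vwalk p (converse_digraph G) \<and> hd p \<in> range R1 \<and> last p \<in> range R2 \<and> real (vwalk_length p) \<le> M \<and> set p \<inter> B = {}) \<longleftrightarrow>
    (\<exists>p. vwalk p G \<and> hd p \<in> range R2 \<and> last p \<in> range R1 \<and> real (vwalk_length p) \<le> M \<and> set p \<inter> B = {})" (is "?L \<longleftrightarrow> ?R")
    for M B
  proof
    assume ?L
    then obtain p where "vwalk (rev p) G" "hd p \<in> range R1" "last p \<in> range R2" "real (vwalk_length p) \<le> M" "set p \<inter> B = {}"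
      unfolding vwalk_converse by blast
    then show ?R by (intro exI[of _ "rev p"]) (simp add: hd_rev last_rev)
  next
    assume ?R
    then obtain p where "vwalk p G" "hd p \<in> range R2" "last p \<in> range R1" "real (vwalk_length p) \<le> M" "set p \<inter> B = {}"
      by blast
    then show ?L unfolding vwalk_converse by (intro exI[of _ "rev p"]) (simp add: hd_rev last_rev)
  qed
  then show ?thesis unfolding ray_le_def out_ball_converse in_ball_converse verts_converse
    by (simp add: Un_commute)
qed

lemma ray_equiv_converse: "ray_equiv (converse_digraph G) = ray_equiv G"
  unfolding ray_equiv_def qg_rays_converse ray_le_converse by blast

lemma with_boundary_converse: "with_boundary (converse_digraph G) = with_boundary G"
  unfolding with_boundary_def qg_boundary_def qg_rays_converse ray_equiv_converse by simp

lemma tail_geodesics_converse: "tail_geodesics (converse_digraph G) R Q n = rev ` tail_geodesics G Q R n"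
  by (rule image_rev_eqI) (auto simp: tail_geodesics_def geodesic_converse)

lemma visual_L_converse: "visual_L (converse_digraph G) s R Q = visual_L G s Q R"
  unfolding visual_L_def tail_geodesics_converse
  by (simp add: image_comp comp_def sdist_path_def sdist_converse)

lemma visual_rho_converse: "visual_rho (converse_digraph G) \<epsilon> s \<eta> \<mu> = visual_rho G \<epsilon> s \<mu> \<eta>"
proof -
  have "(INF (R, Q) \<in> A \<times> B. h R Q) = (INF (R, Q) \<in> B \<times> A. h Q R)" for A B and h :: "_ \<Rightarrow> _ \<Rightarrow> ereal"
  proof -
    have "(\<lambda>(R, Q). h R Q) ` (A \<times> B) = (\<lambda>(R, Q). h Q R) ` (B \<times> A)" by auto
    then show ?thesis by simp
  qed
  then show ?thesis unfolding visual_rho_def visual_L_converse by auto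
qed

lemma visual_rho_base_converse:
  "visual_rho_base (converse_digraph G) \<epsilon> S \<eta> \<mu> = visual_rho_base G \<epsilon> S \<mu> \<eta>"
  unfolding visual_rho_base_def visual_rho_converse by simp

lemma visual_dist_converse: "visual_dist (converse_digraph G) S \<epsilon> \<eta> \<mu> = visual_dist G S \<epsilon> \<mu> \<eta>"
proof -
  let ?V = "\<lambda>G \<eta> \<mu>. {(\<Sum>i<n. visual_rho_base G \<epsilon> S (c i) (c (Suc i))) | (n::nat) c.
            c 0 = \<eta> \<and> c n = \<mu> \<and> (\<forall>i\<le>n. c i \<in> with_boundary G)}"
  have sub: "?V (converse_digraph G) \<eta> \<mu> \<subseteq> ?V G \<mu> \<eta>" for G :: "('a,'b) pre_digraph" and \<eta> \<mu>
  proof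
    fix t assume "t \<in> ?V (converse_digraph G) \<eta> \<mu>"
    then obtain n c where c: "c 0 = \<eta>" "c n = \<mu>" "\<forall>i\<le>n. c i \<in> with_boundary G"
      and t: "t = (\<Sum>i<n. visual_rho_base G \<epsilon> S (c (Suc i)) (c i))"
      unfolding with_boundary_converse visual_rho_base_converse by blast
    have "t = (\<Sum>i<n. visual_rho_base G \<epsilon> S (c (Suc (n - Suc i))) (c (n - Suc i)))"
      unfolding t by (rule sum.nat_diff_reindex[symmetric])
    also have "\<dots> = (\<Sum>i<n. visual_rho_base G \<epsilon> S (c (n - i)) (c (n - Suc i)))"
      by (rule sum.cong) (auto simp: Suc_diff_Suc)
    finally show "t \<in> ?V G \<mu> \<eta>"
      using c by (intro CollectI exI[of _ n] exI[of _ "\<lambda>i. c (n - i)"]) auto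
  qed
  have "?V (converse_digraph G) \<eta> \<mu> = ?V G \<mu> \<eta>"
    using sub[of G \<eta> \<mu>] sub[of "converse_digraph G" \<mu> \<eta>] unfolding converse_converse by (rule subset_antisym)
  then show ?thesis unfolding visual_dist_def by simp
qed

lemma finite_out_degree_converse: "finite_out_degree (converse_digraph G) x = finite_in_degree G x"
  unfolding finite_out_degree_def finite_in_degree_def ddist_converse by simp

lemma semimetric_on_transpose: assumes "semimetric_on Y \<rho>" shows "semimetric_on Y (\<lambda>x y. \<rho> y x)"
proof -
  have "\<rho> z x \<le> \<rho> y x + \<rho> z y" if "x \<in> Y" "y \<in> Y" "z \<in> Y" for x y z
    using assms that unfolding semimetric_on_def by (subst add.commute) blast
  then show ?thesis using assms unfolding semimetric_on_def by blast
qed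

lemma f_complete_transpose: "f_complete Y (\<lambda>x y. \<rho> y x) \<longleftrightarrow> b_complete Y \<rho>"
  unfolding f_complete_def b_complete_def f_Cauchy_def b_Cauchy_def b_topology_def f_topology_def by simp

theorem corollary9p5:
  fixes D :: "('a,'b) pre_digraph" and \<delta> \<epsilon> :: real and f :: "real \<Rightarrow> real" and S :: "'a set"
  assumes "wf_digraph D"
    and "\<delta> \<ge> 0"
    and "hyperbolic D \<delta>"
    and "B1 D f" and "B2 D f"
    and "finite S" and "is_base D S"
    and "\<epsilon> > 0"
    and "exp (2 * \<epsilon> * (6 * \<delta> + 2 * \<delta> * f (\<delta> + 1))) < sqrt 2"
  shows "((\<forall>x\<in>verts D. finite_out_degree D x) \<and>
           semimetric_on (with_boundary D) (visual_dist D S \<epsilon>) \<longrightarrow>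
           f_complete (with_boundary D) (visual_dist D S \<epsilon>)) \<and>
         ((\<forall>x\<in>verts D. finite_in_degree D x) \<and>
           semimetric_on (with_boundary D) (visual_dist D S \<epsilon>) \<longrightarrow>
           b_complete (with_boundary D) (visual_dist D S \<epsilon>))"
proof (intro conjI impI; elim conjE)
  assume "\<forall>x\<in>verts D. finite_out_degree D x" "semimetric_on (with_boundary D) (visual_dist D S \<epsilon>)"
  then show "f_complete (with_boundary D) (visual_dist D S \<epsilon>)"
    using f_complete_hyperbolic_digraph assms by blast
next
  assume deg: "\<forall>x\<in>verts D. finite_in_degree D x"
    and sm: "semimetric_on (with_boundary D) (visual_dist D S \<epsilon>)"
  let ?D = "converse_digraph D"
  have dist: "visual_dist ?D S \<epsilon> = (\<lambda>\<eta> \<mu>. visual_dist D S \<epsilon> \<mu> \<eta>)"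
    by (intro ext visual_dist_converse)
  have "f_complete (with_boundary ?D) (visual_dist ?D S \<epsilon>)"
  proof (rule f_complete_hyperbolic_digraph)
    show "wf_digraph ?D" "hyperbolic ?D \<delta>" "B1 ?D f" "B2 ?D f" "is_base ?D S"
      using assms by (simp_all add: wf_converse hyperbolic_converse B1_converse B2_converse is_base_converse)
    show "\<forall>x\<in>verts ?D. finite_out_degree ?D x"
      using deg by (simp add: finite_out_degree_converse)
    show "semimetric_on (with_boundary ?D) (visual_dist ?D S \<epsilon>)"
      unfolding dist with_boundary_converse by (rule semimetric_on_transpose[OF sm])
  qed (use assms in auto)
  then show "b_complete (with_boundary D) (visual_dist D S \<epsilon>)"
    unfolding dist with_boundary_converse f_complete_transpose .
qed

end
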